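(* Let $\mathrm m\ge 1$ be an integer and let $L$ be an operator on a manifold $\mathsf M$ with $\mathcal T^{(\mathrm m)}_L=0$. Assume that at a point $\mathsf p\in\mathsf M$ its characteristic polynomial factorises as $\chi_{L(\mathsf p)}(\lambda)=p_1(\lambda)p_2(\lambda)$, where $p_1$ and $p_2$ are coprime monic real polynomials, and let $k=\deg p_1$, $s=\deg p_2$. Then, in a neighbourhood of $\mathsf p$, there exists a coordinate system $u=(u^1,\dots,u^k)$, $v=(v^1,\dots,v^s)$ such that: (i) the operator $L$ has the form $$L=\begin{pmatrix}A(u,v)&0_{k\times s}\\ 0_{s\times k}&B(u,v)\end{pmatrix};$$ (ii) $\mathcal T^{(\mathrm m)}_A=0$ with respect to $u$, and $\mathcal T^{(\mathrm m)}_B=0$ with respect to $v$; (iii) $\operatorname{ad}_A^{\mathrm m-1}A_{v^j}=0$ for all $j=1,\dots,s$, where $A_{v^j}=\frac{\partial A}{\partial v^j}$; (iv) $\operatorname{ad}_B^{\mathrm m-1}B_{u^i}=0$ for all $i=1,\dots,k$, where $B_{u^i}=\frac{\partial B}{\partial u^i}$. Moreover, every block diagonal operator of the form in (i) satisfying (ii), (iii), (iv) satisfies $\mathcal T^{(\mathrm m)}_L=0$.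
   Context: An operator (field) is a smooth $(1,1)$-tensor field, viewed as a field of endomorphisms of the tangent spaces. The generalised Nijenhuis torsion of level $\mathrm m$ of an operator $L$ is defined recursively by $$\mathcal T^{(1)}_L(\xi,\eta)=\mathcal N_L(\xi,\eta)=L^2[\xi,\eta]+[L\xi,L\eta]-L[L\xi,\eta]-L[\xi,L\eta],$$ $$\mathcal T^{(\mathrm m)}_L(\xi,\eta)=L^2\mathcal T^{(\mathrm m-1)}_L(\xi,\eta)+\mathcal T^{(\mathrm m-1)}_L(L\xi,L\eta)-L\mathcal T^{(\mathrm m-1)}_L(L\xi,\eta)-L\mathcal T^{(\mathrm m-1)}_L(\xi,L\eta),\quad \mathrm m\ge2.$$ For matrices, $\operatorname{ad}_L M=LM-ML$, and $\operatorname{ad}_L^0=\mathrm{Id}$. "With respect to $u$" means that for each fixed $v$ the matrix $A(\cdot,v)$ is viewed as an operator field in the coordinates $u^1,\dots,u^k$; similarly for $B$ with respect to $v$ (with $u$ fixed). *)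

theory Defs
  imports "HOL-Analysis.Analysis" "HOL-Computational_Algebra.Polynomial"
begin

subsection \<open>Smooth maps\<close>

primrec C_diff_on ::
  "nat \<Rightarrow> 'a::real_normed_vector set \<Rightarrow> ('a \<Rightarrow> 'b::real_normed_vector) \<Rightarrow> bool"
where
  "C_diff_on 0 S f \<longleftrightarrow> continuous_on S f"
| "C_diff_on (Suc n) S f \<longleftrightarrow>
     (\<forall>x\<in>S. f differentiable (at x)) \<and>
     (\<forall>v. C_diff_on n S (\<lambda>x. frechet_derivative f (at x) v))"

text \<open>Only meant for open \<open>S\<close>: the derivatives are two-sided.\<close>
definition smooth_on ::
  "'a::real_normed_vector set \<Rightarrow> ('a \<Rightarrow> 'b::real_normed_vector) \<Rightarrow> bool"
where
  "smooth_on S f \<longleftrightarrow> (\<forall>n. C_diff_on n S f)"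

subsection \<open>Manifolds and operator fields\<close>

type_synonym ('a, 'n) chart = "'a set \<times> ('a \<Rightarrow> real ^ 'n)"

definition is_chart :: "'a topology \<Rightarrow> ('a, 'n::finite) chart \<Rightarrow> bool" where
  "is_chart X c \<longleftrightarrow>
     openin X (fst c) \<and> open (snd c ` fst c) \<and>
     homeomorphic_map (subtopology X (fst c))
       (subtopology euclidean (snd c ` fst c)) (snd c)"

definition transition ::
  "('a, 'n::finite) chart \<Rightarrow> ('a, 'n) chart \<Rightarrow> real ^ 'n \<Rightarrow> real ^ 'n" where
  "transition c d = snd d \<circ> inv_into (fst c) (snd c)"

definition compatible :: "('a, 'n::finite) chart \<Rightarrow> ('a, 'n) chart \<Rightarrow> bool" where
  "compatible c d \<longleftrightarrow>
     smooth_on (snd c ` (fst c \<inter> fst d)) (transition c d) \<and>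
     smooth_on (snd d ` (fst c \<inter> fst d)) (transition d c)"

definition smooth_manifold :: "'a topology \<Rightarrow> ('a, 'n::finite) chart set \<Rightarrow> bool" where
  "smooth_manifold X \<A> \<longleftrightarrow>
     Hausdorff_space X \<and> second_countable X \<and>
     (\<forall>c\<in>\<A>. is_chart X c) \<and> (\<Union>c\<in>\<A>. fst c) = topspace X \<and>
     (\<forall>c\<in>\<A>. \<forall>d\<in>\<A>. compatible c d)"

text \<open>The maximal atlas generated by \<open>\<A>\<close>: its members are the local coordinate systems.\<close>
definition coordinate_systems ::
  "'a topology \<Rightarrow> ('a, 'n::finite) chart set \<Rightarrow> ('a, 'n) chart set" where
  "coordinate_systems X \<A> = {c. is_chart X c \<and> (\<forall>d\<in>\<A>. compatible c d)}"

text \<open>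
  A smooth \<open>(1,1)\<close>-tensor field is given by its component matrices: \<open>L c x\<close> is the matrix, in
  the coordinates \<open>c\<close>, of the endomorphism of the tangent space at the point with coordinates
  \<open>x\<close>. The last clause is the tensor transformation law
  \<open>L\<^sub>d (\<tau> x) = J (L\<^sub>c x) J\<^sup>-\<^sup>1\<close>, with \<open>J\<close> the Jacobian matrix of the transition map \<open>\<tau>\<close> at \<open>x\<close>.
\<close>
definition operator_field ::
  "'a topology \<Rightarrow> ('a, 'n::finite) chart set \<Rightarrow>
   (('a, 'n) chart \<Rightarrow> real ^ 'n \<Rightarrow> real ^ 'n ^ 'n) \<Rightarrow> bool"
where
  "operator_field X \<A> L \<longleftrightarrow>
     (\<forall>c\<in>coordinate_systems X \<A>. smooth_on (snd c ` fst c) (L c)) \<and>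
     (\<forall>c\<in>coordinate_systems X \<A>. \<forall>d\<in>coordinate_systems X \<A>.
        \<forall>x\<in>snd c ` (fst c \<inter> fst d).
          (let J = matrix (frechet_derivative (transition c d) (at x))
           in L d (transition c d x) ** J = J ** L c x))"

definition charpoly :: "real ^ 'n ^ 'n \<Rightarrow> real poly" where
  "charpoly M = det (\<chi> i j. (if i = j then [:0, 1:] else 0) - [:M $ i $ j:])"

text \<open>The existential is chart independent, since matrices in different charts are similar.\<close>
definition has_charpoly_at ::
  "'a topology \<Rightarrow> ('a, 'n::finite) chart set \<Rightarrow>
   (('a, 'n) chart \<Rightarrow> real ^ 'n \<Rightarrow> real ^ 'n ^ 'n) \<Rightarrow> 'a \<Rightarrow> real poly \<Rightarrow> bool"
where
  "has_charpoly_at X \<A> L p q \<longleftrightarrow>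
     (\<exists>c\<in>coordinate_systems X \<A>. p \<in> fst c \<and> charpoly (L c (snd c p)) = q)"

subsection \<open>Generalised Nijenhuis torsion\<close>

definition lie_bracket ::
  "(real ^ 'n \<Rightarrow> real ^ 'n) \<Rightarrow> (real ^ 'n \<Rightarrow> real ^ 'n) \<Rightarrow> real ^ 'n \<Rightarrow> real ^ 'n"
where
  "lie_bracket \<xi> \<eta> x =
     frechet_derivative \<eta> (at x) (\<xi> x) - frechet_derivative \<xi> (at x) (\<eta> x)"

definition app_field ::
  "(real ^ 'n \<Rightarrow> real ^ 'n ^ 'n) \<Rightarrow> (real ^ 'n \<Rightarrow> real ^ 'n) \<Rightarrow> real ^ 'n \<Rightarrow> real ^ 'n"
where
  "app_field L \<xi> x = L x *v \<xi> x"

text \<open>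
  Starting the recursion at level \<open>0\<close> with the Lie bracket makes level \<open>1\<close> the Nijenhuis torsion
  (lemma \<open>torsion_1\<close> below).
\<close>
primrec torsion ::
  "nat \<Rightarrow> (real ^ 'n \<Rightarrow> real ^ 'n ^ 'n) \<Rightarrow> (real ^ 'n \<Rightarrow> real ^ 'n) \<Rightarrow> (real ^ 'n \<Rightarrow> real ^ 'n) \<Rightarrow>
   real ^ 'n \<Rightarrow> real ^ 'n"
where
  "torsion 0 L \<xi> \<eta> = lie_bracket \<xi> \<eta>"
| "torsion (Suc m) L \<xi> \<eta> = (\<lambda>x.
     L x *v (L x *v torsion m L \<xi> \<eta> x) +
     torsion m L (app_field L \<xi>) (app_field L \<eta>) x -
     L x *v torsion m L (app_field L \<xi>) \<eta> x -
     L x *v torsion m L \<xi> (app_field L \<eta>) x)"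

lemma torsion_1:
  "torsion 1 L \<xi> \<eta> x =
     L x *v (L x *v lie_bracket \<xi> \<eta> x) + lie_bracket (app_field L \<xi>) (app_field L \<eta>) x -
     L x *v lie_bracket (app_field L \<xi>) \<eta> x - L x *v lie_bracket \<xi> (app_field L \<eta>) x"
  by simp

definition torsion_vanishes ::
  "nat \<Rightarrow> (real ^ 'n) set \<Rightarrow> (real ^ 'n \<Rightarrow> real ^ 'n ^ 'n) \<Rightarrow> bool"
where
  "torsion_vanishes m W L \<longleftrightarrow>
     (\<forall>\<xi> \<eta>. smooth_on W \<xi> \<longrightarrow> smooth_on W \<eta> \<longrightarrow> (\<forall>x\<in>W. torsion m L \<xi> \<eta> x = 0))"

text \<open>The torsion is a tensor, so on a manifold its vanishing is tested in local coordinates.\<close>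
definition operator_torsion_vanishes ::
  "nat \<Rightarrow> 'a topology \<Rightarrow> ('a, 'n::finite) chart set \<Rightarrow>
   (('a, 'n) chart \<Rightarrow> real ^ 'n \<Rightarrow> real ^ 'n ^ 'n) \<Rightarrow> bool"
where
  "operator_torsion_vanishes m X \<A> L \<longleftrightarrow>
     (\<forall>c\<in>coordinate_systems X \<A>. torsion_vanishes m (snd c ` fst c) (L c))"

subsection \<open>Block structure\<close>

text \<open>
  The coordinates \<open>x $ i\<close> are split into two groups by a set \<open>K\<close> of indices: those with \<open>i \<in> K\<close>
  are called \<open>u\<close> and those with \<open>i \<notin> K\<close> are called \<open>v\<close>. The diagonal block with rows and columns
  in \<open>K\<close> is kept as a matrix of full size, extended by zero. Products, commutators and
  derivatives of such matrices are the zero extensions of those of the blocks.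
\<close>
definition block :: "'n set \<Rightarrow> real ^ 'n ^ 'n \<Rightarrow> real ^ 'n ^ 'n" where
  "block K M = (\<chi> i j. if i \<in> K \<and> j \<in> K then M $ i $ j else 0)"

definition glue :: "'n set \<Rightarrow> real ^ 'n \<Rightarrow> real ^ 'n \<Rightarrow> real ^ 'n" where
  "glue K x y = (\<chi> i. if i \<in> K then x $ i else y $ i)"

text \<open>
  \<open>\<T>\<^sup>(\<^sup>m\<^sup>)\<^sub>A = 0\<close> with respect to the coordinates in \<open>K\<close>: the coordinates outside \<open>K\<close> are frozen at
  their values in \<open>y\<close>, and \<open>A\<close> acts on vector fields in the directions of \<open>K\<close>. The slice is
  represented by the cylinder of all \<open>x\<close> with \<open>glue K x y \<in> W\<close>; the components of \<open>x\<close> outside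
  \<open>K\<close> are dummies. Since all fields are directed along \<open>K\<close>, the Lie brackets differentiate in
  these directions only.
\<close>
definition torsion_vanishes_wrt ::
  "'n set \<Rightarrow> nat \<Rightarrow> (real ^ 'n) set \<Rightarrow> (real ^ 'n \<Rightarrow> real ^ 'n ^ 'n) \<Rightarrow> bool"
where
  "torsion_vanishes_wrt K m W A \<longleftrightarrow>
     (\<forall>y \<xi> \<eta>. let S = {x. glue K x y \<in> W} in
        smooth_on S \<xi> \<longrightarrow> smooth_on S \<eta> \<longrightarrow>
        (\<forall>x\<in>S. \<forall>i. i \<notin> K \<longrightarrow> \<xi> x $ i = 0 \<and> \<eta> x $ i = 0) \<longrightarrow>
        (\<forall>x\<in>S. torsion m (\<lambda>z. A (glue K z y)) \<xi> \<eta> x = 0))"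

definition ad :: "real ^ 'n ^ 'n \<Rightarrow> real ^ 'n ^ 'n \<Rightarrow> real ^ 'n ^ 'n" where
  "ad L M = L ** M - M ** L"

definition partial :: "'n \<Rightarrow> (real ^ 'n \<Rightarrow> real ^ 'n ^ 'n) \<Rightarrow> real ^ 'n \<Rightarrow> real ^ 'n ^ 'n" where
  "partial j F x = frechet_derivative F (at x) (axis j 1)"

definition block_diagonal_on ::
  "'n set \<Rightarrow> (real ^ 'n) set \<Rightarrow> (real ^ 'n \<Rightarrow> real ^ 'n ^ 'n) \<Rightarrow> bool"
where
  "block_diagonal_on K W L \<longleftrightarrow> (\<forall>x\<in>W. \<forall>i j. (i \<in> K) \<noteq> (j \<in> K) \<longrightarrow> L x $ i $ j = 0)"

text \<open>With \<open>A\<close> the block of \<open>L\<close> in \<open>K\<close>: \<open>ad\<^sub>A\<^sup>m\<^sup>-\<^sup>1 (\<partial>A/\<partial>v\<^sup>j) = 0\<close> for all coordinates \<open>v\<^sup>j\<close> outside \<open>K\<close>.\<close>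
definition ad_condition ::
  "'n set \<Rightarrow> nat \<Rightarrow> (real ^ 'n) set \<Rightarrow> (real ^ 'n \<Rightarrow> real ^ 'n ^ 'n) \<Rightarrow> bool"
where
  "ad_condition K m W L \<longleftrightarrow>
     (\<forall>j. j \<notin> K \<longrightarrow> (\<forall>x\<in>W.
        (ad (block K (L x)) ^^ (m - 1)) (partial j (\<lambda>z. block K (L z)) x) = 0))"

definition splitting_conditions ::
  "'n set \<Rightarrow> nat \<Rightarrow> (real ^ 'n) set \<Rightarrow> (real ^ 'n \<Rightarrow> real ^ 'n ^ 'n) \<Rightarrow> bool"
where
  "splitting_conditions K m W L \<longleftrightarrow>
     torsion_vanishes_wrt K m W (\<lambda>x. block K (L x)) \<and>
     torsion_vanishes_wrt (- K) m W (\<lambda>x. block (- K) (L x)) \<and>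
     ad_condition K m W L \<and>
     ad_condition (- K) m W L"

end

theory Submission
  imports Defs
    "HOL-Computational_Algebra.Field_as_Ring"
    "HOL-Computational_Algebra.Polynomial_Factorial"
begin

text \<open>
  The splitting of the tangent space at \<open>p\<close> given by \<open>p\<^sub>1 p\<^sub>2\<close> extends to a smooth splitting into
  \<open>L\<close>-invariant distributions (a Riccati equation). Since
  \<open>\<T>\<^sup>(\<^sup>m\<^sup>) = (L - R\<^sub>1)\<^sup>m (L - R\<^sub>2)\<^sup>m [\<cdot>, \<cdot>]\<close>, where \<open>R\<^sub>i\<close> inserts \<open>L\<close> into the \<open>i\<close>-th argument, and since
  the bracket of two sections of one distribution is a tensor modulo that distribution, on which
  \<open>L - R\<^sub>i\<close> is injective because the two spectra are disjoint, both distributions are involutive.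
  The Frobenius theorem then gives \<open>u\<close> and \<open>v\<close>. In these coordinates \<open>\<T>\<^sup>(\<^sup>m\<^sup>)\<close> restricts to the torsions
  of \<open>A\<close> and \<open>B\<close>, and the \<open>u\<close>-part of \<open>\<T>\<^sup>(\<^sup>m\<^sup>)(\<xi>, \<eta>)\<close>, with \<open>\<xi>\<close> along \<open>u\<close> and \<open>\<eta>\<close> along \<open>v\<close>, is
  \<open>(L - R\<^sub>2)\<^sup>m\<close> applied to \<open>ad\<^sub>A\<^sup>m\<^sup>-\<^sup>1 (D\<^sub>\<eta> A) \<xi>\<close>.

  The analytic input is the smoothness of solutions of \<open>f x = \<integral>\<^sub>0\<^sup>1 H (s, x, f (\<sigma>\<^sub>s x)) ds\<close>, where \<open>\<sigma>\<^sub>s\<close>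
  shrinks a subspace by the factor \<open>s\<close>: with the trivial subspace this solves the Riccati equation,
  and with a coordinate subspace it integrates commuting vector fields along rays.
\<close>

subsection \<open>Calculus of smooth maps\<close>

text \<open>Real matrices may have complex eigenvalues, so disjointness of the two spectra is never
  stated through eigenvalues. It is encoded as \<open>separated\<close>: every matrix commuting with
  \<open>M\<close> is block diagonal. Bezout coefficients of \<open>p1\<close> and \<open>p2\<close>
  provide it at the base point, because the spectral idempotent is a polynomial in the operator; it
  is an open condition, being injectivity of a Sylvester map; and through
  \<open>sylvester_zero\<close> it removes the factors \<open>L - R_i\<close> one at a time.
  Involutivity alone does not yield coordinates directly. Normalising the frame so that its
  components along its own index set are constant makes the frame fields commute, which is the form
  that the fixed point equation can integrate. Two demands of the statement shape the final chart.
  The set \<open>K\<close> is prescribed with \<open>degree p1\<close> elements, so the rank of the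
  spectral idempotent has to be identified with this degree. And condition (ii) tests fields that
  live on a single slice only; these must extend to the whole chart, which is why its image is
  finally cut down to a cube.\<close>

abbreviation fderiv :: "('a::real_normed_vector \<Rightarrow> 'b::real_normed_vector) \<Rightarrow> 'a \<Rightarrow> 'a \<Rightarrow> 'b" where
  "fderiv f x \<equiv> frechet_derivative f (at x)"

lemma frechet_derivative_cong_open:
  assumes "open S" "x \<in> S" "\<And>y. y \<in> S \<Longrightarrow> f y = g y"
  shows "fderiv f x = fderiv g x"
proof -
  have "(f has_derivative f') (at x) \<longleftrightarrow> (g has_derivative f') (at x)" for f'
    using assms by (metis has_derivative_transform_within_open)
  then show ?thesis by (simp add: frechet_derivative_def)
qed

lemma frechet_derivativeI:
  "(f has_derivative f') (at x) \<Longrightarrow> fderiv f x = f'"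
  by (metis frechet_derivative_at)

lemma C_diff_on_cong:
  assumes "open S" "\<And>x. x \<in> S \<Longrightarrow> f x = g x" "C_diff_on n S f"
  shows "C_diff_on n S g"
  using assms(2,3)
proof (induction n arbitrary: f g)
  case 0
  then show ?case by (simp cong: continuous_on_cong)
next
  case (Suc n)
  have D: "fderiv f x = fderiv g x" if "x \<in> S" for x
    using frechet_derivative_cong_open[OF assms(1) that] Suc.prems(1) by blast
  have "g differentiable (at x)" if "x \<in> S" for x
    using Suc.prems that assms(1) unfolding differentiable_def C_diff_on.simps
    by (metis has_derivative_transform_within_open)
  moreover have "C_diff_on n S (\<lambda>x. fderiv g x v)" for v
    using Suc.IH[of "\<lambda>x. fderiv f x v"] D Suc.prems(2) by simp
  ultimately show ?case by simp
qed

text \<open>\<open>C_diff_on\<close> is phrased with \<open>frechet_derivative\<close>; here an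
  explicit derivative takes its place. This is the usual induction step of the closure proofs
  below.\<close>

lemma C_diff_on_SucI:
  assumes "open S" "\<And>x. x \<in> S \<Longrightarrow> (f has_derivative f' x) (at x)"
    "\<And>v. C_diff_on n S (\<lambda>x. f' x v)"
  shows "C_diff_on (Suc n) S f"
proof -
  have "f' x v = fderiv f x v" if "x \<in> S" for x v
    using frechet_derivativeI[OF assms(2)[OF that]] by simp
  then have "C_diff_on n S (\<lambda>x. fderiv f x v)" for v
    by (intro C_diff_on_cong[OF assms(1) _ assms(3)]) auto
  then show ?thesis using assms(2) by (auto simp: differentiable_def)
qed

lemma C_diff_on_SucD:
  assumes "C_diff_on (Suc n) S f"
  shows "C_diff_on n S f"
  using assms
proof (induction n arbitrary: f)
  case 0
  then show ?case
    by (auto intro!: continuous_at_imp_continuous_on differentiable_imp_continuous_within)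
next
  case (Suc n)
  then show ?case by (auto simp del: C_diff_on.simps(1))
qed

lemma C_diff_on_le: "C_diff_on n S f \<Longrightarrow> m \<le> n \<Longrightarrow> C_diff_on m S f"
  by (induction n) (use C_diff_on_SucD le_Suc_eq in blast)+

lemma C_diff_on_continuous: "C_diff_on n S f \<Longrightarrow> continuous_on S f"
  using C_diff_on_le[of n S f 0] by simp

lemma C_diff_on_subset: "C_diff_on n S f \<Longrightarrow> T \<subseteq> S \<Longrightarrow> C_diff_on n T f"
proof (induction n arbitrary: f)
  case 0 then show ?case by (auto intro: continuous_on_subset)
next
  case (Suc n) then show ?case by (auto simp: subset_iff)
qed

lemma C_diff_on_const: "open S \<Longrightarrow> C_diff_on n S (\<lambda>x. c)"
proof (induction n arbitrary: c)
  case (Suc n)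
  show ?case by (rule C_diff_on_SucI[where f' = "\<lambda>x v. 0"]) (use Suc in auto)
qed simp

lemma C_diff_on_linear:
  assumes "open S" "bounded_linear f"
  shows "C_diff_on n S f"
proof (cases n)
  case 0 then show ?thesis using assms by (simp add: linear_continuous_on)
next
  case (Suc k)
  then show ?thesis
    using assms by (auto intro!: C_diff_on_SucI[where f' = "\<lambda>x. f"] C_diff_on_const bounded_linear_imp_has_derivative
        simp del: C_diff_on.simps)
qed

lemma C_diff_on_has_derivative:
  "C_diff_on (Suc n) S f \<Longrightarrow> x \<in> S \<Longrightarrow> (f has_derivative fderiv f x) (at x)"
  by (simp add: frechet_derivative_works)

lemma C_diff_on_derivative:
  "C_diff_on (Suc n) S f \<Longrightarrow> C_diff_on n S (\<lambda>x. fderiv f x v)"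
  by simp

lemma C_diff_on_add:
  assumes "open S" "C_diff_on n S f" "C_diff_on n S g"
  shows "C_diff_on n S (\<lambda>x. f x + g x)"
  using assms(2,3)
proof (induction n arbitrary: f g)
  case 0 then show ?case by (auto intro: continuous_on_add)
next
  case (Suc n)
  show ?case
    by (rule C_diff_on_SucI[OF assms(1) has_derivative_add[OF
       C_diff_on_has_derivative[OF Suc.prems(1)] C_diff_on_has_derivative[OF Suc.prems(2)]]])
      (use Suc in auto)
qed

lemma C_diff_on_linear_compose:
  assumes "open S" "bounded_linear h" "C_diff_on n S f"
  shows "C_diff_on n S (\<lambda>x. h (f x))"
  using assms(3)
proof (induction n arbitrary: f)
  case 0 then show ?case using assms(2) by (auto intro: bounded_linear.continuous_on)
next
  case (Suc n)
  show ?case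
    by (rule C_diff_on_SucI[OF assms(1) bounded_linear.has_derivative[OF assms(2)
       C_diff_on_has_derivative[OF Suc.prems]]])
      (use Suc in auto)
qed

lemma C_diff_on_bilinear:
  assumes "open S" "bounded_bilinear h" "C_diff_on n S f" "C_diff_on n S g"
  shows "C_diff_on n S (\<lambda>x. h (f x) (g x))"
  using assms(3,4)
proof (induction n arbitrary: f g)
  case 0 then show ?case using assms(2) by (auto intro: bounded_bilinear.continuous_on)
next
  case (Suc n)
  note C_diff_on_SucD[OF Suc.prems(1)] C_diff_on_SucD[OF Suc.prems(2)]
  then show ?case
    by (intro C_diff_on_SucI[OF assms(1) bounded_bilinear.FDERIV[OF assms(2)
       C_diff_on_has_derivative[OF Suc.prems(1)] C_diff_on_has_derivative[OF Suc.prems(2)]]])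
      (use Suc in \<open>auto intro!: C_diff_on_add[OF assms(1)]\<close>)
qed

lemma C_diff_on_sum:
  assumes "open S" "\<And>i. i \<in> I \<Longrightarrow> C_diff_on n S (f i)"
  shows "C_diff_on n S (\<lambda>x. \<Sum>i\<in>I. f i x)"
  using assms(2)
  by (induction I rule: infinite_finite_induct)
    (auto intro!: C_diff_on_const C_diff_on_add assms(1))

lemma C_diff_on_prod:
  fixes f :: "'i \<Rightarrow> 'a::real_normed_vector \<Rightarrow> 'b::{real_normed_field}"
  assumes "open S" "\<And>i. i \<in> I \<Longrightarrow> C_diff_on n S (f i)"
  shows "C_diff_on n S (\<lambda>x. \<Prod>i\<in>I. f i x)"
  using assms(2)
  by (induction I rule: infinite_finite_induct)
    (auto intro!: C_diff_on_const C_diff_on_bilinear[OF _ bounded_bilinear_mult] assms(1))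

lemma C_diff_on_minus:
  assumes "open S" "C_diff_on n S f"
  shows "C_diff_on n S (\<lambda>x. - f x)"
  by (rule C_diff_on_linear_compose[OF assms(1) _ assms(2)])
    (simp add: bounded_linear_minus bounded_linear_ident)

lemma C_diff_on_diff:
  assumes "open S" "C_diff_on n S f" "C_diff_on n S g"
  shows "C_diff_on n S (\<lambda>x. f x - g x)"
  using C_diff_on_add[OF assms(1,2) C_diff_on_minus[OF assms(1,3)]] by simp

lemma C_diff_on_Pair:
  assumes "open S" "C_diff_on n S f" "C_diff_on n S g"
  shows "C_diff_on n S (\<lambda>x. (f x, g x))"
proof -
  have "C_diff_on n S (\<lambda>x. (f x, 0) + (0, g x))"
    by (intro C_diff_on_add assms C_diff_on_linear_compose[OF assms(1) _ assms(2)]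
        C_diff_on_linear_compose[OF assms(1) _ assms(3)] bounded_linear_Pair
        bounded_linear_ident bounded_linear_zero)
  then show ?thesis by simp
qed

lemma linear_basis_expand:
  fixes f :: "'a::euclidean_space \<Rightarrow> 'b::real_normed_vector"
  assumes "bounded_linear f"
  shows "f v = (\<Sum>i\<in>Basis. (v \<bullet> i) *\<^sub>R f i)"
proof -
  interpret bounded_linear f by fact
  have "f v = f (\<Sum>i\<in>Basis. (v \<bullet> i) *\<^sub>R i)" by (simp add: euclidean_representation)
  then show ?thesis by (simp add: sum scaleR)
qed

text \<open>A derivative is only known to be differentiable in each fixed direction. Expanding the
  argument in a basis turns a varying direction into finitely many fixed ones, which is why the
  chain rule below asks for a Euclidean intermediate space.\<close>

lemma C_diff_on_apply:
  fixes A :: "'a::real_normed_vector \<Rightarrow> 'b::euclidean_space \<Rightarrow> 'c::real_normed_vector"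
  assumes "open S" "\<And>x. x \<in> S \<Longrightarrow> bounded_linear (A x)"
    "\<And>i. i \<in> Basis \<Longrightarrow> C_diff_on n S (\<lambda>x. A x i)" "C_diff_on n S w"
  shows "C_diff_on n S (\<lambda>x. A x (w x))"
proof -
  have "C_diff_on n S (\<lambda>x. \<Sum>i\<in>Basis. (w x \<bullet> i) *\<^sub>R A x i)"
    using assms
    by (intro C_diff_on_sum C_diff_on_bilinear[OF _ bounded_bilinear_scaleR]
        C_diff_on_linear_compose[OF _ bounded_linear_inner_left]) auto
  then show ?thesis
    by (rule C_diff_on_cong[OF assms(1), rotated]) (metis linear_basis_expand assms(2))
qed

text \<open>By the chain rule, the derivative of the composite is built from the derivative of
  \<open>f\<close> and from composites of directional derivatives of \<open>g\<close> with the same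
  \<open>f\<close>. Hence the induction generalises over \<open>g\<close> and keeps
  \<open>f\<close>.\<close>

lemma C_diff_on_compose:
  fixes g :: "'b::euclidean_space \<Rightarrow> 'c::real_normed_vector"
  assumes "open S" "open T" "C_diff_on n S f" "C_diff_on n T g" "f ` S \<subseteq> T"
  shows "C_diff_on n S (\<lambda>x. g (f x))"
  using assms(3,4)
proof (induction n arbitrary: g)
  case 0 then show ?case using assms(5) by (auto intro: continuous_on_compose2)
next
  case (Suc n)
  have fx: "f x \<in> T" if "x \<in> S" for x using that assms(5) by auto
  have D: "((\<lambda>x. g (f x)) has_derivative
     (\<lambda>v. fderiv g (f x) (fderiv f x v))) (at x)" if "x \<in> S" for x
    by (rule has_derivative_compose[OF C_diff_on_has_derivative[OF Suc.prems(1) that]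
        C_diff_on_has_derivative[OF Suc.prems(2) fx[OF that]]])
  show ?case
  proof (rule C_diff_on_SucI[OF assms(1) D])
    fix v
    show "C_diff_on n S (\<lambda>x. fderiv g (f x) (fderiv f x v))"
    proof (rule C_diff_on_apply[OF assms(1)])
      show "bounded_linear (fderiv g (f x))" if "x \<in> S" for x
        using C_diff_on_has_derivative[OF Suc.prems(2) fx[OF that]] has_derivative_bounded_linear by blast
      show "C_diff_on n S (\<lambda>x. fderiv g (f x) i)" for i
        using Suc.IH[OF C_diff_on_SucD[OF Suc.prems(1)] C_diff_on_derivative[OF Suc.prems(2)]] .
      show "C_diff_on n S (\<lambda>x. fderiv f x v)"
        using C_diff_on_derivative[OF Suc.prems(1)] .
    qed
  qed
qed

lemma C_diff_on_inverse:
  fixes f :: "'a::real_normed_vector \<Rightarrow> real"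
  assumes "open S" "C_diff_on n S f" "\<And>x. x \<in> S \<Longrightarrow> f x \<noteq> 0"
  shows "C_diff_on n S (\<lambda>x. inverse (f x))"
  using assms(2)
proof (induction n)
  case 0 then show ?case using assms(3) by (auto intro: continuous_intros)
next
  case (Suc n)
  have D: "((\<lambda>x. inverse (f x)) has_derivative
     (\<lambda>v. - (inverse (f x) * fderiv f x v * inverse (f x)))) (at x)" if "x \<in> S" for x
    by (rule Deriv.has_derivative_inverse[OF assms(3)[OF that] C_diff_on_has_derivative[OF Suc.prems that]])
  note IH = Suc.IH[OF C_diff_on_SucD[OF Suc.prems]]
  show ?case
    by (rule C_diff_on_SucI[OF assms(1) D])
      (use Suc.prems IH in \<open>auto intro!: C_diff_on_minus C_diff_on_bilinear[OF _ bounded_bilinear_mult] assms(1)\<close>)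
qed

lemma C_diff_on_vec_nth:
  "open S \<Longrightarrow> C_diff_on n S f \<Longrightarrow> C_diff_on n S (\<lambda>x. f x $ i)"
  by (rule C_diff_on_linear_compose[OF _ bounded_linear_vec_nth])

lemma C_diff_on_vec_lambda:
  fixes f :: "'a::real_normed_vector \<Rightarrow> 'i::finite \<Rightarrow> 'b::euclidean_space"
  assumes "open S" "\<And>i. C_diff_on n S (\<lambda>x. f x i)"
  shows "C_diff_on n S (\<lambda>x. \<chi> i. f x i)"
proof -
  have "C_diff_on n S (\<lambda>x. \<Sum>i\<in>UNIV. axis i (f x i))"
    by (intro C_diff_on_sum assms C_diff_on_linear_compose[OF assms(1) _ assms(2)]
        linear_conv_bounded_linear[THEN iffD1] linearI)
      (auto simp: vec_eq_iff axis_def)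
  moreover have "(\<Sum>i\<in>UNIV. axis i (f x i)) = (\<chi> i. f x i)" for x
    by (simp add: vec_eq_iff axis_def sum.delta)
  ultimately show ?thesis by simp
qed

lemma bounded_bilinear_matrix_vector_mult:
  "bounded_bilinear ((*v) :: real^'n^'m \<Rightarrow> real^'n \<Rightarrow> real^'m)"
  unfolding bilinear_conv_bounded_bilinear[symmetric]
  by (auto simp: bilinear_def linear_iff matrix_vector_mult_def vec_eq_iff sum.distrib
      sum_distrib_left algebra_simps)

lemma bounded_bilinear_matrix_matrix_mult:
  "bounded_bilinear ((**) :: real^'n^'m \<Rightarrow> real^'k^'n \<Rightarrow> real^'k^'m)"
  unfolding bilinear_conv_bounded_bilinear[symmetric]
  by (auto simp: bilinear_def linear_iff matrix_matrix_mult_def vec_eq_iff sum.distrib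
      sum_distrib_left algebra_simps)

lemma C_diff_on_det:
  fixes f :: "'a::real_normed_vector \<Rightarrow> real^'n^'n"
  assumes "open S" "\<And>i j. C_diff_on n S (\<lambda>x. f x $ i $ j)"
  shows "C_diff_on n S (\<lambda>x. det (f x))"
  unfolding det_def
  by (intro C_diff_on_sum assms C_diff_on_bilinear[OF _ bounded_bilinear_mult]
      C_diff_on_prod C_diff_on_const)

lemma matrix_inv_mult:
  fixes A :: "real^'n^'n"
  assumes "invertible A"
  shows "A ** matrix_inv A = mat 1" "matrix_inv A ** A = mat 1"
  using someI_ex[of "\<lambda>A'. A ** A' = mat 1 \<and> A' ** A = mat 1"] assms
  by (auto simp: invertible_def matrix_inv_def)

text \<open>Cramer's rule writes the entries of the inverse as quotients of determinants, so the
  inverse inherits differentiability of every order from products, sums and reciprocals.\<close>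

lemma matrix_inv_cramer:
  fixes A :: "real^'n^'n"
  assumes "det A \<noteq> 0"
  shows "matrix_inv A $ k $ j = det (\<chi> i l. if l = k then axis j 1 $ i else A $ i $ l) / det A"
proof -
  have "invertible A" using assms by (simp add: invertible_det_nz)
  then have "A *v (matrix_inv A *v axis j 1) = axis j 1"
    by (metis matrix_inv_mult(1) matrix_vector_mul_assoc matrix_vector_mul_lid)
  then have "matrix_inv A *v axis j 1 = (\<chi> k. det (\<chi> i l. if l = k then axis j 1 $ i else A $ i $ l) / det A)"
    using cramer[OF assms] by blast
  then show ?thesis
    by (simp add: matrix_vector_mult_basis column_def vec_eq_iff)
qed

lemma C_diff_on_matrix_inv:
  fixes f :: "'a::real_normed_vector \<Rightarrow> real^'n^'n"
  assumes "open S" "C_diff_on n S f" "\<And>x. x \<in> S \<Longrightarrow> invertible (f x)"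
  shows "C_diff_on n S (\<lambda>x. matrix_inv (f x))"
proof -
  have d: "det (f x) \<noteq> 0" if "x \<in> S" for x using assms(3)[OF that] by (simp add: invertible_det_nz)
  have f: "C_diff_on n S (\<lambda>x. f x $ i $ j)" for i j
    by (intro C_diff_on_vec_nth assms)
  have "C_diff_on n S (\<lambda>x. \<chi> k j. det (\<chi> i l. if l = k then axis j 1 $ i else f x $ i $ l) * inverse (det (f x)))"
  proof (intro C_diff_on_vec_lambda assms(1) C_diff_on_bilinear[OF _ bounded_bilinear_mult] C_diff_on_inverse
      C_diff_on_det f d)
    fix i l j k
    show "C_diff_on n S (\<lambda>x. (\<chi> i l. if l = k then axis j 1 $ i else f x $ i $ l) $ i $ l)"
      using f by (cases "l = k") (auto intro: C_diff_on_const assms(1))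
  qed
  then show ?thesis
    by (rule C_diff_on_cong[OF assms(1), rotated])
      (simp add: vec_eq_iff matrix_inv_cramer d divide_inverse)
qed

section \<open>Rules for \<open>smooth_on\<close>\<close>

lemma smooth_on_cong: "open S \<Longrightarrow> (\<And>x. x \<in> S \<Longrightarrow> f x = g x) \<Longrightarrow> smooth_on S f \<Longrightarrow> smooth_on S g"
  unfolding smooth_on_def using C_diff_on_cong by blast

lemma smooth_on_subset: "smooth_on S f \<Longrightarrow> T \<subseteq> S \<Longrightarrow> smooth_on T f"
  unfolding smooth_on_def using C_diff_on_subset by blast

lemma smooth_on_continuous: "smooth_on S f \<Longrightarrow> continuous_on S f"
  unfolding smooth_on_def using C_diff_on_continuous by blast

lemma smooth_on_has_derivative:
  "smooth_on S f \<Longrightarrow> x \<in> S \<Longrightarrow> (f has_derivative fderiv f x) (at x)"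
  unfolding smooth_on_def using C_diff_on_has_derivative by blast

lemma smooth_on_bounded_linear:
  "smooth_on S f \<Longrightarrow> x \<in> S \<Longrightarrow> bounded_linear (fderiv f x)"
  using smooth_on_has_derivative has_derivative_bounded_linear by blast

lemma smooth_on_derivative: "smooth_on S f \<Longrightarrow> smooth_on S (\<lambda>x. fderiv f x v)"
  unfolding smooth_on_def using C_diff_on_derivative by blast

lemma smooth_on_const: "open S \<Longrightarrow> smooth_on S (\<lambda>x. c)"
  unfolding smooth_on_def using C_diff_on_const by blast

lemma smooth_on_linear: "open S \<Longrightarrow> bounded_linear f \<Longrightarrow> smooth_on S f"
  unfolding smooth_on_def using C_diff_on_linear by blast

lemma smooth_on_add:
  "open S \<Longrightarrow> smooth_on S f \<Longrightarrow> smooth_on S g \<Longrightarrow> smooth_on S (\<lambda>x. f x + g x)"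
  unfolding smooth_on_def using C_diff_on_add by blast

lemma smooth_on_diff:
  "open S \<Longrightarrow> smooth_on S f \<Longrightarrow> smooth_on S g \<Longrightarrow> smooth_on S (\<lambda>x. f x - g x)"
  unfolding smooth_on_def using C_diff_on_diff by blast

lemma smooth_on_linear_compose:
  "open S \<Longrightarrow> bounded_linear h \<Longrightarrow> smooth_on S f \<Longrightarrow> smooth_on S (\<lambda>x. h (f x))"
  unfolding smooth_on_def using C_diff_on_linear_compose by blast

lemma smooth_on_bilinear:
  "open S \<Longrightarrow> bounded_bilinear h \<Longrightarrow> smooth_on S f \<Longrightarrow> smooth_on S g \<Longrightarrow> smooth_on S (\<lambda>x. h (f x) (g x))"
  unfolding smooth_on_def using C_diff_on_bilinear by blast

lemma smooth_on_compose:
  fixes g :: "'b::euclidean_space \<Rightarrow> 'c::real_normed_vector"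
  shows "open S \<Longrightarrow> open T \<Longrightarrow> smooth_on S f \<Longrightarrow> smooth_on T g \<Longrightarrow> f ` S \<subseteq> T \<Longrightarrow> smooth_on S (\<lambda>x. g (f x))"
  unfolding smooth_on_def using C_diff_on_compose by blast

lemma smooth_on_matrix_mult:
  fixes F :: "'a::real_normed_vector \<Rightarrow> real^'n^'m" and G :: "'a \<Rightarrow> real^'k^'n"
  shows "open S \<Longrightarrow> smooth_on S F \<Longrightarrow> smooth_on S G \<Longrightarrow> smooth_on S (\<lambda>x. F x ** G x)"
  by (rule smooth_on_bilinear[OF _ bounded_bilinear_matrix_matrix_mult])

lemma smooth_on_matrix_vector_mult:
  fixes F :: "'a::real_normed_vector \<Rightarrow> real^'n^'m"
  shows "open S \<Longrightarrow> smooth_on S F \<Longrightarrow> smooth_on S g \<Longrightarrow> smooth_on S (\<lambda>x. F x *v g x)"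
  by (rule smooth_on_bilinear[OF _ bounded_bilinear_matrix_vector_mult])

subsection \<open>Smooth inverse functions\<close>

text \<open>Bootstrapping: the derivative of \<open>g\<close> at \<open>y\<close> is the inverse
  Jacobian of \<open>f\<close> at \<open>g y\<close>, so it is as often differentiable as
  \<open>g\<close> itself, and each round gains one order. The formula for the derivative is
  exported because straightening maps arise below as inverses of flow maps.\<close>

lemma smooth_inverse_function:
  fixes f :: "real^'n \<Rightarrow> real^'n"
  assumes S: "open S" "smooth_on S f" "x0 \<in> S" and inj: "inj (fderiv f x0)"
  obtains U V g where "open U" "U \<subseteq> S" "x0 \<in> U" "open V" "homeomorphism U V f g" "smooth_on V g"
    "\<And>x. x \<in> U \<Longrightarrow> bij (fderiv f x)"
    "\<And>x. x \<in> U \<Longrightarrow> (g has_derivative inv (fderiv f x)) (at (f x))"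
proof -
  let ?D = "\<lambda>x. fderiv f x"
  define f' where "f' x = Blinfun (?D x)" for x
  have f': "blinfun_apply (f' x) = ?D x" if "x \<in> S" for x
    using bounded_linear_Blinfun_apply[OF smooth_on_bounded_linear[OF S(2) that]] by (simp add: f'_def)
  have der: "(f has_derivative blinfun_apply (f' x)) (at x)" if "x \<in> S" for x
    using smooth_on_has_derivative[OF S(2) that] f'[OF that] by simp
  have cont: "continuous_on S f'"
  proof (rule continuous_on_blinfun_componentwise)
    fix i :: "real^'n" assume "i \<in> Basis"
    show "continuous_on S (\<lambda>x. blinfun_apply (f' x) i)"
      using smooth_on_continuous[OF smooth_on_derivative[OF S(2), of i]] f'
      by (simp cong: continuous_on_cong)
  qed
  obtain h where h: "linear h" "h \<circ> ?D x0 = id"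
    using linear_injective_left_inverse[OF bounded_linear.linear[OF smooth_on_bounded_linear[OF S(2,3)]] inj]
    by blast
  have "Blinfun h o\<^sub>L f' x0 = id_blinfun"
    using h f'[OF S(3)]
    by (intro blinfun_eqI) (simp add: bounded_linear_Blinfun_apply linear_conv_bounded_linear o_def fun_eq_iff)
  from inverse_function_theorem[OF S(1) der cont S(3) this]
  obtain U V g g' where *: "open U" "U \<subseteq> S" "x0 \<in> U" "open V" "f x0 \<in> V" "homeomorphism U V f g"
    "\<And>y. y \<in> V \<Longrightarrow> (g has_derivative (g' y)) (at y)"
    "\<And>y. y \<in> V \<Longrightarrow> g' y = inv (blinfun_apply (f'(g y)))"
    "\<And>y. y \<in> V \<Longrightarrow> bij (blinfun_apply (f'(g y)))" by blast
  have gU: "g y \<in> U" if "y \<in> V" for y using *(6) that by (auto simp: homeomorphism_def)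
  then have gS: "g y \<in> S" if "y \<in> V" for y using *(2) that by auto
  have fV: "f x \<in> V" "g (f x) = x" if "x \<in> U" for x using *(6) that by (auto simp: homeomorphism_def)
  have bij: "bij (?D x)" if "x \<in> U" for x
    using *(9)[OF fV(1)[OF that]] fV(2)[OF that] f'[of x] that *(2) by auto
  let ?M = "\<lambda>x. matrix (?D x)"
  have lin: "linear (?D x)" if "x \<in> S" for x
    using smooth_on_bounded_linear[OF S(2) that] bounded_linear.linear by blast
  have M: "invertible (?M x)" "inv (?D x) v = matrix_inv (?M x) *v v" if "x \<in> U" for x v
  proof -
    have l: "linear (?D x)" using lin that *(2) by auto
    have "inj (\<lambda>v. ?M x *v v)" using bij[OF that] matrix_vector_mul(2)[OF l] by (simp add: bij_def)
    then show i: "invertible (?M x)"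
      using invertible_left_inverse matrix_left_invertible_injective by blast
    have "?D x (matrix_inv (?M x) *v v) = v"
      using fun_cong[OF matrix_vector_mul(2)[OF l]] matrix_inv_mult[OF i] by (metis matrix_vector_mul_assoc matrix_vector_mul_lid)
    then show "inv (?D x) v = matrix_inv (?M x) *v v"
      using bij[OF that] by (metis bij_inv_eq_iff)
  qed
  have D: "(g has_derivative (\<lambda>v. matrix_inv (?M (g y)) *v v)) (at y)" if "y \<in> V" for y
    using *(7,8)[OF that] f'[OF gS[OF that]] M(2)[OF gU[OF that]] by (simp add: fun_eq_iff)
      (metis (no_types, lifting) ext)
  have SM: "smooth_on S ?M"
  proof -
    have "C_diff_on n S ?M" for n
      unfolding matrix_def
      by (intro C_diff_on_vec_lambda C_diff_on_vec_nth S(1))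
        (use smooth_on_derivative[OF S(2)] in \<open>auto simp: smooth_on_def\<close>)
    then show ?thesis by (simp add: smooth_on_def)
  qed
  have g: "C_diff_on n V g" for n
  proof (induction n)
    case 0 then show ?case
      using *(6) by (simp add: homeomorphism_def)
  next
    case (Suc n)
    show ?case
    proof (rule C_diff_on_SucI[OF \<open>open V\<close> D])
      fix v
      have "C_diff_on n V (\<lambda>y. ?M (g y))"
        by (rule C_diff_on_compose[OF \<open>open V\<close> S(1) Suc.IH]) (use SM gS in \<open>auto simp: smooth_on_def\<close>)
      then show "C_diff_on n V (\<lambda>y. matrix_inv (?M (g y)) *v v)"
        by (intro C_diff_on_bilinear[OF _ bounded_bilinear_matrix_vector_mult] C_diff_on_matrix_inv
            C_diff_on_const \<open>open V\<close>) (use M gU in auto)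
    qed
  qed
  show ?thesis
  proof (rule that[OF *(1-4) *(6) _ bij])
    show "smooth_on V g" using g by (simp add: smooth_on_def)
    show "(g has_derivative inv (?D x)) (at (f x))" if "x \<in> U" for x
      using *(7,8)[OF fV(1)[OF that]] fV(2)[OF that] f'[of x] that *(2) by auto
  qed
qed

subsection \<open>Smooth solutions of integral fixed point equations\<close>

lemma integral_norm_le_01:
  fixes f :: "real \<Rightarrow> 'e::banach"
  assumes "f integrable_on {0..1}" "\<And>s. s \<in> {0..1} \<Longrightarrow> norm (f s) \<le> B"
  shows "norm (integral {0..1} f) \<le> B"
proof -
  have "norm (integral {0..1} f) \<le> integral {0..1::real} (\<lambda>_. B)"
    by (rule integral_norm_bound_integral[OF assms(1) _ assms(2)]) auto
  then show ?thesis by simp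
qed

text \<open>Picard iteration. The interval has length 1, so the Lipschitz constant 1/2 of
  \<open>H\<close> makes the integral operator halve distances in the supremum norm over
  \<open>U\<close>.\<close>

lemma integral_fixpoint_exists:
  fixes U :: "'p::metric_space set" and \<sigma> :: "real \<Rightarrow> 'p \<Rightarrow> 'p"
    and H :: "real \<Rightarrow> 'p \<Rightarrow> 'e::banach \<Rightarrow> 'e"
  assumes U: "compact U"
    and \<sigma>: "continuous_on ({0..1} \<times> U) (\<lambda>(s, x). \<sigma> s x)" "\<And>s x. s \<in> {0..1} \<Longrightarrow> x \<in> U \<Longrightarrow> \<sigma> s x \<in> U"
    and W: "closed W" "w0 \<in> W"
    and H: "continuous_on ({0..1} \<times> U \<times> W) (\<lambda>(s, x, w). H s x w)"
    and lip: "\<And>s x w w'. s \<in> {0..1} \<Longrightarrow> x \<in> U \<Longrightarrow> w \<in> W \<Longrightarrow> w' \<in> W \<Longrightarrow>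
      norm (H s x w - H s x w') \<le> norm (w - w') / 2"
    and inv: "\<And>f x. continuous_on U f \<Longrightarrow> f ` U \<subseteq> W \<Longrightarrow> x \<in> U \<Longrightarrow>
      integral {0..1} (\<lambda>s. H s x (f (\<sigma> s x))) \<in> W"
  obtains f where "continuous_on U f" "f ` U \<subseteq> W"
    "\<And>x. x \<in> U \<Longrightarrow> f x = integral {0..1} (\<lambda>s. H s x (f (\<sigma> s x)))"
proof -
  define T where "T f x = integral {0..1} (\<lambda>s. H s x (f (\<sigma> s x)))" for f x
  have joint: "continuous_on (U \<times> {0..1}) (\<lambda>(x, s). H s x (f (\<sigma> s x)))"
    if f: "continuous_on U f" "f ` U \<subseteq> W" for f
  proof -
    have "continuous_on (U \<times> {0..1}) (\<lambda>(x, s). \<sigma> s x)"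
      using continuous_on_compose2[OF \<sigma>(1), of "U \<times> {0..1}" "\<lambda>(x, s). (s, x)"]
      by (simp add: split_def image_subset_iff continuous_on_fst continuous_on_snd continuous_on_Pair continuous_on_id)
    then have "continuous_on (U \<times> {0..1}) (\<lambda>(x, s). f (\<sigma> s x))"
      unfolding split_def by (rule continuous_on_compose2[OF f(1)]) (use \<sigma>(2) in auto)
    then have "continuous_on (U \<times> {0..1}) (\<lambda>(x, s). (s, x, f (\<sigma> s x)))"
      by (auto simp: split_def intro!: continuous_intros)
    from continuous_on_compose2[OF H this] show ?thesis
      using \<sigma>(2) f(2) by (auto simp: split_def image_subset_iff)
  qed
  have int: "(\<lambda>s. H s x (f (\<sigma> s x))) integrable_on {0..1}"
    if f: "continuous_on U f" "f ` U \<subseteq> W" and x: "x \<in> U" for f x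
  proof -
    have "continuous_on {0..1} (\<lambda>s. H s x (f (\<sigma> s x)))"
      using continuous_on_compose2[OF joint[OF f], of "{0..1}" "\<lambda>s. (x, s)"] x
      by (simp add: image_subset_iff continuous_on_Pair continuous_on_id)
    then show ?thesis using integrable_continuous_real by blast
  qed
  have contT: "continuous_on U (T f)" if f: "continuous_on U f" "f ` U \<subseteq> W" for f
    using integral_continuous_on_param[of U 0 1 "\<lambda>x s. H s x (f (\<sigma> s x))"] joint[OF f]
    unfolding T_def[abs_def] by simp
  have TW: "T f ` U \<subseteq> W" if f: "continuous_on U f" "f ` U \<subseteq> W" for f
    using inv[OF f] by (auto simp: T_def)
  define F where "F n = (T ^^ n) (\<lambda>x. w0)" for n
  have F_Suc: "F (Suc n) = T (F n)" for n by (simp add: F_def)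
  have F: "continuous_on U (F n) \<and> F n ` U \<subseteq> W" for n
    by (induction n) (use contT TW F_Suc W in \<open>auto simp: F_def\<close>)
  have Tlip: "norm (T f x - T g x) \<le> B / 2"
    if f: "continuous_on U f" "f ` U \<subseteq> W" and g: "continuous_on U g" "g ` U \<subseteq> W"
      and B: "\<And>y. y \<in> U \<Longrightarrow> norm (f y - g y) \<le> B" and x: "x \<in> U" for f g B x
  proof -
    have "norm (integral {0..1} (\<lambda>s. H s x (f (\<sigma> s x)) - H s x (g (\<sigma> s x)))) \<le> B / 2"
    proof (rule integral_norm_le_01)
      show "(\<lambda>s. H s x (f (\<sigma> s x)) - H s x (g (\<sigma> s x))) integrable_on {0..1}"
        using int f g x by (auto intro: integrable_diff)
      fix s :: real assume s: "s \<in> {0..1}"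
      have "norm (H s x (f (\<sigma> s x)) - H s x (g (\<sigma> s x))) \<le> norm (f (\<sigma> s x) - g (\<sigma> s x)) / 2"
        using lip[OF s x] f(2) g(2) \<sigma>(2)[OF s x] by blast
      also have "\<dots> \<le> B / 2" using B[OF \<sigma>(2)[OF s x]] by simp
      finally show "norm (H s x (f (\<sigma> s x)) - H s x (g (\<sigma> s x))) \<le> B / 2" .
    qed
    then show ?thesis
      unfolding T_def using integral_diff[OF int[OF f x] int[OF g x]] by simp
  qed
  have "bounded ((\<lambda>x. F 1 x - F 0 x) ` U)"
    using F[of 0] F[of 1] U by (intro compact_imp_bounded compact_continuous_image continuous_on_diff) auto
  then obtain B where B: "\<And>x. x \<in> U \<Longrightarrow> norm (F 1 x - F 0 x) \<le> B"
    unfolding bounded_iff by auto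
  have diffs: "norm (F (Suc k) x - F k x) \<le> B * (1/2)^k" if "x \<in> U" for k x
    using that
  proof (induction k arbitrary: x)
    case 0 then show ?case using B by simp
  next
    case (Suc k)
    have "norm (T (F (Suc k)) x - T (F k) x) \<le> B * (1/2)^k / 2"
      by (rule Tlip) (use F Suc in auto)
    then show ?case by (simp add: F_Suc field_simps)
  qed
  \<comment> \<open>The limit is written as the sum of the telescoping increments, which
    \<open>diffs\<close> dominates by a geometric series; uniform convergence keeps it
    continuous.\<close>
  define f where "f x = w0 + (\<Sum>k. F (Suc k) x - F k x)" for x
  have "uniform_limit U (\<lambda>n x. \<Sum>k<n. F (Suc k) x - F k x) (\<lambda>x. \<Sum>k. F (Suc k) x - F k x) sequentially"
    by (rule Weierstrass_m_test[where M = "\<lambda>k. B * (1/2)^k"])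
      (auto simp: diffs intro!: summable_mult summable_geometric)
  then have ul0: "uniform_limit U (\<lambda>n x. w0 + (\<Sum>k<n. F (Suc k) x - F k x)) f sequentially"
    unfolding f_def by (intro uniform_limit_intros)
  have "w0 + (\<Sum>k<n. F (Suc k) x - F k x) = F n x" for n x
    by (subst sum_lessThan_telescope) (simp add: F_def)
  with ul0 have ul: "uniform_limit U F f sequentially" by simp
  have fc: "continuous_on U f"
    by (rule uniform_limit_theorem[OF _ ul]) (use F in auto)
  have pw: "(\<lambda>n. F n x) \<longlonglongrightarrow> f x" if "x \<in> U" for x
    using tendsto_uniform_limitI[OF ul that] .
  have fW: "f ` U \<subseteq> W"
  proof
    fix y assume "y \<in> f ` U"
    then obtain x where x: "x \<in> U" "y = f x" by blast
    have "F n x \<in> W" for n using F x(1) by blast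
    then show "y \<in> W" using closed_sequentially[OF W(1) _ pw[OF x(1)]] x(2) by simp
  qed
  have "f x = T f x" if x: "x \<in> U" for x
  proof -
    have "(\<lambda>n. T (F n) x) \<longlonglongrightarrow> T f x"
      unfolding tendsto_iff
    proof (intro allI impI)
      fix e :: real assume "e > 0"
      from uniform_limitD[OF ul this]
      show "\<forall>\<^sub>F n in sequentially. dist (T (F n) x) (T f x) < e"
      proof eventually_elim
        case (elim n)
        have "norm (T (F n) x - T f x) \<le> e / 2"
          by (rule Tlip) (use F fc fW elim x in \<open>auto simp: dist_norm less_imp_le\<close>)
        then show ?case using \<open>e > 0\<close> by (simp add: dist_norm)
      qed
    qed
    moreover have "(\<lambda>n. T (F n) x) \<longlonglongrightarrow> f x"
      using LIMSEQ_Suc[OF pw[OF x]] by (simp add: F_Suc)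
    ultimately show ?thesis using LIMSEQ_unique by blast
  qed
  then show ?thesis using that fc fW unfolding T_def by blast
qed

text \<open>Uniqueness principle: at a point where \<open>norm (D y)\<close> is maximal,
  \<open>D\<close> is an integral over an interval of length 1 of values at most half that
  maximum.\<close>

lemma integral_contraction_zero:
  fixes U :: "'p::metric_space set" and D :: "'p \<Rightarrow> 'e::banach"
  assumes U: "compact U" and D: "continuous_on U D"
    and \<sigma>: "\<And>s x. s \<in> {0..1} \<Longrightarrow> x \<in> U \<Longrightarrow> \<sigma> s x \<in> U"
    and d: "\<And>x. x \<in> U \<Longrightarrow> (d x has_integral D x) {0..1::real}"
      "\<And>s x. s \<in> {0..1} \<Longrightarrow> x \<in> U \<Longrightarrow> norm (d x s) \<le> norm (D (\<sigma> s x)) / 2"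
    and x: "x \<in> U"
  shows "D x = 0"
proof -
  obtain z where z: "z \<in> U" "\<And>y. y \<in> U \<Longrightarrow> norm (D y) \<le> norm (D z)"
    using continuous_attains_sup[OF U, of "\<lambda>y. norm (D y)"] x D by (auto intro: continuous_on_norm)
  have "norm (D z) \<le> norm (D z) / 2"
    unfolding integral_unique[OF d(1)[OF z(1)], symmetric]
  proof (rule integral_norm_le_01)
    show "d z integrable_on {0..1}" using d(1)[OF z(1)] by blast
    show "norm (d z s) \<le> norm (integral {0..1} (d z)) / 2" if "s \<in> {0..1}" for s
      using d(2)[OF that z(1)] z(2)[OF \<sigma>[OF that z(1)]] integral_unique[OF d(1)[OF z(1)]] by simp
  qed
  then show ?thesis using z(2)[OF x] by simp
qed

lemma derivative_norm_le_lipschitz: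
  assumes f: "(f has_derivative f') (at x)"
    and S: "open S" "x \<in> S" "\<And>y. y \<in> S \<Longrightarrow> norm (f y - f x) \<le> C * norm (y - x)"
  shows "norm (f' k) \<le> C * norm k"
proof (rule field_le_epsilon)
  fix e :: real assume "e > 0"
  show "norm (f' k) \<le> C * norm k + e"
  proof (cases "k = 0")
    case True
    then show ?thesis using linear_0[OF has_derivative_linear[OF f]] \<open>e > 0\<close> by simp
  next
    case False
    then have "e / norm k > 0" using \<open>e > 0\<close> by simp
    then obtain d where d: "d > 0"
      "\<And>y. norm (y - x) < d \<Longrightarrow> norm (f y - f x - f' (y - x)) \<le> e / norm k * norm (y - x)"
      using f unfolding has_derivative_at_alt by metis
    obtain r where r: "r > 0" "ball x r \<subseteq> S" using S openE by blast
    define t where "t = min d r / (2 * norm k)"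
    have t: "t > 0" "t * norm k < d" "t * norm k < r"
      using False d(1) r(1) by (auto simp: t_def)
    define y where "y = x + t *\<^sub>R k"
    have y: "norm (y - x) = t * norm k" using t(1) by (simp add: y_def)
    then have "y \<in> S" using r(2) t(3) by (auto simp: dist_norm norm_minus_commute)
    then have 1: "norm (f y - f x) \<le> C * (t * norm k)" using S(3) y by metis
    have "norm (f y - f x - f' (y - x)) \<le> e / norm k * (t * norm k)" using d(2) y t(2) by metis
    then have 2: "norm (f y - f x - f' (y - x)) \<le> t * e" using False by (simp add: mult.commute)
    have "f' (y - x) = t *\<^sub>R f' k"
      using linear_scale[OF has_derivative_linear[OF f]] by (simp add: y_def)
    then have "t * norm (f' k) = norm (f' (y - x))" using t(1) by simp
    also have "\<dots> \<le> norm (f y - f x) + norm (f y - f x - f' (y - x))"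
      by (metis norm_triangle_sub add.commute norm_minus_commute)
    also have "\<dots> \<le> t * (C * norm k + e)" using 1 2 by (simp add: algebra_simps)
    finally show ?thesis using t(1) by simp
  qed
qed


section \<open>Regularity of fixed points along shrinking projections\<close>

lemma blinfun_has_integral_apply:
  "(f has_integral I) S \<Longrightarrow> ((\<lambda>t. blinfun_apply (f t) v) has_integral blinfun_apply I v) S"
  using has_integral_linear[of f I S "\<lambda>T. blinfun_apply T v"] blinfun.bounded_linear_left
  by (simp add: o_def)

text \<open>The third axiom makes every ball around 0 stable under \<open>\<sigma> s\<close> for
  \<open>s\<close> between 0 and 1, so that the fixed point equation closes up on a ball. The
  instances are \<open>P = 0\<close> and the coordinate projections.\<close>

locale shrinking =
  fixes P :: "'a::euclidean_space \<Rightarrow> 'a"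
  assumes lin: "bounded_linear P"
    and idem: "P (P x) = P x"
    and short: "0 \<le> t \<Longrightarrow> t \<le> 1 \<Longrightarrow> norm (x - t *\<^sub>R P x) \<le> norm x"
begin

definition \<sigma> :: "real \<Rightarrow> 'a \<Rightarrow> 'a" where
  "\<sigma> s x = x - (1 - s) *\<^sub>R P x"

text \<open>Derivatives are two-sided, so the domain has to be open and \<open>s\<close> cannot be
  confined to the unit interval. Requiring that \<open>\<sigma> s x\<close> stay in the ball keeps
  \<open>f (\<sigma> s x)\<close> meaningful for all \<open>s\<close> that occur.\<close>

definition param_dom :: "real \<Rightarrow> 'e set \<Rightarrow> (real \<times> 'a \<times> 'e) set" where
  "param_dom d W = {(s, x, w). x \<in> ball 0 d \<and> \<sigma> s x \<in> ball 0 d \<and> w \<in> W}"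

lemma \<sigma>_blinfun: "\<sigma> s x = blinfun_apply (id_blinfun - (1 - s) *\<^sub>R Blinfun P) x"
  using bounded_linear_Blinfun_apply[OF lin]
  by (simp add: \<sigma>_def blinfun.diff_left blinfun.scaleR_left)

lemma bounded_linear_\<sigma>: "bounded_linear (\<sigma> s)"
  unfolding \<sigma>_blinfun[abs_def] by (rule blinfun.bounded_linear_right)

lemma norm_\<sigma>: "s \<in> {0..1} \<Longrightarrow> norm (\<sigma> s x) \<le> norm x"
  using short[of "1 - s" x] by (simp add: \<sigma>_def)

lemma continuous_on_\<sigma> [continuous_intros]:
  "continuous_on S f \<Longrightarrow> continuous_on S g \<Longrightarrow> continuous_on S (\<lambda>z. \<sigma> (f z) (g z))"
  unfolding \<sigma>_def by (intro continuous_intros bounded_linear.continuous_on[OF lin])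

lemma C_diff_on_\<sigma>:
  assumes "open S" "C_diff_on n S f" "C_diff_on n S g"
  shows "C_diff_on n S (\<lambda>z. \<sigma> (f z) (g z))"
  unfolding \<sigma>_def
  by (intro C_diff_on_diff C_diff_on_bilinear[OF _ bounded_bilinear_scaleR]
      C_diff_on_linear_compose[OF _ lin] C_diff_on_const assms)

lemma open_dom:
  assumes "open W"
  shows "open (param_dom d W)"
proof -
  have "param_dom d W = UNIV \<times> ball 0 d \<times> W \<inter> (\<lambda>z. \<sigma> (fst z) (fst (snd z))) -` ball 0 d"
    by (auto simp: param_dom_def)
  moreover have "continuous_on (UNIV \<times> ball 0 d \<times> W) (\<lambda>z. \<sigma> (fst z) (fst (snd z)))"
    by (intro continuous_intros)
  ultimately show ?thesis
    using assms by (simp add: continuous_on_open_vimage open_Times Int_commute)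
qed

lemma param_dom_I: "s \<in> {0..1} \<Longrightarrow> x \<in> ball 0 d \<Longrightarrow> w \<in> W \<Longrightarrow> (s, x, w) \<in> param_dom d W"
  using norm_\<sigma>[of s x] by (auto simp: param_dom_def)

lemma \<sigma>_ball: "s \<in> {0..1} \<Longrightarrow> x \<in> ball 0 d \<Longrightarrow> \<sigma> s x \<in> ball 0 d"
  using norm_\<sigma>[of s x] by auto

lemma \<sigma>_cball: "s \<in> {0..1} \<Longrightarrow> x \<in> cball 0 d \<Longrightarrow> \<sigma> s x \<in> cball 0 d"
  using norm_\<sigma>[of s x] by auto

lemma derivative_dom_le:
  fixes H :: "real \<times> 'a \<times> 'e::euclidean_space \<Rightarrow> 'e"
  assumes W: "open W"
    and H: "C_diff_on (Suc 0) (param_dom d W) H"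
    and lip: "\<And>s x w w'. s \<in> {0..1} \<Longrightarrow> x \<in> ball 0 d \<Longrightarrow> w \<in> W \<Longrightarrow> w' \<in> W \<Longrightarrow>
      norm (H (s, x, w) - H (s, x, w')) \<le> norm (w - w') / 2"
    and p: "s \<in> {0..1}" "x \<in> ball 0 d" "w \<in> W"
  shows "norm (fderiv H (s, x, w) (0, 0, k)) \<le> norm k / 2"
proof -
  have "(H has_derivative fderiv H (s, x, w)) (at (s, x, w))"
    using C_diff_on_has_derivative[OF H param_dom_I[OF p]] .
  then have "((\<lambda>w. H (s, x, w)) has_derivative (\<lambda>k. fderiv H (s, x, w) (0, 0, k))) (at w)"
    by (auto intro!: derivative_eq_intros has_derivative_compose[of "\<lambda>w. (s, x, w)" _ w UNIV H])
  from derivative_norm_le_lipschitz[OF this W p(3), of "1/2"] show ?thesis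
    using lip[OF p(1,2) _ p(3)] by simp
qed

text \<open>
  Hadamard's trick: the increment \<open>f y - f x\<close> satisfies a linear fixed point equation whose
  coefficients are averages of \<open>DH\<close> along segments. The operator-valued equation with the same
  coefficients has a continuous solution \<open>A\<close>, and by uniqueness \<open>f y - f x = A (x, y) (y - x)\<close>, so
  that \<open>A (x, x)\<close> is the derivative of \<open>f\<close>.
\<close>
lemma hadamard_fixpoint:
  fixes H :: "real \<times> 'a \<times> 'e::euclidean_space \<Rightarrow> 'e"
  assumes W: "open W" "convex W"
    and H: "C_diff_on (Suc 0) (param_dom d W) H"
    and lip: "\<And>s x w w'. s \<in> {0..1} \<Longrightarrow> x \<in> ball 0 d \<Longrightarrow> w \<in> W \<Longrightarrow> w' \<in> W \<Longrightarrow>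
      norm (H (s, x, w) - H (s, x, w')) \<le> norm (w - w') / 2"
    and f: "continuous_on (ball 0 d) f" "\<And>x. x \<in> ball 0 d \<Longrightarrow> f x \<in> W"
    and eq: "\<And>x. x \<in> ball 0 d \<Longrightarrow> f x = integral {0..1} (\<lambda>s. H (s, x, f (\<sigma> s x)))"
    and r: "r < d"
  obtains A :: "'a \<times> 'a \<Rightarrow> 'a \<Rightarrow>\<^sub>L 'e" where
    "continuous_on (cball 0 r \<times> cball 0 r) A"
    "\<And>x y. x \<in> cball 0 r \<Longrightarrow> y \<in> cball 0 r \<Longrightarrow> f y - f x = A (x, y) (y - x)"
    "\<And>x k. x \<in> cball 0 r \<Longrightarrow>
      ((\<lambda>s. fderiv H (s, x, f (\<sigma> s x)) (0, k, A (\<sigma> s x, \<sigma> s x) (\<sigma> s k)))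
        has_integral A (x, x) k) {0..1}"
proof -
  let ?B = "cball (0::'a) r" and ?I = "{0..1::real}"
  let ?D = "\<lambda>p. fderiv H p"
  have Bd: "x \<in> ball 0 d" if "x \<in> ?B" for x using that r by auto
  define D where "D p = Blinfun (?D p)" for p
  have D: "blinfun_apply (D p) = ?D p" if "p \<in> param_dom d W" for p
    using C_diff_on_has_derivative[OF H that] has_derivative_bounded_linear bounded_linear_Blinfun_apply
    unfolding D_def by blast
  have contD: "continuous_on (param_dom d W) D"
  proof (rule continuous_on_blinfun_componentwise)
    fix i :: "real \<times> 'a \<times> 'e"
    have "continuous_on (param_dom d W) (\<lambda>p. ?D p i)"
      using C_diff_on_derivative[OF H] C_diff_on.simps(1) by blast
    then show "continuous_on (param_dom d W) (\<lambda>p. blinfun_apply (D p) i)"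
      using D by (simp cong: continuous_on_cong)
  qed
  have contf: "continuous_on ?B f" by (rule continuous_on_subset[OF f(1)]) (use Bd in auto)
  \<comment> \<open>The segment joining the arguments of \<open>H\<close> belonging to
    \<open>x\<close> and to \<open>y\<close>; convexity of \<open>W\<close> keeps it in the domain.
    Below, \<open>M\<close> is the average of the derivative of \<open>H\<close> over it.\<close>
  define q where "q s x y t = (s, x + t *\<^sub>R (y - x), f (\<sigma> s x) + t *\<^sub>R (f (\<sigma> s y) - f (\<sigma> s x)))" for s x y t
  have q_dom: "q s x y t \<in> param_dom d W" if "s \<in> ?I" "x \<in> ?B" "y \<in> ?B" "t \<in> ?I" for s x y t
  proof -
    have c: "a + t *\<^sub>R (b - a) \<in> C" if "convex C" "a \<in> C" "b \<in> C" for C :: "'v::real_vector set" and a b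
      using convexD_alt[OF that, of t] \<open>t \<in> ?I\<close> by (simp add: algebra_simps)
    show ?thesis
      unfolding q_def
      by (intro param_dom_I that c W convex_ball Bd f(2) \<sigma>_ball)
  qed
  define M where "M s z = integral ?I (\<lambda>t. D (q s (fst z) (snd z) t))" for s z
  have "continuous_on ((?I \<times> ?B \<times> ?B) \<times> ?I) (\<lambda>p. D (q (fst (fst p)) (fst (snd (fst p))) (snd (snd (fst p))) (snd p)))"
  proof (rule continuous_on_compose2[OF contD])
    show "continuous_on ((?I \<times> ?B \<times> ?B) \<times> ?I) (\<lambda>p. q (fst (fst p)) (fst (snd (fst p))) (snd (snd (fst p))) (snd p))"
      unfolding q_def
      by (intro continuous_intros continuous_on_compose2[OF contf]) (use \<sigma>_cball in auto)
  qed (use q_dom in auto)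
  then have contM: "continuous_on (?I \<times> ?B \<times> ?B) (\<lambda>p. M (fst p) (snd p))"
    using integral_continuous_on_param[of "?I \<times> ?B \<times> ?B" 0 1 "\<lambda>p t. D (q (fst p) (fst (snd p)) (snd (snd p)) t)"]
    by (simp add: M_def split_def)
  have M_int: "((\<lambda>t. D (q s x y t)) has_integral M s (x, y)) ?I"
    if "s \<in> ?I" "x \<in> ?B" "y \<in> ?B" for s x y
  proof -
    have "continuous_on ?I (\<lambda>t. D (q s x y t))"
      by (rule continuous_on_compose2[OF contD])
        (use q_dom that in \<open>auto simp: q_def intro!: continuous_intros\<close>)
    from integrable_integral[OF integrable_continuous_real[OF this]] show ?thesis by (simp add: M_def)
  qed
  have M_apply: "((\<lambda>t. ?D (q s x y t) v) has_integral blinfun_apply (M s (x, y)) v) ?I"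
    if "s \<in> ?I" "x \<in> ?B" "y \<in> ?B" for s x y v
    by (rule has_integral_eq[OF _ blinfun_has_integral_apply[OF M_int[OF that]]])
      (use D[OF q_dom[OF that]] in simp)
  have M_diff: "blinfun_apply (M s (x, y)) (0, y - x, f (\<sigma> s y) - f (\<sigma> s x)) =
      H (s, y, f (\<sigma> s y)) - H (s, x, f (\<sigma> s x))"
    if s: "s \<in> ?I" and x: "x \<in> ?B" and y: "y \<in> ?B" for s x y
  proof -
    let ?v = "(0, y - x, f (\<sigma> s y) - f (\<sigma> s x))"
    have "((\<lambda>t. ?D (q s x y t) ?v) has_integral H (q s x y 1) - H (q s x y 0)) ?I"
    proof (rule fundamental_theorem_of_calculus)
      fix t :: real assume t: "t \<in> ?I"
      have "((\<lambda>t. q s x y t) has_derivative (\<lambda>h. h *\<^sub>R ?v)) (at t)"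
        unfolding q_def by (auto intro!: derivative_eq_intros)
      from has_derivative_compose[OF this C_diff_on_has_derivative[OF H q_dom[OF s x y t]]]
      have "((\<lambda>t. H (q s x y t)) has_derivative (\<lambda>h. ?D (q s x y t) (h *\<^sub>R ?v))) (at t)" .
      then have "((\<lambda>t. H (q s x y t)) has_vector_derivative ?D (q s x y t) ?v) (at t)"
        using linear_scale[OF has_derivative_linear[OF C_diff_on_has_derivative[OF H q_dom[OF s x y t]]], of _ ?v]
        unfolding has_vector_derivative_def by (simp del: scaleR_Pair)
      then show "((\<lambda>t. H (q s x y t)) has_vector_derivative ?D (q s x y t) ?v) (at t within ?I)"
        by (rule has_vector_derivative_at_within)
    qed simp
    from has_integral_unique[OF M_apply[OF s x y] this] show ?thesis by (simp add: q_def)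
  qed
  define E where "E = Blinfun (\<lambda>k::'e. (0::real, 0::'a, k))"
  define J where "J = Blinfun (\<lambda>k::'a. (0::real, k, 0::'e))"
  define S where "S s = id_blinfun - (1 - s) *\<^sub>R Blinfun P" for s
  have E: "blinfun_apply E k = (0, 0, k)" for k
    unfolding E_def by (subst bounded_linear_Blinfun_apply)
      (auto intro!: bounded_linear_Pair bounded_linear_zero bounded_linear_ident)
  have J: "blinfun_apply J k = (0, k, 0)" for k
    unfolding J_def by (subst bounded_linear_Blinfun_apply)
      (auto intro!: bounded_linear_Pair bounded_linear_zero bounded_linear_ident)
  have S: "blinfun_apply (S s) k = \<sigma> s k" for s k by (simp add: S_def \<sigma>_blinfun)
  have normS: "norm (S s) \<le> 1" if "s \<in> ?I" for s
    by (rule norm_blinfun_bound) (use norm_\<sigma>[OF that] S in auto)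
  have normM: "norm (blinfun_apply (M s (x, y)) (0, 0, k)) \<le> norm k / 2"
    if "s \<in> ?I" "x \<in> ?B" "y \<in> ?B" for s x y k
    unfolding integral_unique[OF M_apply[OF that], symmetric]
  proof (rule integral_norm_le_01)
    show "(\<lambda>t. ?D (q s x y t) (0, 0, k)) integrable_on ?I" using M_apply[OF that] by blast
    fix t :: real assume "t \<in> ?I"
    note qd = q_dom[OF that this]
    show "norm (?D (q s x y t) (0, 0, k)) \<le> norm k / 2"
      using derivative_dom_le[OF W(1) H lip] qd that(1) unfolding q_def param_dom_def by auto
  qed
  have normME: "norm (M s (x, y) o\<^sub>L E) \<le> 1/2" if "s \<in> ?I" "x \<in> ?B" "y \<in> ?B" for s x y
    by (rule norm_blinfun_bound) (use normM[OF that] E in auto)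
  \<comment> \<open>This is \<open>k \<mapsto> M (0, k, X (\<sigma> s k))\<close>, the linearised
    integrand: \<open>J\<close> inserts the increment of the point, \<open>E\<close> the increment
    of the value, and \<open>S s\<close> is \<open>\<sigma> s\<close> as an operator of norm at most
    1.\<close>
  define T where "T s z X = (M s z o\<^sub>L J) + (((M s z o\<^sub>L E) o\<^sub>L X) o\<^sub>L S s)" for s z X
  let ?\<sigma> = "\<lambda>s z. (\<sigma> s (fst z), \<sigma> s (snd z))"
  obtain A where A: "continuous_on (?B \<times> ?B) A" "A ` (?B \<times> ?B) \<subseteq> UNIV"
    "\<And>z. z \<in> ?B \<times> ?B \<Longrightarrow> A z = integral ?I (\<lambda>s. T s z (A (?\<sigma> s z)))"
  proof (rule integral_fixpoint_exists[of "?B \<times> ?B" ?\<sigma> UNIV 0 T])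
    show "compact (?B \<times> ?B)" by (intro compact_Times compact_cball)
    show "continuous_on (?I \<times> ?B \<times> ?B) (\<lambda>(s, z). ?\<sigma> s z)"
      by (auto simp: split_def intro!: continuous_intros)
    show "?\<sigma> s z \<in> ?B \<times> ?B" if "s \<in> ?I" "z \<in> ?B \<times> ?B" for s z
      using that \<sigma>_cball by (auto simp del: mem_cball)
    have "continuous_on (?I \<times> (?B \<times> ?B) \<times> UNIV) (\<lambda>p. M (fst p) (fst (snd p)))"
      using continuous_on_compose2[OF contM, of "?I \<times> (?B \<times> ?B) \<times> UNIV" "\<lambda>p. (fst p, fst (snd p))"]
      by (force intro!: continuous_intros)
    then show "continuous_on (?I \<times> (?B \<times> ?B) \<times> UNIV) (\<lambda>(s, z, X). T s z X)"
      unfolding T_def S_def split_def by (intro continuous_intros)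
    fix s z and X Y :: "'a \<Rightarrow>\<^sub>L 'e"
    assume sz: "s \<in> ?I" "z \<in> ?B \<times> ?B"
    obtain x y where z: "z = (x, y)" "x \<in> ?B" "y \<in> ?B"
      using sz by (metis (no_types) mem_Times_iff prod.collapse)
    have "T s z X - T s z Y = ((M s z o\<^sub>L E) o\<^sub>L (X - Y)) o\<^sub>L S s"
      unfolding T_def by (intro blinfun_eqI) (simp add: blinfun.diff_left blinfun.diff_right blinfun.add_left)
    also have "norm \<dots> \<le> norm ((M s z o\<^sub>L E) o\<^sub>L (X - Y)) * norm (S s)"
      by (rule norm_blinfun_compose)
    also have "\<dots> \<le> (norm (M s z o\<^sub>L E) * norm (X - Y)) * 1"
      by (intro mult_mono norm_blinfun_compose normS sz) auto
    also have "\<dots> \<le> (1/2 * norm (X - Y)) * 1"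
      by (intro mult_right_mono) (use normME sz z in auto)
    finally show "norm (T s z X - T s z Y) \<le> norm (X - Y) / 2" by simp
  qed auto
  have T_int: "((\<lambda>s. T s z (A (?\<sigma> s z))) has_integral A z) ?I" if z: "z \<in> ?B \<times> ?B" for z
  proof -
    obtain x y where xy: "z = (x, y)" "x \<in> ?B" "y \<in> ?B"
      using z by (metis (no_types) mem_Times_iff prod.collapse)
    have "continuous_on ?I (\<lambda>s. M s z)"
      using continuous_on_compose2[OF contM, of ?I "\<lambda>s. (s, z)"] z
      by (force intro!: continuous_intros)
    moreover have "continuous_on ?I (\<lambda>s. A (?\<sigma> s z))"
      by (rule continuous_on_compose2[OF A(1)])
        (use \<sigma>_cball xy in \<open>auto intro!: continuous_intros simp del: mem_cball\<close>)
    ultimately have "continuous_on ?I (\<lambda>s. T s z (A (?\<sigma> s z)))"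
      unfolding T_def S_def by (intro continuous_intros)
    from integrable_integral[OF integrable_continuous_real[OF this]] A(3)[OF z] show ?thesis by simp
  qed
  have f_int: "((\<lambda>s. H (s, x, f (\<sigma> s x))) has_integral f x) ?I" if x: "x \<in> ?B" for x
  proof -
    have "continuous_on (param_dom d W) H" using C_diff_on_continuous[OF H] .
    then have "continuous_on ?I (\<lambda>s. H (s, x, f (\<sigma> s x)))"
      by (rule continuous_on_compose2)
        (auto intro!: continuous_intros continuous_on_compose2[OF contf] param_dom_I \<sigma>_cball x Bd f(2)
          simp del: mem_cball mem_ball)
    from integrable_integral[OF integrable_continuous_real[OF this]] eq[OF Bd[OF x]] show ?thesis by simp
  qed
  have Afix: "f y - f x = A (x, y) (y - x)" if x: "x \<in> ?B" and y: "y \<in> ?B" for x y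
  proof -
    \<comment> \<open>The residual of the claimed identity. It solves the homogeneous linear
      equation with operator \<open>M s z\<close> on the last component, of norm at most 1/2, and
      therefore vanishes.\<close>
    let ?R = "\<lambda>z. f (snd z) - f (fst z) - A z (snd z - fst z)"
    let ?d = "\<lambda>z s. H (s, snd z, f (\<sigma> s (snd z))) - H (s, fst z, f (\<sigma> s (fst z)))
       - T s z (A (?\<sigma> s z)) (snd z - fst z)"
    have "?R (x, y) = 0"
    proof (rule integral_contraction_zero[of "?B \<times> ?B" ?R ?\<sigma> ?d])
      show "compact (?B \<times> ?B)" by (intro compact_Times compact_cball)
      show "continuous_on (?B \<times> ?B) ?R"
      proof -
        have "continuous_on (?B \<times> ?B) (\<lambda>z. f (fst z))" "continuous_on (?B \<times> ?B) (\<lambda>z. f (snd z))"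
          by (rule continuous_on_compose2[OF contf]; force intro!: continuous_on_fst continuous_on_snd continuous_on_id)+
        then show ?thesis
          by (intro continuous_on_diff blinfun.continuous_on[OF A(1)] continuous_on_fst continuous_on_snd continuous_on_id)
      qed
      show "?\<sigma> s z \<in> ?B \<times> ?B" if "s \<in> ?I" "z \<in> ?B \<times> ?B" for s z
        using that \<sigma>_cball by (auto simp del: mem_cball)
      show "(?d z has_integral ?R z) ?I" if "z \<in> ?B \<times> ?B" for z
      proof -
        have "fst z \<in> ?B" "snd z \<in> ?B" using that by (simp_all only: mem_Times_iff)
        note f_int[OF this(2)] f_int[OF this(1)]
        from has_integral_diff[OF has_integral_diff[OF this]
            blinfun_has_integral_apply[OF T_int[OF that], of "snd z - fst z"]]
        show ?thesis by this
      qed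
      show "norm (?d z s) \<le> norm (?R (?\<sigma> s z)) / 2" if sz: "s \<in> ?I" "z \<in> ?B \<times> ?B" for s z
      proof -
        obtain a b where z: "z = (a, b)" "a \<in> ?B" "b \<in> ?B"
          using sz(2) by (metis (no_types) mem_Times_iff prod.collapse)
        have lin: "\<sigma> s b - \<sigma> s a = \<sigma> s (b - a)"
          using bounded_linear.linear[OF bounded_linear_\<sigma>] by (simp add: linear_diff)
        have "?d z s = blinfun_apply (M s z) ((0, b - a, f (\<sigma> s b) - f (\<sigma> s a))
          - ((0, b - a, 0) + (0, 0, A (?\<sigma> s z) (\<sigma> s (b - a)))))"
          unfolding blinfun.diff_right[of "M s z"] blinfun.add_right[of "M s z"]
          using M_diff[OF sz(1) z(2,3)] z(1)
          by (simp add: T_def blinfun.add_left E J S)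
        also have "\<dots> = blinfun_apply (M s z) (0, 0, ?R (?\<sigma> s z))"
          using z lin by simp
        finally have "norm (?d z s) = norm (blinfun_apply (M s z) (0, 0, ?R (?\<sigma> s z)))"
          by (rule arg_cong)
        then show ?thesis
          unfolding z(1) using normM[OF sz(1) z(2,3)] by (rule ord_eq_le_trans)
      qed
    qed (use x y in auto)
    then show ?thesis by simp
  qed
  show ?thesis
  proof (rule that[OF A(1) Afix])
    fix x k assume x: "x \<in> ?B"
    \<comment> \<open>On the diagonal the segment is constant, and the average is the derivative of
      \<open>H\<close> itself.\<close>
    have *: "blinfun_apply (M s (x, x)) v = ?D (s, x, f (\<sigma> s x)) v" if "s \<in> ?I" for s v
    proof -
      have "((\<lambda>t. ?D (s, x, f (\<sigma> s x)) v) has_integral ?D (s, x, f (\<sigma> s x)) v) ?I"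
        using has_integral_const_real[of "?D (s, x, f (\<sigma> s x)) v" 0 1] by simp
      moreover have "((\<lambda>t. ?D (s, x, f (\<sigma> s x)) v) has_integral blinfun_apply (M s (x, x)) v) ?I"
        using M_apply[OF that x x, of v] by (simp add: q_def)
      ultimately show ?thesis using has_integral_unique by blast
    qed
    have lin: "?D (s, x, f (\<sigma> s x)) (0, k, 0) + ?D (s, x, f (\<sigma> s x)) (0, 0, w) = ?D (s, x, f (\<sigma> s x)) (0, k, w)"
      if "s \<in> ?I" for s w
      using *[OF that] blinfun.add_right[of "M s (x, x)" "(0, k, 0)" "(0, 0, w)"] by simp
    have "((\<lambda>s. T s (x, x) (A (?\<sigma> s (x, x))) k) has_integral A (x, x) k) ?I"
      using blinfun_has_integral_apply[OF T_int[of "(x, x)"], of k] x by simp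
    then show "((\<lambda>s. ?D (s, x, f (\<sigma> s x)) (0, k, A (\<sigma> s x, \<sigma> s x) (\<sigma> s k))) has_integral A (x, x) k) ?I"
      by (rule has_integral_eq[rotated]) (simp add: T_def blinfun.add_left E J S * lin)
  qed
qed

text \<open>In \<open>f y - f x = A (x, y) (y - x)\<close>, continuity of \<open>A\<close> at the
  diagonal gives differentiability with derivative \<open>A (x, x)\<close>, and continuity of that
  derivative.\<close>

lemma fixpoint_C1:
  fixes H :: "real \<times> 'a \<times> 'e::euclidean_space \<Rightarrow> 'e"
  assumes W: "open W" "convex W"
    and H: "C_diff_on (Suc 0) (param_dom d W) H"
    and lip: "\<And>s x w w'. s \<in> {0..1} \<Longrightarrow> x \<in> ball 0 d \<Longrightarrow> w \<in> W \<Longrightarrow> w' \<in> W \<Longrightarrow>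
      norm (H (s, x, w) - H (s, x, w')) \<le> norm (w - w') / 2"
    and f: "continuous_on (ball 0 d) f" "\<And>x. x \<in> ball 0 d \<Longrightarrow> f x \<in> W"
    and eq: "\<And>x. x \<in> ball 0 d \<Longrightarrow> f x = integral {0..1} (\<lambda>s. H (s, x, f (\<sigma> s x)))"
    and x: "x \<in> ball 0 d"
  shows "(f has_derivative fderiv f x) (at x)" (is ?A)
    and "((\<lambda>s. fderiv H (s, x, f (\<sigma> s x))
        (0, k, fderiv f (\<sigma> s x) (\<sigma> s k)))
      has_integral fderiv f x k) {0..1}" (is ?B)
    and "isCont (\<lambda>x. fderiv f x k) x" (is ?C)
proof -
  \<comment> \<open>\<open>A\<close> is available on compact balls only, hence a radius strictly
    between \<open>norm x\<close> and \<open>d\<close>.\<close>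
  obtain r where r: "norm x < r" "r < d" using x dense[of "norm x" d] by auto
  obtain A :: "'a \<times> 'a \<Rightarrow> 'a \<Rightarrow>\<^sub>L 'e" where A:
    "continuous_on (cball 0 r \<times> cball 0 r) A"
    "\<And>x y. x \<in> cball 0 r \<Longrightarrow> y \<in> cball 0 r \<Longrightarrow> f y - f x = A (x, y) (y - x)"
    "\<And>x k. x \<in> cball 0 r \<Longrightarrow>
      ((\<lambda>s. fderiv H (s, x, f (\<sigma> s x)) (0, k, A (\<sigma> s x, \<sigma> s x) (\<sigma> s k)))
        has_integral A (x, x) k) {0..1}"
    using hadamard_fixpoint[OF W H lip f eq r(2)] by blast
  have contA: "isCont (\<lambda>y. A (g y, y)) z" if g: "continuous_on (ball 0 r) g" "g ` ball 0 r \<subseteq> ball 0 r"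
    and z: "z \<in> ball 0 r" for g z
  proof -
    have "continuous_on (ball 0 r) (\<lambda>y. A (g y, y))"
      by (rule continuous_on_compose2[OF A(1)])
        (use g(2) in \<open>auto intro!: continuous_on_Pair g(1) continuous_on_id less_imp_le simp: image_subset_iff\<close>)
    then show ?thesis using z continuous_on_eq_continuous_at open_ball by blast
  qed
  have der: "(f has_derivative blinfun_apply (A (y, y))) (at y)" if y: "y \<in> ball 0 r" for y
    unfolding has_derivative_within_alt2
  proof (intro conjI allI impI blinfun.bounded_linear_right)
    fix e :: real assume "e > 0"
    have "((\<lambda>z. A (y, z)) \<longlongrightarrow> A (y, y)) (at y)"
      using contA[of "\<lambda>_. y" y] y by (simp add: isCont_def image_subset_iff)
    then have "eventually (\<lambda>z. dist (A (y, z)) (A (y, y)) < e) (at y)"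
      using \<open>e > 0\<close> tendstoD by blast
    moreover have "eventually (\<lambda>z. z \<in> ball 0 r) (at y)"
      using y eventually_at_in_open' open_ball by blast
    ultimately show "eventually (\<lambda>z. norm (f z - f y - A (y, y) (z - y)) \<le> e * norm (z - y)) (at y)"
    proof eventually_elim
      case (elim z)
      have "f z - f y - A (y, y) (z - y) = (A (y, z) - A (y, y)) (z - y)"
        using A(2)[of y z] y elim(2) by (simp add: blinfun.diff_left)
      also have "norm \<dots> \<le> norm (A (y, z) - A (y, y)) * norm (z - y)" by (rule norm_blinfun)
      also have "\<dots> \<le> e * norm (z - y)" using elim(1) by (intro mult_right_mono) (auto simp: dist_norm)
      finally show ?case .
    qed
  qed
  have fd: "fderiv f y = blinfun_apply (A (y, y))" if "y \<in> ball 0 r" for y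
    using frechet_derivativeI[OF der[OF that]] .
  have xr: "x \<in> ball 0 r" using r by simp
  show ?A using der[OF xr] fd[OF xr] by simp
  have "x \<in> cball 0 r" using r by simp
  from A(3)[OF this, of k] show ?B
    unfolding fd[OF xr] by (rule has_integral_eq[rotated]) (use fd[OF \<sigma>_ball[OF _ xr]] in simp)
  have "isCont (\<lambda>y. A (y, y) k) x"
    using contA[of "\<lambda>y. y" x] xr by (intro continuous_intros) auto
  moreover have "eventually (\<lambda>y. fderiv f y k = A (y, y) k) (nhds x)"
    using eventually_nhds_in_open[OF open_ball xr] by eventually_elim (simp add: fd)
  ultimately show ?C using isCont_cong by fastforce
qed

text \<open>
  For \<open>k\<close> in the range or in the kernel of \<open>P\<close>, \<open>\<sigma> s k\<close> is a multiple of \<open>k\<close>, so the directional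
  derivative of \<open>f\<close> along \<open>k\<close> solves an equation of the same type, with one order of
  differentiability less.
\<close>
lemma fixpoint_Cn:
  fixes H :: "real \<times> 'a \<times> 'e::euclidean_space \<Rightarrow> 'e"
  assumes W: "open W" "convex W"
    and H: "C_diff_on n (param_dom d W) H"
    and lip: "\<And>s x w w'. s \<in> {0..1} \<Longrightarrow> x \<in> ball 0 d \<Longrightarrow> w \<in> W \<Longrightarrow> w' \<in> W \<Longrightarrow>
      norm (H (s, x, w) - H (s, x, w')) \<le> norm (w - w') / 2"
    and f: "continuous_on (ball 0 d) f" "\<And>x. x \<in> ball 0 d \<Longrightarrow> f x \<in> W"
    and eq: "\<And>x. x \<in> ball 0 d \<Longrightarrow> f x = integral {0..1} (\<lambda>s. H (s, x, f (\<sigma> s x)))"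
  shows "C_diff_on n (ball 0 d) f"
  using assms
proof (induction n arbitrary: H W f)
  case 0
  then show ?case by simp
next
  case (Suc n)
  let ?DH = "\<lambda>p. fderiv H p" and ?Df = "\<lambda>x. fderiv f x"
  note H = Suc.prems(3) and W = Suc.prems(1,2) and fW = Suc.prems(6)
  note lip = Suc.prems(4) and eq = Suc.prems(7)
  have H1: "C_diff_on (Suc 0) (param_dom d W) H" by (rule C_diff_on_le[OF H]) simp
  have f: "C_diff_on n (ball 0 d) f"
    by (rule Suc.IH[OF W C_diff_on_SucD[OF H]]; fact)
  have C1: "(f has_derivative ?Df x) (at x)"
      "((\<lambda>s. ?DH (s, x, f (\<sigma> s x)) (0, k, ?Df (\<sigma> s x) (\<sigma> s k))) has_integral ?Df x k) {0..1}"
      "isCont (\<lambda>x. ?Df x k) x" if "x \<in> ball 0 d" for x k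
    by (rule fixpoint_C1[of W d H f x]; fact)+
  have lin: "linear (?DH (s, x, f (\<sigma> s x)))" if "s \<in> {0..1}" "x \<in> ball 0 d" for s x
    using C_diff_on_has_derivative[OF H1 param_dom_I[OF that fW[OF \<sigma>_ball[OF that]]]] has_derivative_linear by blast
  have eigen: "C_diff_on n (ball 0 d) (\<lambda>x. ?Df x k)"
    if c: "\<And>s. \<sigma> s k = c s *\<^sub>R k" "\<And>s. s \<in> {0..1} \<Longrightarrow> \<bar>c s\<bar> \<le> 1" "C_diff_on n UNIV c"
    for k c
  proof -
    \<comment> \<open>The right-hand side of the equation for the derivative along \<open>k\<close>.
      It is affine in \<open>w\<close>, so the convex set \<open>W\<close> is replaced by the whole
      space.\<close>
    define K where "K = (\<lambda>(s, x, w). ?DH (s, x, f (\<sigma> s x)) (0, k, c s *\<^sub>R w))"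
    have od: "open (param_dom d (UNIV :: 'e set))" by (rule open_dom) simp
    have L: "C_diff_on n S (\<lambda>p. fst p)" "C_diff_on n S (\<lambda>p. fst (snd p))" "C_diff_on n S (\<lambda>p. snd (snd p))"
      if "open S" for S :: "(real \<times> 'a \<times> 'e) set"
      using that by (auto intro!: C_diff_on_linear bounded_linear_fst_comp bounded_linear_snd_comp
          bounded_linear_fst bounded_linear_snd)
    have K: "C_diff_on n (param_dom d UNIV) K"
    proof -
      have fs: "C_diff_on n (param_dom d UNIV) (\<lambda>p. f (\<sigma> (fst p) (fst (snd (p :: real \<times> 'a \<times> 'e)))))"
        by (rule C_diff_on_compose[OF od open_ball _ f]) (intro C_diff_on_\<sigma> L od, auto simp: param_dom_def)
      have "C_diff_on n (param_dom d UNIV)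
        (\<lambda>p :: real \<times> 'a \<times> 'e. ?DH (fst p, fst (snd p), f (\<sigma> (fst p) (fst (snd p)))) (0, k, c (fst p) *\<^sub>R snd (snd p)))"
      proof (rule C_diff_on_apply[OF od, where A = "\<lambda>p. ?DH (fst p, fst (snd p), f (\<sigma> (fst p) (fst (snd p))))"])
        fix p :: "real \<times> 'a \<times> 'e" assume "p \<in> param_dom d UNIV"
        then have "(fst p, fst (snd p), f (\<sigma> (fst p) (fst (snd p)))) \<in> param_dom d W"
          using fW by (auto simp: param_dom_def)
        then show "bounded_linear (?DH (fst p, fst (snd p), f (\<sigma> (fst p) (fst (snd p)))))"
          using C_diff_on_has_derivative[OF H1] has_derivative_bounded_linear by blast
      next
        fix i
        show "C_diff_on n (param_dom d UNIV)
          (\<lambda>p :: real \<times> 'a \<times> 'e. ?DH (fst p, fst (snd p), f (\<sigma> (fst p) (fst (snd p)))) i)"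
          by (rule C_diff_on_compose[OF od open_dom[OF W(1)] _ C_diff_on_derivative[OF H]])
            (use fW in \<open>intro C_diff_on_Pair L fs od, auto simp: param_dom_def\<close>)
        have "C_diff_on n (param_dom d UNIV) (\<lambda>p :: real \<times> 'a \<times> 'e. c (fst p))"
          by (rule C_diff_on_compose[OF od open_UNIV L(1)[OF od] c(3)]) simp
        then show "C_diff_on n (param_dom d UNIV) (\<lambda>p :: real \<times> 'a \<times> 'e. (0, k, c (fst p) *\<^sub>R snd (snd p)))"
          by (intro C_diff_on_Pair C_diff_on_bilinear[OF _ bounded_bilinear_scaleR] C_diff_on_const od L)
      qed
      then show ?thesis by (simp add: K_def split_def)
    qed
    show ?thesis
    proof (rule Suc.IH[OF open_UNIV convex_UNIV K])
      fix s :: real and x :: 'a and w w' :: 'e assume s: "s \<in> {0..1}" and x: "x \<in> ball 0 d"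
      let ?p = "(s, x, f (\<sigma> s x))"
      have "K (s, x, w) - K (s, x, w') = ?DH ?p (0, 0, c s *\<^sub>R (w - w'))"
        using linear_diff[OF lin[OF s x], of "(0, k, c s *\<^sub>R w)" "(0, k, c s *\<^sub>R w')"]
        by (simp add: K_def algebra_simps)
      also have "norm \<dots> \<le> norm (c s *\<^sub>R (w - w')) / 2"
        by (rule derivative_dom_le[OF W(1) H1 lip s x fW[OF \<sigma>_ball[OF s x]]])
      also have "\<dots> \<le> norm (w - w') / 2"
        using c(2)[OF s] by (simp add: mult_left_le_one_le)
      finally show "norm (K (s, x, w) - K (s, x, w')) \<le> norm (w - w') / 2" .
    next
      show "continuous_on (ball 0 d) (\<lambda>x. ?Df x k)"
        using C1(3) by (intro continuous_at_imp_continuous_on) blast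
      fix x :: 'a assume x: "x \<in> ball 0 d"
      have "((\<lambda>s. K (s, x, ?Df (\<sigma> s x) k)) has_integral ?Df x k) {0..1}"
      proof (rule has_integral_eq[OF _ C1(2)[OF x]])
        fix s :: real assume s: "s \<in> {0..1}"
        have "linear (?Df (\<sigma> s x))" using C1(1)[OF \<sigma>_ball[OF s x]] has_derivative_linear by blast
        then show "?DH (s, x, f (\<sigma> s x)) (0, k, ?Df (\<sigma> s x) (\<sigma> s k)) = K (s, x, ?Df (\<sigma> s x) k)"
          by (simp add: K_def c(1) linear_scale)
      qed
      then show "?Df x k = integral {0..1} (\<lambda>s. K (s, x, ?Df (\<sigma> s x) k))" by (simp add: integral_unique)
    qed simp
  qed
  have Plin: "linear P"
    by (rule bounded_linear.linear[OF shrinking.lin[OF shrinking_axioms]])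
  show ?case
  proof (rule C_diff_on_SucI[OF open_ball C1(1)])
    fix v
    \<comment> \<open>Each \<open>v\<close> is the sum of \<open>P v\<close> and
      \<open>v - P v\<close>, on which \<open>\<sigma> s\<close> acts by the factors
      \<open>s\<close> and 1.\<close>
    have "\<sigma> s (P v) = s *\<^sub>R P v" "\<sigma> s (v - P v) = 1 *\<^sub>R (v - P v)" for s
      using idem linear_diff[OF Plin, of v "P v"] by (simp_all add: \<sigma>_def algebra_simps)
    note eig = this
    have "C_diff_on n (ball 0 d) (\<lambda>x. ?Df x (P v))"
      by (rule eigen[OF eig(1)]) (auto intro: C_diff_on_linear bounded_linear_ident)
    moreover have "C_diff_on n (ball 0 d) (\<lambda>x. ?Df x (v - P v))"
      by (rule eigen[OF eig(2)]) (auto intro: C_diff_on_const)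
    ultimately have "C_diff_on n (ball 0 d) (\<lambda>x. ?Df x (P v) + ?Df x (v - P v))"
      by (intro C_diff_on_add open_ball)
    then show "C_diff_on n (ball 0 d) (\<lambda>x. ?Df x v)"
    proof (rule C_diff_on_cong[OF open_ball, rotated])
      fix x :: 'a assume "x \<in> ball 0 d"
      then have "linear (?Df x)" using C1(1) has_derivative_linear by blast
      then show "?Df x (P v) + ?Df x (v - P v) = ?Df x v" by (simp add: linear_diff)
    qed
  qed
qed

text \<open>The vanishing derivative at the origin makes \<open>H\<close> contract by 1/2 in its
  second argument on a small ball. Besides the solution, the differentiated equation and the bound
  1/2 along the solution are exported; \<open>frobenius_flow\<close> identifies the derivative of
  the flow by them.\<close>

lemma fixpoint_local:
  fixes H :: "'a \<times> 'e::euclidean_space \<Rightarrow> 'e"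
  assumes Q: "open Q" "(0, 0) \<in> Q" and H: "smooth_on Q H" and H0: "H (0, 0) = 0"
    and DH0: "\<And>k. fderiv H (0, 0) (0, k) = 0"
  obtains d f where "d > 0" "smooth_on (ball 0 d) f" "f 0 = 0"
    "\<And>s x. s \<in> {0..1} \<Longrightarrow> x \<in> ball 0 d \<Longrightarrow> (x, f (\<sigma> s x)) \<in> Q"
    "\<And>x. x \<in> ball 0 d \<Longrightarrow> ((\<lambda>s. H (x, f (\<sigma> s x))) has_integral f x) {0..1}"
    "\<And>x k. x \<in> ball 0 d \<Longrightarrow> ((\<lambda>s. fderiv H (x, f (\<sigma> s x))
        (k, fderiv f (\<sigma> s x) (\<sigma> s k))) has_integral fderiv f x k) {0..1}"
    "\<And>s x k. s \<in> {0..1} \<Longrightarrow> x \<in> ball 0 d \<Longrightarrow>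
      norm (fderiv H (x, f (\<sigma> s x)) (0, k)) \<le> norm k / 2"
proof -
  let ?DH = "\<lambda>p. fderiv H p"
  note derH = smooth_on_has_derivative[OF H]
  define E where "E = Blinfun (\<lambda>k::'e. (0::'a, k))"
  have E: "blinfun_apply E k = (0, k)" for k
    unfolding E_def by (subst bounded_linear_Blinfun_apply)
      (auto intro!: bounded_linear_Pair bounded_linear_zero bounded_linear_ident)
  define D where "D p = Blinfun (?DH p) o\<^sub>L E" for p
  have D: "blinfun_apply (D p) k = ?DH p (0, k)" if "p \<in> Q" for p k
    using bounded_linear_Blinfun_apply[OF smooth_on_bounded_linear[OF H that]] by (simp add: D_def E)
  have contD: "continuous_on Q D"
  proof (rule continuous_on_blinfun_componentwise)
    fix i :: 'e
    show "continuous_on Q (\<lambda>p. blinfun_apply (D p) i)"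
      using smooth_on_continuous[OF smooth_on_derivative[OF H, of "(0, i)"]] D
      by (simp cong: continuous_on_cong)
  qed
  have D0: "D (0, 0) = 0"
    using D[OF Q(2)] DH0 by (intro blinfun_eqI) simp
  obtain r1 where r1: "r1 > 0" "\<And>p. p \<in> Q \<Longrightarrow> dist p (0, 0) < r1 \<Longrightarrow> norm (D p) < 1/2"
    using contD Q(2) D0 unfolding continuous_on_iff by (metis dist_0_norm dist_commute half_gt_zero zero_less_one)
  obtain r2 where r2: "r2 > 0" "ball (0, 0) r2 \<subseteq> Q" using Q openE by blast
  \<comment> \<open>Two vectors of norm at most \<open>r\<close> form a pair of norm at most
    \<open>2 r\<close>, which has to be strictly below \<open>r1\<close> and
    \<open>r2\<close>.\<close>
  define r where "r = min r1 r2 / 4"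
  have r: "r > 0" "4 * r \<le> r1" "4 * r \<le> r2" using r1(1) r2(1) by (auto simp: r_def)
  have near: "(x, w) \<in> Q" "norm (D (x, w)) < 1/2" if "norm x \<le> r" "norm w \<le> r" for x w
  proof -
    have d: "dist (x, w) (0, 0) \<le> 2 * r"
      using norm_Pair_le[of x w] that by (simp add: dist_norm)
    then show "(x, w) \<in> Q" using r r2 by (auto simp: dist_commute subset_iff)
    then show "norm (D (x, w)) < 1/2" using r1(2) d r by auto
  qed
  have DHle: "norm (?DH (x, w) (0, k)) \<le> norm k / 2" if "norm x \<le> r" "norm w \<le> r" for x w k
  proof -
    have "norm (?DH (x, w) (0, k)) \<le> norm (D (x, w)) * norm k"
      using norm_blinfun[of "D (x, w)" k] D[OF near(1)[OF that]] by simp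
    also have "\<dots> \<le> 1/2 * norm k" using near(2)[OF that] by (intro mult_right_mono) auto
    finally show ?thesis by simp
  qed
  have lip: "norm (H (x, w) - H (x, w')) \<le> norm (w - w') / 2"
    if "norm x \<le> r" "norm w \<le> r" "norm w' \<le> r" for x w w'
  proof -
    have "norm (H (x, w) - H (x, w')) \<le> 1/2 * norm (w - w')"
    proof (rule differentiable_bound[of "cball 0 r" "\<lambda>w. H (x, w)" "\<lambda>w k. ?DH (x, w) (0, k)"])
      fix v :: 'e assume v: "v \<in> cball 0 r"
      show "((\<lambda>w. H (x, w)) has_derivative (\<lambda>k. ?DH (x, v) (0, k))) (at v within cball 0 r)"
        by (rule has_derivative_at_withinI)
          (use derH[OF near(1)[OF that(1)]] v in
           \<open>auto intro!: derivative_eq_intros has_derivative_compose[of "\<lambda>w. (x, w)" _ v UNIV H]\<close>)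
      show "onorm (\<lambda>k. ?DH (x, v) (0, k)) \<le> 1/2"
        by (rule onorm_le) (use DHle that v in auto)
    qed (use that in auto)
    then show ?thesis by simp
  qed
  have "continuous_on (cball 0 r) (\<lambda>x. H (x, 0))"
    by (rule continuous_on_compose2[OF smooth_on_continuous[OF H]])
      (use near r in \<open>auto intro!: continuous_intros\<close>)
  then obtain d0 where d0: "d0 > 0" "\<And>x. norm x \<le> r \<Longrightarrow> norm x < d0 \<Longrightarrow> norm (H (x, 0)) < r / 4"
    unfolding continuous_on_iff using r(1) H0
    by (metis (no_types, lifting) dist_0_norm dist_commute divide_pos_pos mem_cball norm_zero order_less_imp_le zero_less_numeral)
  define d where "d = min r d0 / 2"
  have d: "d > 0" "d \<le> r" "d < d0" using r(1) d0(1) by (auto simp: d_def)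
  \<comment> \<open>One quarter of \<open>r\<close> comes from \<open>H (x, 0)\<close>, the other
    from the Lipschitz bound on \<open>w\<close>; so the ball of radius \<open>r / 2\<close> is
    mapped into itself.\<close>
  have Hr: "norm (H (x, w)) \<le> r / 2" if "norm x \<le> d" "norm w \<le> r / 2" for x w
    using lip[of x w 0] d0(2)[of x] norm_triangle_sub[of "H (x, w)" "H (x, 0)"] that d r(1) by simp
  have contH: "continuous_on (cball 0 r \<times> cball 0 r) H"
    by (rule continuous_on_subset[OF smooth_on_continuous[OF H]]) (use near in auto)
  obtain f where f: "continuous_on (cball 0 d) f" "f ` cball 0 d \<subseteq> cball 0 (r / 2)"
    "\<And>x. x \<in> cball 0 d \<Longrightarrow> f x = integral {0..1} (\<lambda>s. H (x, f (\<sigma> s x)))"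
  proof (rule integral_fixpoint_exists[of "cball 0 d" \<sigma> "cball 0 (r / 2)" 0 "\<lambda>s x w. H (x, w)"])
    show "continuous_on ({0..1} \<times> cball 0 d) (\<lambda>(s, x). \<sigma> s x)"
      by (auto simp: split_def intro!: continuous_intros)
    show "continuous_on ({0..1} \<times> cball 0 d \<times> cball 0 (r / 2)) (\<lambda>(s, x, w). H (x, w))"
      unfolding split_def
      by (rule continuous_on_compose2[OF contH]) (use d r(1) in \<open>auto intro!: continuous_intros\<close>)
    fix g :: "'a \<Rightarrow> 'e" and x :: 'a assume g: "continuous_on (cball 0 d) g" "g ` cball 0 d \<subseteq> cball 0 (r / 2)"
      and x: "x \<in> cball 0 d"
    have "continuous_on {0..1} (\<lambda>s. \<sigma> s x)" by (intro continuous_intros)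
    then have "continuous_on {0..1} (\<lambda>s. g (\<sigma> s x))"
      by (rule continuous_on_compose2[OF g(1)]) (use \<sigma>_cball[OF _ x] in blast)
    then have "continuous_on {0..1} (\<lambda>s. (x, g (\<sigma> s x)))" by (intro continuous_intros)
    then have c: "continuous_on {0..1} (\<lambda>s. H (x, g (\<sigma> s x)))"
      by (rule continuous_on_compose2[OF contH])
        (use d r(1) x g(2) \<sigma>_cball[OF _ x] in \<open>force simp: image_subset_iff\<close>)
    have "norm (integral {0..1} (\<lambda>s. H (x, g (\<sigma> s x)))) \<le> r / 2"
      by (rule integral_norm_le_01[OF integrable_continuous_real[OF c]])
        (use Hr x g(2) \<sigma>_cball[OF _ x] in \<open>force simp: image_subset_iff\<close>)
    then show "integral {0..1} (\<lambda>s. H (x, g (\<sigma> s x))) \<in> cball 0 (r / 2)" by simp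
  next
    fix s :: real and x :: 'a and w w' :: 'e assume "x \<in> cball 0 d" "w \<in> cball 0 (r / 2)" "w' \<in> cball 0 (r / 2)"
    then show "norm (H (x, w) - H (x, w')) \<le> norm (w - w') / 2"
      using lip[of x w w'] d(2) r(1) by simp
  next
    show "\<sigma> s x \<in> cball 0 d" if "s \<in> {0..1}" "x \<in> cball 0 d" for s x
      using that by (rule \<sigma>_cball)
    show "(0::'e) \<in> cball 0 (r / 2)" using r(1) by simp
  qed (rule compact_cball closed_cball | blast)+
  have fr: "norm (f x) \<le> r / 2" if "norm x \<le> d" for x using f(2) that by (auto simp: image_subset_iff)
  \<comment> \<open>\<open>?K\<close> is \<open>H\<close> with a dummy parameter \<open>s\<close>.
    The regularity results want an open convex set of values: the open ball of radius
    \<open>r\<close> around the closed ball of radius \<open>r / 2\<close> that contains the values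
    of \<open>f\<close>.\<close>
  let ?K = "\<lambda>p. H (snd p)"
  have KC: "C_diff_on n (param_dom d (ball 0 r)) ?K" for n
  proof (rule C_diff_on_compose[OF open_dom Q(1)])
    show "C_diff_on n (param_dom d (ball 0 r)) (\<lambda>p::real \<times> 'a \<times> 'e. snd p)"
      by (intro C_diff_on_linear open_dom open_ball bounded_linear_snd)
    show "C_diff_on n Q H" using H by (simp add: smooth_on_def)
    show "snd ` param_dom d (ball 0 r) \<subseteq> Q" using near(1) d(2) by (auto simp: param_dom_def)
  qed simp
  have fc: "continuous_on (ball 0 d) f" by (rule continuous_on_subset[OF f(1)]) auto
  have fW: "f x \<in> ball 0 r" if "x \<in> ball 0 d" for x using fr[of x] that r(1) by simp
  have lipK: "norm (?K (s, x, w) - ?K (s, x, w')) \<le> norm (w - w') / 2"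
    if "s \<in> {0..1}" "x \<in> ball 0 d" "w \<in> ball 0 r" "w' \<in> ball 0 r" for s :: real and x :: 'a and w w'
    using lip[of x w w'] that d(2) by simp
  have eqK: "f x = integral {0..1} (\<lambda>s. ?K (s, x, f (\<sigma> s x)))" if "x \<in> ball 0 d" for x :: 'a
    using f(3)[of x] that by simp
  have f_smooth: "smooth_on (ball 0 d) f"
    unfolding smooth_on_def
  proof
    fix n
    show "C_diff_on n (ball 0 d) f"
      by (rule fixpoint_Cn[of "ball 0 r" n d ?K f, OF open_ball convex_ball KC]; fact)
  qed
  have C1: "((\<lambda>s. fderiv ?K (s, x, f (\<sigma> s x))
        (0, k, fderiv f (\<sigma> s x) (\<sigma> s k))) has_integral fderiv f x k) {0..1}"
    if "x \<in> ball 0 d" for x k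
    by (rule fixpoint_C1(2)[of "ball 0 r" d ?K f x, OF open_ball convex_ball KC]; fact)
  have "(x, f (\<sigma> s x)) \<in> Q \<and> norm x \<le> r \<and> norm (f (\<sigma> s x)) \<le> r"
    if "s \<in> {0..1}" "x \<in> ball 0 d" for s x
  proof -
    have 1: "norm x \<le> r" using that d(2) by simp
    have 2: "norm (f (\<sigma> s x)) \<le> r" using fW[OF \<sigma>_ball[OF that]] by simp
    show ?thesis using near(1)[OF 1 2] 1 2 by blast
  qed
  note inQ = this[THEN conjunct1] and nr = this[THEN conjunct2, THEN conjunct1] this[THEN conjunct2, THEN conjunct2]
  show ?thesis
  proof (rule that[OF d(1) f_smooth])
    \<comment> \<open>All \<open>\<sigma> s 0\<close> equal 0, so \<open>f 0\<close> is a fixed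
      point of the contraction \<open>w \<mapsto> H (0, w)\<close>, which also fixes 0.\<close>
    have "norm (f 0) \<le> norm (f 0) / 2"
    proof -
      have "\<sigma> s 0 = 0" for s using bounded_linear.linear[OF bounded_linear_\<sigma>] linear_0 by blast
      then have "f 0 = H (0, f 0)" using f(3)[of 0] d(1) by simp
      then show ?thesis using lip[of 0 "f 0" 0] H0 fr[of 0] d(1) r(1) by simp
    qed
    then show "f 0 = 0" by simp
    show "(x, f (\<sigma> s x)) \<in> Q" if "s \<in> {0..1}" "x \<in> ball 0 d" for s x by (rule inQ[OF that])
    show "norm (?DH (x, f (\<sigma> s x)) (0, k)) \<le> norm k / 2" if "s \<in> {0..1}" "x \<in> ball 0 d" for s x k
      by (rule DHle[OF nr[OF that]])
    show "((\<lambda>s. H (x, f (\<sigma> s x))) has_integral f x) {0..1}" if x: "x \<in> ball 0 d" for x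
    proof -
      have "continuous_on {0..1} (\<lambda>s. \<sigma> s x)" by (intro continuous_intros)
      then have "continuous_on {0..1} (\<lambda>s. f (\<sigma> s x))"
        by (rule continuous_on_compose2[OF fc]) (use \<sigma>_ball[OF _ x] in blast)
      then have "continuous_on {0..1} (\<lambda>s. (x, f (\<sigma> s x)))" by (intro continuous_intros)
      then have "continuous_on {0..1} (\<lambda>s. H (x, f (\<sigma> s x)))"
        by (rule continuous_on_compose2[OF smooth_on_continuous[OF H]]) (use inQ[OF _ x] in blast)
      from integrable_integral[OF integrable_continuous_real[OF this]] eqK[OF x] show ?thesis by simp
    qed
    show "((\<lambda>s. ?DH (x, f (\<sigma> s x)) (k, fderiv f (\<sigma> s x) (\<sigma> s k)))
      has_integral fderiv f x k) {0..1}" if x: "x \<in> ball 0 d" for x k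
    proof (rule has_integral_eq[OF _ C1[OF x]])
      fix s :: real assume s: "s \<in> {0..1}"
      have "(?K has_derivative (\<lambda>h. ?DH (x, f (\<sigma> s x)) (snd h))) (at (s, x, f (\<sigma> s x)))"
        using derH[OF inQ[OF s x]]
        by (auto intro!: derivative_eq_intros has_derivative_compose[of snd _ _ UNIV H])
      then show "fderiv ?K (s, x, f (\<sigma> s x)) (0, k, fderiv f (\<sigma> s x) (\<sigma> s k))
        = ?DH (x, f (\<sigma> s x)) (k, fderiv f (\<sigma> s x) (\<sigma> s k))"
        by (simp add: frechet_derivativeI)
    qed
  qed
qed

end

subsection \<open>Coordinate projections\<close>

definition proj :: "'n set \<Rightarrow> real^'n \<Rightarrow> real^'n" where
  "proj K x = (\<chi> i. if i \<in> K then x $ i else 0)"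

lemma proj_nth [simp]: "proj K x $ i = (if i \<in> K then x $ i else 0)"
  by (simp add: proj_def)

lemma linear_proj: "linear (proj K)"
  by (auto simp: linear_iff vec_eq_iff)

lemma bounded_linear_proj: "bounded_linear (proj K)"
  using linear_proj linear_conv_bounded_linear by blast

lemma proj_idem [simp]: "proj K (proj K x) = proj K x"
  by (simp add: vec_eq_iff)

lemma proj_compl [simp]: "proj K (proj (- K) x) = 0" "proj (- K) (proj K x) = 0"
  by (simp_all add: vec_eq_iff)

lemma proj_0 [simp]: "proj K 0 = 0"
  by (simp add: vec_eq_iff)

lemma proj_add_compl: "proj K x + proj (- K) x = x"
  by (simp add: vec_eq_iff)

lemma proj_eq_self_iff: "proj K x = x \<longleftrightarrow> (\<forall>i. i \<notin> K \<longrightarrow> x $ i = 0)"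
  by (auto simp: vec_eq_iff)

lemma proj_add: "proj K (x + y) = proj K x + proj K y"
  by (simp add: vec_eq_iff)

lemma proj_diff: "proj K (x - y) = proj K x - proj K y"
  by (simp add: vec_eq_iff)

lemma proj_minus: "proj K (- x) = - proj K x"
  by (simp add: vec_eq_iff)

lemma proj_scaleR: "proj K (a *\<^sub>R x) = a *\<^sub>R proj K x"
  by (simp add: vec_eq_iff)

lemma norm_proj_shrink:
  assumes "0 \<le> t" "t \<le> 1"
  shows "norm (x - t *\<^sub>R proj K x) \<le> norm x"
proof (rule norm_le_componentwise_cart)
  fix i
  have "\<bar>(1 - t) * x $ i\<bar> \<le> \<bar>x $ i\<bar>"
    using assms by (simp add: abs_mult mult_left_le_one_le)
  then show "norm ((x - t *\<^sub>R proj K x) $ i) \<le> norm (x $ i)"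
    by (simp add: algebra_simps)
qed

subsection \<open>Commuting frames and the Frobenius theorem\<close>

text \<open>
  Along the ray through \<open>h\<close> from a point \<open>q\<close> of the complement, \<open>f\<close> is the flow of \<open>z \<mapsto> G z h\<close>
  starting at \<open>q\<close>. Commutativity makes \<open>s \<mapsto> s G (f (\<sigma> s x)) h\<close> and the derivative of \<open>f\<close> along \<open>h\<close>
  solutions of the same linear equation.
\<close>
lemma frobenius_flow:
  fixes G :: "real^'n \<Rightarrow> real^'n^'n"
  assumes Q: "open Q" "0 \<in> Q" and G: "smooth_on Q G" and G0: "G 0 = mat 1"
    and comm: "\<And>z h k. z \<in> Q \<Longrightarrow> proj K h = h \<Longrightarrow> proj K k = k \<Longrightarrow>
      fderiv G z (G z *v h) *v k = fderiv G z (G z *v k) *v h"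
  obtains d f where "d > 0" "smooth_on (ball 0 d) f" "f 0 = 0" "f ` ball 0 d \<subseteq> Q"
    "\<And>k. fderiv f 0 k = k"
    "\<And>x h. x \<in> ball 0 d \<Longrightarrow> proj K h = h \<Longrightarrow> fderiv f x h = G (f x) *v h"
proof -
  let ?P = "proj K"
  interpret shrinking ?P
    by (rule shrinking.intro) (simp_all add: bounded_linear_proj norm_proj_shrink)
  let ?DG = "\<lambda>z. fderiv G z"
  \<comment> \<open>Integrating \<open>H (x, f (\<sigma> s x))\<close> gives the starting point
    \<open>x - P x\<close> plus the integral of the field \<open>G\<close> applied to
    \<open>P x\<close> along the image of the ray.\<close>
  define H where "H = (\<lambda>p. (fst p - ?P (fst p)) + G (snd p) *v ?P (fst p))"
  have oQ: "open ((UNIV :: (real^'n) set) \<times> Q)" using Q(1) by (simp add: open_Times)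
  have smH: "smooth_on (UNIV \<times> Q) H"
  proof -
    have P: "smooth_on (UNIV \<times> Q) (\<lambda>p. ?P (fst p))"
      using oQ by (intro smooth_on_linear) (auto intro: bounded_linear_compose[OF bounded_linear_proj bounded_linear_fst])
    have "smooth_on ((UNIV :: (real^'n) set) \<times> Q) (\<lambda>p. G (snd p))"
      by (rule smooth_on_compose[OF oQ Q(1) _ G]) (auto intro!: smooth_on_linear oQ bounded_linear_snd)
    then show ?thesis
      unfolding H_def using oQ P
      by (intro smooth_on_add smooth_on_diff smooth_on_matrix_vector_mult) (auto intro: smooth_on_linear bounded_linear_fst)
  qed
  have derH: "fderiv H (x, w) (k, l) = (k - ?P k) + G w *v ?P k + ?DG w l *v ?P x"
    if "w \<in> Q" for x w k l
  proof -
    have dG: "((\<lambda>p. G (snd p)) has_derivative (\<lambda>q. ?DG w (snd q))) (at (x, w))"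
      using smooth_on_has_derivative[OF G that]
      by (auto intro!: derivative_eq_intros has_derivative_compose[of snd _ _ UNIV G])
    have dP: "((\<lambda>p. ?P (fst p)) has_derivative (\<lambda>q. ?P (fst q))) (at (x, w))"
      by (rule bounded_linear_imp_has_derivative) (rule bounded_linear_compose[OF bounded_linear_proj bounded_linear_fst])
    have "(fst has_derivative fst) (at (x, w))"
      by (rule bounded_linear_imp_has_derivative) (rule bounded_linear_fst)
    from has_derivative_add[OF has_derivative_diff[OF this dP]
        bounded_bilinear.FDERIV[OF bounded_bilinear_matrix_vector_mult dG dP]]
    have "(H has_derivative (\<lambda>q. (fst q - ?P (fst q)) + (G w *v ?P (fst q) + ?DG w (snd q) *v ?P x))) (at (x, w))"
      by (simp add: H_def)
    from frechet_derivativeI[OF this] show ?thesis by simp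
  qed
  obtain d f where d: "d > 0" and f: "smooth_on (ball 0 d) f" and f0: "f 0 = 0"
    and inQ: "\<And>s x. s \<in> {0..1} \<Longrightarrow> x \<in> ball 0 d \<Longrightarrow> (x, f (\<sigma> s x)) \<in> UNIV \<times> Q"
    and eq: "\<And>x. x \<in> ball 0 d \<Longrightarrow> ((\<lambda>s. H (x, f (\<sigma> s x))) has_integral f x) {0..1}"
    and deq: "\<And>x k. x \<in> ball 0 d \<Longrightarrow> ((\<lambda>s. fderiv H (x, f (\<sigma> s x))
        (k, fderiv f (\<sigma> s x) (\<sigma> s k))) has_integral fderiv f x k) {0..1}"
    and le: "\<And>s x k. s \<in> {0..1} \<Longrightarrow> x \<in> ball 0 d \<Longrightarrow>
      norm (fderiv H (x, f (\<sigma> s x)) (0, k)) \<le> norm k / 2"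
  proof (rule fixpoint_local[of "UNIV \<times> Q" H])
    show "fderiv H (0, 0) (0, k) = 0" for k
      using derH[OF Q(2)] by simp
  qed (use oQ Q smH in \<open>auto simp: H_def\<close>)
  let ?Df = "\<lambda>x. fderiv f x"
  have derf: "(f has_derivative ?Df x) (at x)" if "x \<in> ball 0 d" for x
    using smooth_on_has_derivative[OF f that] .
  have linf: "linear (?Df x)" if "x \<in> ball 0 d" for x
    using derf[OF that] has_derivative_linear by blast
  have linG: "linear (?DG z)" if "z \<in> Q" for z
    using smooth_on_has_derivative[OF G that] has_derivative_linear by blast
  have fQ: "f (\<sigma> s x) \<in> Q" if "s \<in> {0..1}" "x \<in> ball 0 d" for s x using inQ[OF that] by simp
  have \<sigma>1: "\<sigma> 1 x = x" for x by (simp add: \<sigma>_def)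
  have P\<sigma>: "?P (\<sigma> s x) = s *\<^sub>R ?P x" for s x
    by (simp add: \<sigma>_def vec_eq_iff algebra_simps)
  have \<sigma>\<sigma>: "\<sigma> t (\<sigma> s x) = \<sigma> (t * s) x" for s t x
    unfolding \<sigma>_def[of t] P\<sigma> by (simp add: \<sigma>_def algebra_simps)
  have d\<sigma>: "((\<lambda>s. \<sigma> s x) has_vector_derivative ?P x) (at s within S)" for s x S
    unfolding \<sigma>_def has_vector_derivative_def by (auto intro!: derivative_eq_intros)
  have df\<sigma>: "((\<lambda>s. f (\<sigma> s x)) has_vector_derivative ?Df (\<sigma> s x) (?P x)) (at s within S)"
    if "s \<in> {0..1}" "x \<in> ball 0 d" for s x S
  proof -
    have "((\<lambda>s. f (\<sigma> s x)) has_derivative (\<lambda>h. ?Df (\<sigma> s x) (h *\<^sub>R ?P x))) (at s within S)"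
      by (rule has_derivative_compose[OF d\<sigma>[unfolded has_vector_derivative_def] derf[OF \<sigma>_ball[OF that]]])
    then show ?thesis
      using linear_scale[OF linf[OF \<sigma>_ball[OF that]]] by (simp add: has_vector_derivative_def)
  qed
  \<comment> \<open>The equation at \<open>\<sigma> u y\<close>, with \<open>t * u\<close> as ray
    parameter, exhibits \<open>f (\<sigma> u y)\<close> as the starting point plus the primitive
    \<open>F u\<close> of the field along the ray. Differentiating in \<open>u\<close> gives the
    flow equation.\<close>
  have ray: "?Df (\<sigma> s y) (?P y) = G (f (\<sigma> s y)) *v ?P y" if s: "s \<in> {0..1}" and y: "y \<in> ball 0 d" for s y
  proof -
    define p where "p s = G (f (\<sigma> s y)) *v ?P y" for s
    have cf: "continuous_on {0..1} (\<lambda>s. f (\<sigma> s y))"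
      by (rule continuous_on_compose2[OF smooth_on_continuous[OF f]])
        (use \<sigma>_ball[OF _ y] in \<open>auto intro!: continuous_intros simp del: mem_ball\<close>)
    have "continuous_on {0..1} (\<lambda>s. G (f (\<sigma> s y)))"
      by (rule continuous_on_compose2[OF smooth_on_continuous[OF G] cf]) (use fQ[OF _ y] in blast)
    then have cp: "continuous_on {0..1} p"
      unfolding p_def by (intro bounded_bilinear.continuous_on[OF bounded_bilinear_matrix_vector_mult] continuous_on_const)
    define F where "F u = integral {0..u} p" for u
    have dF: "(F has_vector_derivative p u) (at u within {0..1})" if "u \<in> {0..1}" for u
      unfolding F_def using integral_has_vector_derivative[OF cp that] .
    have F0: "F 0 = 0" by (simp add: F_def)
    have fF: "f (\<sigma> u y) = (y - ?P y) + F u" if u: "u \<in> {0..1}" for u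
    proof -
      have "((\<lambda>t. u *\<^sub>R p (t * u)) has_integral (F (1 * u) - F (0 * u))) {0..1}"
      proof (rule fundamental_theorem_of_calculus)
        fix t :: real assume t: "t \<in> {0..1}"
        have "(F has_vector_derivative p (t * u)) (at (t * u) within (\<lambda>t. t * u) ` {0..1})"
          by (rule has_vector_derivative_within_subset[OF dF])
            (use t u in \<open>auto simp: mult_le_one\<close>)
        moreover have "((\<lambda>t. t * u) has_vector_derivative u) (at t within {0..1})"
          unfolding has_vector_derivative_def by (auto intro!: derivative_eq_intros)
        ultimately show "((\<lambda>t. F (t * u)) has_vector_derivative u *\<^sub>R p (t * u)) (at t within {0..1})"
          using vector_diff_chain_within[of "\<lambda>t. t * u" u t "{0..1}" F] by (simp add: o_def)
      qed simp
      from has_integral_add[OF has_integral_const_real[of "y - ?P y" 0 1] this]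
      have "((\<lambda>t. (y - ?P y) + u *\<^sub>R p (t * u)) has_integral ((y - ?P y) + F u)) {0..1}"
        by (simp add: F0)
      moreover have "(y - ?P y) + u *\<^sub>R p (t * u) = H (\<sigma> u y, f (\<sigma> t (\<sigma> u y)))" for t
        unfolding \<sigma>\<sigma> by (simp add: H_def P\<sigma> p_def) (simp add: \<sigma>_def algebra_simps matrix_vector_mult_scaleR)
      ultimately have "((\<lambda>t. H (\<sigma> u y, f (\<sigma> t (\<sigma> u y)))) has_integral ((y - ?P y) + F u)) {0..1}"
        by simp
      from has_integral_unique[OF eq[OF \<sigma>_ball[OF u y]] this] show ?thesis .
    qed
    have "((\<lambda>u. (y - ?P y) + F u) has_vector_derivative 0 + p s) (at s within {0..1})"
      by (intro has_vector_derivative_add dF s has_vector_derivative_const)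
    then have "((\<lambda>u. (y - ?P y) + F u) has_vector_derivative p s) (at s within {0..1})" by simp
    from has_vector_derivative_transform[OF s _ this]
    have "((\<lambda>u. f (\<sigma> u y)) has_vector_derivative p s) (at s within {0..1})" using fF by simp
    then show ?thesis
      using vector_derivative_unique_within_closed_interval[of 0 1 s "\<lambda>u. f (\<sigma> u y)"]
        df\<sigma>[OF s y, of "{0..1}"] s
      by (simp add: p_def)
  qed
  have frame: "?Df x h = G (f x) *v h" if x: "x \<in> ball 0 d" and h: "?P h = h" for x h
  proof -
    let ?U = "cball 0 (norm x)"
    let ?D = "\<lambda>y. ?Df y h - G (f y) *v h"
    \<comment> \<open>The derivative of \<open>s \<mapsto> s G (f (\<sigma> s y)) h\<close>, with
      \<open>h\<close> and \<open>P y\<close> interchanged in its second term by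
      \<open>comm\<close>. In this form it is the integrand of \<open>deq\<close> with
      \<open>G (f (\<sigma> s y)) h\<close> in place of the derivative of \<open>f\<close>, so
      \<open>?D\<close> solves a homogeneous equation.\<close>
    define r where "r y s = G (f (\<sigma> s y)) *v h + s *\<^sub>R (?DG (f (\<sigma> s y)) (G (f (\<sigma> s y)) *v h) *v ?P y)" for y s
    let ?d = "\<lambda>y s. fderiv H (y, f (\<sigma> s y)) (h, ?Df (\<sigma> s y) (\<sigma> s h)) - r y s"
    have U: "y \<in> ball 0 d" if "y \<in> ?U" for y using that x by simp
    have \<sigma>h: "\<sigma> s h = s *\<^sub>R h" for s using h by (simp add: \<sigma>_def algebra_simps)
    have r: "(r y has_integral G (f y) *v h) {0..1}" if y: "y \<in> ball 0 d" for y
    proof -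
      have "(r y has_integral (1 *\<^sub>R (G (f (\<sigma> 1 y)) *v h) - 0 *\<^sub>R (G (f (\<sigma> 0 y)) *v h))) {0..1}"
      proof (rule fundamental_theorem_of_calculus)
        fix s :: real assume s: "s \<in> {0..1}"
        let ?z = "f (\<sigma> s y)"
        note z = fQ[OF s y]
        have "((\<lambda>s. f (\<sigma> s y)) has_derivative (\<lambda>t. t *\<^sub>R (G ?z *v ?P y))) (at s within {0..1})"
          using df\<sigma>[OF s y, of "{0..1}"] ray[OF s y] by (simp add: has_vector_derivative_def)
        from has_derivative_compose[OF this smooth_on_has_derivative[OF G z]]
        have "((\<lambda>s. G (f (\<sigma> s y))) has_vector_derivative ?DG ?z (G ?z *v ?P y)) (at s within {0..1})"
          using linear_scale[OF linG[OF z]] by (simp add: has_vector_derivative_def)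
        from bounded_linear.has_vector_derivative[OF
            bounded_bilinear.bounded_linear_left[OF bounded_bilinear_matrix_vector_mult] this]
        have "((\<lambda>s. G (f (\<sigma> s y)) *v h) has_vector_derivative ?DG ?z (G ?z *v ?P y) *v h) (at s within {0..1})" .
        from has_vector_derivative_scaleR[OF DERIV_ident this]
        have "((\<lambda>s. s *\<^sub>R (G (f (\<sigma> s y)) *v h)) has_vector_derivative
            s *\<^sub>R (?DG ?z (G ?z *v ?P y) *v h) + 1 *\<^sub>R (G ?z *v h)) (at s within {0..1})" .
        then show "((\<lambda>s. s *\<^sub>R (G (f (\<sigma> s y)) *v h)) has_vector_derivative r y s) (at s within {0..1})"
          using comm[OF z h proj_idem[of K y]] by (simp add: r_def add.commute)
      qed simp
      then show ?thesis by (simp add: \<sigma>1)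
    qed
    have "?D x = 0"
    proof (rule integral_contraction_zero[of ?U ?D \<sigma> ?d])
      show "continuous_on ?U ?D"
      proof -
        have "continuous_on (ball 0 d) (\<lambda>y. G (f y))"
          by (rule continuous_on_compose2[OF smooth_on_continuous[OF G] smooth_on_continuous[OF f]])
            (use fQ[of 1] in \<open>auto simp: \<sigma>1\<close>)
        then have "continuous_on (ball 0 d) ?D"
          using smooth_on_continuous[OF smooth_on_derivative[OF f]]
          by (intro continuous_on_diff bounded_bilinear.continuous_on[OF bounded_bilinear_matrix_vector_mult]
              continuous_on_const)
        then show ?thesis by (rule continuous_on_subset) (use U in blast)
      qed
      show "(?d y has_integral ?D y) {0..1}" if "y \<in> ?U" for y
        by (rule has_integral_diff[OF deq[OF U[OF that]] r[OF U[OF that]]])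
      show "norm (?d y s) \<le> norm (?D (\<sigma> s y)) / 2" if s: "s \<in> {0..1}" and y': "y \<in> ?U" for s y
      proof -
        note y = U[OF y']
        note z = fQ[OF s y]
        note lins = linear_diff[OF linG[OF z]] linear_scale[OF linG[OF z]] linear_scale[OF linf[OF \<sigma>_ball[OF s y]]]
        have "?d y s = s *\<^sub>R (?DG (f (\<sigma> s y)) (?D (\<sigma> s y)) *v ?P y)"
          using h by (simp add: derH[OF z] r_def \<sigma>h lins algebra_simps scaleR_matrix_vector_assoc[symmetric])
        also have "\<dots> = fderiv H (y, f (\<sigma> s y)) (0, s *\<^sub>R ?D (\<sigma> s y))"
          by (simp add: derH[OF z] linear_scale[OF linG[OF z]] scaleR_matrix_vector_assoc[symmetric])
        finally have "norm (?d y s) = norm (fderiv H (y, f (\<sigma> s y)) (0, s *\<^sub>R ?D (\<sigma> s y)))"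
          by (rule arg_cong)
        also have "\<dots> \<le> norm (s *\<^sub>R ?D (\<sigma> s y)) / 2" by (rule le[OF s y])
        also have "\<dots> \<le> norm (?D (\<sigma> s y)) / 2"
          using s by (simp add: mult_left_le_one_le)
        finally show ?thesis .
      qed
      show "\<sigma> s y \<in> ?U" if "s \<in> {0..1}" "y \<in> ?U" for s y using that by (rule \<sigma>_cball)
    qed auto
    then show ?thesis by simp
  qed
  show ?thesis
  proof (rule that[OF d f f0])
    show "f ` ball 0 d \<subseteq> Q" using fQ[of 1] by (auto simp: \<sigma>1)
    show "?Df 0 k = k" for k
    proof -
      have 0: "\<sigma> s 0 = 0" for s by (simp add: \<sigma>_def)
      have "((\<lambda>s::real. k) has_integral ?Df 0 k) {0..1}"
        using deq[of 0 k] d derH[OF Q(2)] by (simp add: 0 f0 G0)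
      from integral_unique[OF this] show ?thesis by simp
    qed
  qed (rule frame)
qed

text \<open>The flow map sends a direction \<open>h\<close> along \<open>K\<close> to
  \<open>G h\<close>, so its local inverse straightens the distribution spanned by these
  vectors.\<close>

lemma frobenius:
  fixes G :: "real^'n \<Rightarrow> real^'n^'n"
  assumes Q: "open Q" "0 \<in> Q" and G: "smooth_on Q G" and G0: "G 0 = mat 1"
    and comm: "\<And>z h k. z \<in> Q \<Longrightarrow> proj K h = h \<Longrightarrow> proj K k = k \<Longrightarrow>
      fderiv G z (G z *v h) *v k = fderiv G z (G z *v k) *v h"
  obtains N g where "open N" "0 \<in> N" "N \<subseteq> Q" "smooth_on N g" "g 0 = 0"
    "\<And>k. fderiv g 0 k = k"
    "\<And>z h. z \<in> N \<Longrightarrow> proj K h = h \<Longrightarrow> fderiv g z (G z *v h) = h"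
proof -
  obtain d f where f: "d > 0" "smooth_on (ball 0 d) f" "f 0 = 0" "f ` ball 0 d \<subseteq> Q"
    "\<And>k. fderiv f 0 k = k"
    "\<And>x h. x \<in> ball 0 d \<Longrightarrow> proj K h = h \<Longrightarrow> fderiv f x h = G (f x) *v h"
    using frobenius_flow[OF assms] by blast
  have id: "fderiv f 0 = id" using f(5) by auto
  obtain U V g where g: "open U" "U \<subseteq> ball 0 d" "0 \<in> U" "open V" "homeomorphism U V f g" "smooth_on V g"
    "\<And>x. x \<in> U \<Longrightarrow> bij (fderiv f x)"
    "\<And>x. x \<in> U \<Longrightarrow> (g has_derivative inv (fderiv f x)) (at (f x))"
    using smooth_inverse_function[OF open_ball f(2), of 0] f(1) id by auto
  have V: "V = f ` U" and gf: "g (f x) = x" if "x \<in> U" for x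
    using g(5) that by (auto simp: homeomorphism_def)
  show ?thesis
  proof (rule that[OF g(4) _ _ g(6)])
    show "0 \<in> V" using V[OF g(3)] g(3) f(3) by force
    show "V \<subseteq> Q" using V[OF g(3)] g(2) f(4) by auto
    show "g 0 = 0" using gf[OF g(3)] f(3) by simp
    show "fderiv g 0 k = k" for k
      using frechet_derivativeI[OF g(8)[OF g(3)]] id f(3) by simp
    fix z h assume "z \<in> V" and h: "proj K h = h"
    then obtain x where x: "x \<in> U" "z = f x" using V[OF g(3)] by auto
    have "fderiv f x h = G z *v h" using f(6)[of x h] x g(2) h by auto
    then show "fderiv g z (G z *v h) = h"
      using frechet_derivativeI[OF g(8)[OF x(1)]] x(2) g(7)[OF x(1)] by (metis bij_inv_eq_iff)
  qed
qed

subsection \<open>Torsion of block diagonal operators\<close>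

definition block_diag :: "'n set \<Rightarrow> real^'n^'n \<Rightarrow> bool" where
  "block_diag K M \<longleftrightarrow> (\<forall>i j. (i \<in> K) \<noteq> (j \<in> K) \<longrightarrow> M $ i $ j = 0)"

text \<open>For block diagonal \<open>M\<close> this means that the two blocks share no complex
  eigenvalue: the off-diagonal parts of a commuting \<open>C\<close> are the intertwiners between
  the blocks.\<close>

definition separated :: "'n set \<Rightarrow> real^'n^'n \<Rightarrow> bool" where
  "separated K M \<longleftrightarrow> (\<forall>C. M ** C = C ** M \<longrightarrow> block_diag K C)"

lemma block_diag_compl: "block_diag (- K) M \<longleftrightarrow> block_diag K M"
  by (auto simp: block_diag_def)

lemma separated_compl: "separated (- K) M \<longleftrightarrow> separated K M"
  by (simp add: separated_def block_diag_compl)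

lemma block_diag_iff: "block_diag K M \<longleftrightarrow> (\<forall>v. proj K (M *v v) = M *v proj K v)"
proof
  assume M: "block_diag K M"
  show "\<forall>v. proj K (M *v v) = M *v proj K v"
  proof
    fix v
    have "(proj K (M *v v)) $ i = (M *v proj K v) $ i" for i
      unfolding proj_nth matrix_vector_mult_def
      using M by (auto simp: block_diag_def intro!: sum.cong sum.neutral)
    then show "proj K (M *v v) = M *v proj K v" by (simp add: vec_eq_iff)
  qed
next
  assume M: "\<forall>v. proj K (M *v v) = M *v proj K v"
  show "block_diag K M"
    unfolding block_diag_def
  proof (intro allI impI)
    fix i j assume ij: "(i \<in> K) \<noteq> (j \<in> K)"
    have p: "proj K (axis j 1) = (if j \<in> K then axis j 1 else 0)"
      by (simp add: vec_eq_iff axis_def)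
    have "(if i \<in> K then M $ i $ j else 0) = (proj K (M *v axis j 1)) $ i"
      by (simp add: matrix_vector_mult_basis column_def)
    also have "\<dots> = (if j \<in> K then M $ i $ j else 0)"
      unfolding M[rule_format] p by (simp add: matrix_vector_mult_basis column_def)
    finally show "M $ i $ j = 0" using ij by (auto split: if_splits)
  qed
qed

lemma block_diag_proj: "block_diag K M \<Longrightarrow> proj K (M *v v) = M *v proj K v"
  by (simp add: block_diag_iff)

lemma block_diag_proj_compl: "block_diag K M \<Longrightarrow> proj (- K) (M *v v) = M *v proj (- K) v"
  using block_diag_compl block_diag_proj by blast

lemma block_diagonal_on_block_diag: "block_diagonal_on K W F \<longleftrightarrow> (\<forall>x\<in>W. block_diag K (F x))"
  by (simp add: block_diagonal_on_def block_diag_def)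

lemma block_mult_vec: "block K M *v v = proj K (M *v proj K v)"
proof -
  have "(block K M *v v) $ i = proj K (M *v proj K v) $ i" for i
    unfolding proj_nth by (auto simp: matrix_vector_mult_def block_def intro!: sum.cong)
  then show ?thesis by (simp add: vec_eq_iff)
qed

lemma block_mult_vec_block_diag: "block_diag K M \<Longrightarrow> proj K v = v \<Longrightarrow> block K M *v v = M *v v"
  by (simp add: block_mult_vec block_diag_proj)

lemma linear_block: "linear (block K)"
  by (auto simp: linear_iff block_def vec_eq_iff)

lemma bounded_linear_block: "bounded_linear (block K)"
  using linear_block linear_conv_bounded_linear by blast

lemma block_diag_block: "block_diag K (block J M)" if "J = K \<or> J = - K"
  using that by (auto simp: block_diag_def block_def)

lemma block_idem [simp]: "block K (block K M) = block K M"
  by (simp add: block_def vec_eq_iff)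

lemma block_selfI:
  assumes "\<And>v. proj K (M *v v) = M *v v" "\<And>v. M *v proj K v = M *v v"
  shows "block K M = M"
  using assms by (simp add: matrix_eq block_mult_vec)

lemma block_selfD:
  assumes "block K M = M"
  shows "proj K (M *v v) = M *v v" "M *v proj K v = M *v v"
  using block_mult_vec[of K M] assms by (metis proj_idem)+

text \<open>Extended by zero to the complement of \<open>K\<close>, such an \<open>f\<close> becomes
  a matrix commuting with \<open>M\<close>. By \<open>separated\<close> it is block diagonal, yet it
  maps \<open>K\<close> into \<open>- K\<close>.\<close>

lemma sylvester_zero:
  assumes M: "block_diag K M" "separated K M" and f: "linear f"
    and Y: "\<And>h. proj K h = h \<Longrightarrow> proj (- K) (f h) = f h"
    and comm: "\<And>h. proj K h = h \<Longrightarrow> M *v f h = f (M *v h)"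
    and h: "proj K h = h"
  shows "f h = 0"
proof -
  define C where "C = matrix (\<lambda>h. f (proj K h))"
  have "linear (\<lambda>h. f (proj K h))" using linear_compose[OF linear_proj f] by (simp add: o_def)
  then have C: "C *v v = f (proj K v)" for v
    unfolding C_def by (metis matrix_vector_mul(2))
  have "M ** C = C ** M"
    by (simp add: matrix_eq matrix_vector_mul_assoc[symmetric] C comm block_diag_proj[OF M(1)])
  then have "proj K (C *v h) = C *v proj K h"
    using M(2) by (simp add: separated_def block_diag_iff)
  then have "proj K (f h) = f h" using C h by simp
  then show ?thesis using Y[OF h] by (metis proj_compl(1))
qed

lemma frechet_derivative_add_on:
  assumes "smooth_on W f" "smooth_on W g" "x \<in> W"
  shows "fderiv (\<lambda>x. f x + g x) x = (\<lambda>v. fderiv f x v + fderiv g x v)"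
  using assms by (intro frechet_derivativeI has_derivative_add smooth_on_has_derivative)

lemma frechet_derivative_matrix_vector:
  fixes F :: "'a::real_normed_vector \<Rightarrow> real^'n^'m"
  assumes "smooth_on W F" "smooth_on W g" "x \<in> W"
  shows "fderiv (\<lambda>x. F x *v g x) x
    = (\<lambda>v. F x *v fderiv g x v + fderiv F x v *v g x)"
  by (rule frechet_derivativeI[OF bounded_bilinear.FDERIV[OF bounded_bilinear_matrix_vector_mult
      smooth_on_has_derivative[OF assms(1,3)] smooth_on_has_derivative[OF assms(2,3)]]])

text \<open>Differentiating \<open>P (f y) = f y\<close>. With \<open>P\<close> a coordinate
  projection, the derivatives of a field along \<open>K\<close> stay along \<open>K\<close>.\<close>

lemma derivative_invariant:
  assumes W: "open W" "x \<in> W" and f: "smooth_on W f" and P: "bounded_linear P" "\<And>y. y \<in> W \<Longrightarrow> P (f y) = f y"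
  shows "P (fderiv f x v) = fderiv f x v"
proof -
  have "((\<lambda>y. P (f y)) has_derivative (\<lambda>v. P (fderiv f x v))) (at x)"
    by (rule bounded_linear.has_derivative[OF P(1) smooth_on_has_derivative[OF f W(2)]])
  moreover have "fderiv (\<lambda>y. P (f y)) x = fderiv f x"
    by (rule frechet_derivative_cong_open[OF W]) (rule P(2))
  ultimately show ?thesis using frechet_derivativeI by metis
qed

section \<open>Locality, antisymmetry and additivity of the torsion\<close>

lemma smooth_on_app_field:
  "open W \<Longrightarrow> smooth_on W F \<Longrightarrow> smooth_on W \<xi> \<Longrightarrow> smooth_on W (app_field F \<xi>)"
  unfolding app_field_def[abs_def] by (rule smooth_on_matrix_vector_mult)

text \<open>Fields are total functions and identities between them hold on an open set only;
  locality of the torsion allows replacing them there.\<close>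

lemma torsion_cong:
  assumes "open S" "x \<in> S" "\<And>y. y \<in> S \<Longrightarrow> F y = F' y" "\<And>y. y \<in> S \<Longrightarrow> \<xi> y = \<xi>' y" "\<And>y. y \<in> S \<Longrightarrow> \<eta> y = \<eta>' y"
  shows "torsion m F \<xi> \<eta> x = torsion m F' \<xi>' \<eta>' x"
  using assms(2,4,5)
proof (induction m arbitrary: \<xi> \<eta> \<xi>' \<eta>' x)
  case 0
  have "fderiv \<xi> x = fderiv \<xi>' x"
       "fderiv \<eta> x = fderiv \<eta>' x"
    using 0 by (auto intro!: frechet_derivative_cong_open[OF assms(1)])
  then show ?case using 0 by (simp add: lie_bracket_def)
next
  case (Suc m)
  have a: "app_field F \<xi> y = app_field F' \<xi>' y" "app_field F \<eta> y = app_field F' \<eta>' y" if "y \<in> S" for y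
    using that Suc.prems assms(3) by (simp_all add: app_field_def)
  have "torsion m F \<xi> \<eta> x = torsion m F' \<xi>' \<eta>' x"
       "torsion m F (app_field F \<xi>) (app_field F \<eta>) x = torsion m F' (app_field F' \<xi>') (app_field F' \<eta>') x"
       "torsion m F (app_field F \<xi>) \<eta> x = torsion m F' (app_field F' \<xi>') \<eta>' x"
       "torsion m F \<xi> (app_field F \<eta>) x = torsion m F' \<xi>' (app_field F' \<eta>') x"
    using Suc.prems a by (auto intro!: Suc.IH)
  then show ?case using assms(3)[OF Suc.prems(1)] by simp
qed

lemma torsion_antisym: "torsion m F \<xi> \<eta> x = - torsion m F \<eta> \<xi> x"
proof (induction m arbitrary: \<xi> \<eta>)
  case 0 then show ?case by (simp add: lie_bracket_def)
next
  case (Suc m)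
  show ?case
    unfolding torsion.simps Suc[of \<xi> \<eta>] Suc[of "app_field F \<xi>" \<eta>] Suc[of \<xi> "app_field F \<eta>"]
      Suc[of "app_field F \<xi>" "app_field F \<eta>"] vec.neg
    by (simp add: algebra_simps)
qed

lemma torsion_add_left:
  assumes W: "open W" "x \<in> W" and F: "smooth_on W F"
    and "smooth_on W \<xi>" "smooth_on W \<xi>'" "smooth_on W \<eta>"
  shows "torsion m F (\<lambda>x. \<xi> x + \<xi>' x) \<eta> x = torsion m F \<xi> \<eta> x + torsion m F \<xi>' \<eta> x"
  using assms(4-)
proof (induction m arbitrary: \<xi> \<xi>' \<eta>)
  case 0
  have "linear (fderiv \<eta> x)"
    using smooth_on_bounded_linear[OF 0(3) W(2)] bounded_linear.linear by blast
  then show ?case using 0 W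
    by (simp add: lie_bracket_def frechet_derivative_add_on[OF 0(1,2) W(2)] linear_add)
next
  case (Suc m)
  note sm = Suc.prems Suc.prems[THEN smooth_on_app_field[OF W(1) F]]
  note IH = Suc.IH[OF sm(1,2,3)] Suc.IH[OF sm(1,2,6)] Suc.IH[OF sm(4,5,3)] Suc.IH[OF sm(4,5,6)]
  have a: "app_field F (\<lambda>x. \<xi> x + \<xi>' x) = (\<lambda>x. app_field F \<xi> x + app_field F \<xi>' x)"
    by (simp add: app_field_def fun_eq_iff matrix_vector_right_distrib)
  show ?case
    unfolding torsion.simps a IH matrix_vector_right_distrib by (simp add: algebra_simps)
qed

lemma torsion_add_right:
  assumes "open W" "x \<in> W" "smooth_on W F" "smooth_on W \<xi>" "smooth_on W \<eta>" "smooth_on W \<eta>'"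
  shows "torsion m F \<xi> (\<lambda>x. \<eta> x + \<eta>' x) x = torsion m F \<xi> \<eta> x + torsion m F \<xi> \<eta>' x"
  unfolding torsion_antisym[of m F \<xi>] torsion_add_left[OF assms(1-3,5,6,4)] by simp

section \<open>Restriction to slices and mixed pairs\<close>

lemma glue_proj: "glue K z y = proj K z + proj (- K) y"
  by (simp add: glue_def vec_eq_iff)

lemma has_derivative_glue: "((\<lambda>z. glue K z y) has_derivative proj K) (at z)"
  unfolding glue_proj
  using has_derivative_add_const[OF bounded_linear_imp_has_derivative[OF bounded_linear_proj]] by blast

lemma open_glue_slice:
  assumes "open W" shows "open {z. glue K z y \<in> W}"
proof -
  have "continuous_on UNIV (\<lambda>z. glue K z y)"
    using has_derivative_continuous[OF has_derivative_glue] by (intro continuous_at_imp_continuous_on) auto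
  from open_vimage[OF assms this] show ?thesis by (simp add: vimage_def)
qed

lemma smooth_on_glue_slice:
  fixes f :: "real^'n \<Rightarrow> 'b::real_normed_vector"
  assumes W: "open W" and f: "smooth_on W f"
  shows "smooth_on {z. glue K z y \<in> W} (\<lambda>z. f (glue K z y))"
proof (rule smooth_on_compose[OF open_glue_slice[OF W] W _ f])
  show "smooth_on {z. glue K z y \<in> W} (\<lambda>z. glue K z y)"
    unfolding glue_proj using open_glue_slice[OF W, unfolded glue_proj]
    by (intro smooth_on_add smooth_on_linear smooth_on_const bounded_linear_proj)
qed auto

text \<open>Fields directed along \<open>K\<close> see only the slice: their brackets differentiate along \<open>K\<close> alone.\<close>
lemma torsion_slice:
  assumes W: "open W" and F: "smooth_on W F" "\<And>x. x \<in> W \<Longrightarrow> block_diag K (F x)"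
    and "smooth_on W \<xi>" "smooth_on W \<eta>"
    and "\<And>x. x \<in> W \<Longrightarrow> proj K (\<xi> x) = \<xi> x" "\<And>x. x \<in> W \<Longrightarrow> proj K (\<eta> x) = \<eta> x"
    and "glue K z y \<in> W"
  shows "torsion m F \<xi> \<eta> (glue K z y) =
      torsion m (\<lambda>z. block K (F (glue K z y))) (\<lambda>z. \<xi> (glue K z y)) (\<lambda>z. \<eta> (glue K z y)) z
    \<and> proj K (torsion m F \<xi> \<eta> (glue K z y)) = torsion m F \<xi> \<eta> (glue K z y)"
  using assms(4-)
proof (induction m arbitrary: \<xi> \<eta>)
  case 0
  let ?x = "glue K z y"
  have D: "fderiv (\<lambda>z. f (glue K z y)) z v = fderiv f ?x (proj K v)"
    if "smooth_on W f" for f :: "real^'a \<Rightarrow> real^'a" and v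
    using frechet_derivativeI[OF has_derivative_compose[OF has_derivative_glue
          smooth_on_has_derivative[OF that \<open>?x \<in> W\<close>]]] by simp
  have "proj K (fderiv f ?x v) = fderiv f ?x v"
    if "smooth_on W f" "\<And>x. x \<in> W \<Longrightarrow> proj K (f x) = f x" for f v
    using derivative_invariant[OF W \<open>?x \<in> W\<close> that(1) bounded_linear_proj that(2)] .
  then show ?case using 0 by (simp add: lie_bracket_def D proj_diff)
next
  case (Suc m)
  let ?x = "glue K z y" and ?A = "\<lambda>z. block K (F (glue K z y))"
  let ?g = "\<lambda>f z. f (glue K z y)"
  let ?S = "{z. glue K z y \<in> W}"
  note S = open_glue_slice[OF W, of K y]
  have bdx: "block_diag K (F ?x)" using F(2) Suc.prems(5) by blast
  have sm: "smooth_on W (app_field F \<xi>)" "smooth_on W (app_field F \<eta>)"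
    using smooth_on_app_field[OF W F(1)] Suc.prems by auto
  have pr: "proj K (app_field F \<xi> x) = app_field F \<xi> x" "proj K (app_field F \<eta> x) = app_field F \<eta> x"
    if "x \<in> W" for x
    using that Suc.prems(3,4) by (simp_all add: app_field_def block_diag_proj[OF F(2)])
  have ap: "app_field ?A (?g \<zeta>) u = ?g (app_field F \<zeta>) u"
    if "u \<in> ?S" "\<And>x. x \<in> W \<Longrightarrow> proj K (\<zeta> x) = \<zeta> x" for \<zeta> u
    using that by (simp add: app_field_def block_mult_vec_block_diag F(2))
  have z: "z \<in> ?S" using Suc.prems by simp
  note IH = Suc.IH[OF _ _ _ _ Suc.prems(5)]
  have cg: "torsion m ?A \<xi>1 \<eta>1 z = torsion m ?A \<xi>2 \<eta>2 z"
    if "\<And>u. u \<in> ?S \<Longrightarrow> \<xi>1 u = \<xi>2 u" "\<And>u. u \<in> ?S \<Longrightarrow> \<eta>1 u = \<eta>2 u" for \<xi>1 \<xi>2 \<eta>1 \<eta>2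
    using torsion_cong[OF S z, of ?A ?A] that by blast
  have 1: "torsion m F \<xi> \<eta> ?x = torsion m ?A (?g \<xi>) (?g \<eta>) z" "proj K (torsion m F \<xi> \<eta> ?x) = torsion m F \<xi> \<eta> ?x"
    using IH[of \<xi> \<eta>] Suc.prems by auto
  have 2: "torsion m F (app_field F \<xi>) (app_field F \<eta>) ?x = torsion m ?A (app_field ?A (?g \<xi>)) (app_field ?A (?g \<eta>)) z"
    "proj K (torsion m F (app_field F \<xi>) (app_field F \<eta>) ?x) = torsion m F (app_field F \<xi>) (app_field F \<eta>) ?x"
    using IH[of "app_field F \<xi>" "app_field F \<eta>"] Suc.prems sm pr
      cg[of "app_field ?A (?g \<xi>)" "?g (app_field F \<xi>)" "app_field ?A (?g \<eta>)" "?g (app_field F \<eta>)"] ap by auto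
  have 3: "torsion m F (app_field F \<xi>) \<eta> ?x = torsion m ?A (app_field ?A (?g \<xi>)) (?g \<eta>) z"
    "proj K (torsion m F (app_field F \<xi>) \<eta> ?x) = torsion m F (app_field F \<xi>) \<eta> ?x"
    using IH[of "app_field F \<xi>" \<eta>] Suc.prems sm pr
      cg[of "app_field ?A (?g \<xi>)" "?g (app_field F \<xi>)" "?g \<eta>" "?g \<eta>"] ap by auto
  have 4: "torsion m F \<xi> (app_field F \<eta>) ?x = torsion m ?A (?g \<xi>) (app_field ?A (?g \<eta>)) z"
    "proj K (torsion m F \<xi> (app_field F \<eta>) ?x) = torsion m F \<xi> (app_field F \<eta>) ?x"
    using IH[of \<xi> "app_field F \<eta>"] Suc.prems sm pr
      cg[of "?g \<xi>" "?g \<xi>" "app_field ?A (?g \<eta>)" "?g (app_field F \<eta>)"] ap by auto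
  have FA: "block K (F ?x) *v v = F ?x *v v" if "proj K v = v" for v
    using block_mult_vec_block_diag[OF bdx that] .
  show ?case
    using 1(2) 2(2) 3(2) 4(2)
    by (simp add: proj_add proj_diff block_diag_proj[OF bdx] FA 1(1)[symmetric] 2(1)[symmetric] 3(1)[symmetric] 4(1)[symmetric])
qed

text \<open>\<open>C\<close> stands for the tensor
  \<open>(\<xi>, \<eta>) \<mapsto> C \<eta> \<xi>\<close> with values in the block of
  \<open>A\<close>. On it this is \<open>L - R_2\<close>, while \<open>L - R_1\<close> is
  \<open>ad A\<close> applied to each value.\<close>

definition off_step :: "real^'n^'n \<Rightarrow> real^'n^'n \<Rightarrow> (real^'n \<Rightarrow> real^'n^'n) \<Rightarrow> real^'n \<Rightarrow> real^'n^'n" where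
  "off_step A F C = (\<lambda>v. A ** C v - C (F *v v))"

lemma ad_mult_vec: "ad A B *v v = A *v (B *v v) - B *v (A *v v)"
  by (simp add: ad_def matrix_vector_mult_diff_rdistrib matrix_vector_mul_assoc)

lemma off_step_mult_vec: "off_step A F C v *v w = A *v (C v *v w) - C (F *v v) *v w"
  by (simp add: off_step_def matrix_vector_mult_diff_rdistrib matrix_vector_mul_assoc)

text \<open>The factors \<open>L - R_1\<close> and \<open>L - R_2\<close> commute, so all
  commutators can be collected innermost.\<close>

lemma off_step_ad: "off_step A F (\<lambda>v. ad A (C v)) = (\<lambda>v. ad A (off_step A F C v))"
  by (simp add: fun_eq_iff matrix_eq off_step_mult_vec ad_mult_vec matrix_vector_mult_diff_distrib)

lemma off_step_pow_ad:
  "(off_step A F ^^ n) (\<lambda>v. ad A (C v)) = (\<lambda>v. ad A ((off_step A F ^^ n) C v))"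
  by (induction n) (simp_all add: off_step_ad)

text \<open>Mixed pairs: the bracket of a \<open>u\<close>-field with a \<open>v\<close>-field has \<open>u\<close>-part \<open>-D\<^sub>\<eta> \<xi>\<close>, so the first
  torsion step already turns it into a tensor built from \<open>D\<^sub>\<eta> A\<close>.\<close>
lemma torsion_mixed:
  assumes W: "open W" "x \<in> W" and F: "smooth_on W F" "\<And>x. x \<in> W \<Longrightarrow> block_diag K (F x)"
    and "smooth_on W \<xi>" "smooth_on W \<eta>"
    and "\<And>x. x \<in> W \<Longrightarrow> proj K (\<xi> x) = \<xi> x" "\<And>x. x \<in> W \<Longrightarrow> proj (- K) (\<eta> x) = \<eta> x"
  shows "proj K (torsion (Suc n) F \<xi> \<eta> x) =
    (off_step (block K (F x)) (F x) ^^ Suc n)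
      (\<lambda>v. (ad (block K (F x)) ^^ n) (fderiv (\<lambda>z. block K (F z)) x v)) (\<eta> x) *v \<xi> x"
  using assms(5-)
proof (induction n arbitrary: \<xi> \<eta>)
  case 0
  let ?A = "block K (F x)" and ?DF = "fderiv F x"
  have bdx: "block_diag K (F x)" using F(2) W(2) .
  have DF_block_diag: "proj K (?DF v *v w) = ?DF v *v w" if "proj K w = w" for v w
  proof -
    have sm: "smooth_on W (\<lambda>y. F y *v w)"
      by (intro smooth_on_matrix_vector_mult smooth_on_const F W(1))
    have "proj K (F y *v w) = F y *v w" if "y \<in> W" for y
      using \<open>proj K w = w\<close> by (simp add: block_diag_proj[OF F(2)[OF that]])
    from derivative_invariant[OF W sm bounded_linear_proj this, of v]
    show ?thesis
      using frechet_derivative_matrix_vector[OF F(1) smooth_on_const[OF W(1)] W(2), of w] by simp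
  qed
  have DA: "fderiv (\<lambda>z. block K (F z)) x v *v w = ?DF v *v w" if "proj K w = w" for v w
    using frechet_derivativeI[OF bounded_linear.has_derivative[OF bounded_linear_block
          smooth_on_has_derivative[OF F(1) W(2)]]] that
    by (simp add: block_mult_vec DF_block_diag)
  have br: "proj K (lie_bracket f g x) = - fderiv f x (g x)"
    if "smooth_on W f" "smooth_on W g" "\<And>x. x \<in> W \<Longrightarrow> proj K (f x) = f x"
      "\<And>x. x \<in> W \<Longrightarrow> proj (- K) (g x) = g x" for f g
  proof -
    have "proj K (fderiv f x v) = fderiv f x v" for v
      using derivative_invariant[OF W that(1) bounded_linear_proj that(3)] .
    moreover have "proj (- K) (fderiv g x v) = fderiv g x v" for v
      using derivative_invariant[OF W that(2) bounded_linear_proj that(4)] .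
    then have "proj K (fderiv g x v) = 0" for v by (metis proj_compl(1))
    ultimately show ?thesis by (simp add: lie_bracket_def proj_diff)
  qed
  have sm: "smooth_on W (app_field F \<xi>)" "smooth_on W (app_field F \<eta>)"
    using smooth_on_app_field[OF W(1) F(1)] 0 by auto
  have pr: "proj K (app_field F \<xi> x) = app_field F \<xi> x" "proj (- K) (app_field F \<eta> x) = app_field F \<eta> x"
    if "x \<in> W" for x
    using that 0(3,4) block_diag_proj[OF F(2)[OF that]] block_diag_proj_compl[OF F(2)[OF that]] by (simp_all add: app_field_def)
  have dF: "fderiv (app_field F \<xi>) x = (\<lambda>v. F x *v fderiv \<xi> x v + ?DF v *v \<xi> x)"
    unfolding app_field_def[abs_def] by (rule frechet_derivative_matrix_vector[OF F(1) 0(1) W(2)])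
  note b = br[OF 0] br[OF sm pr] br[OF sm(1) 0(2) pr(1) 0(4)] br[OF 0(1) sm(2) 0(3) pr(2)]
  have \<xi>: "proj K (\<xi> x) = \<xi> x" using 0(3) W(2) .
  \<comment> \<open>In the sum of the four brackets the terms with the derivative of
    \<open>\<xi>\<close> cancel; only derivatives of \<open>F\<close> survive, and the result is
    algebraic in \<open>\<xi> x\<close> and \<open>\<eta> x\<close>.\<close>
  have "proj K (torsion (Suc 0) F \<xi> \<eta> x) = F x *v (?DF (\<eta> x) *v \<xi> x) - ?DF (F x *v \<eta> x) *v \<xi> x"
    by (simp only: torsion.simps proj_add proj_diff block_diag_proj[OF bdx] b dF)
      (simp add: app_field_def matrix_vector_right_distrib vec.neg algebra_simps)
  then show ?case
    by (simp add: off_step_mult_vec DA[OF \<xi>] block_mult_vec_block_diag[OF bdx DF_block_diag[OF \<xi>]])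
next
  case (Suc n)
  let ?A = "block K (F x)"
  let ?D = "\<lambda>n v. (ad ?A ^^ n) (fderiv (\<lambda>z. block K (F z)) x v)"
  let ?C = "(off_step ?A (F x) ^^ Suc n) (?D n)"
  have bdx: "block_diag K (F x)" using F(2) W(2) .
  have sm: "smooth_on W (app_field F \<xi>)" "smooth_on W (app_field F \<eta>)"
    using smooth_on_app_field[OF W(1) F(1)] Suc.prems by auto
  have pr: "proj K (app_field F \<xi> x) = app_field F \<xi> x" "proj (- K) (app_field F \<eta> x) = app_field F \<eta> x"
    if "x \<in> W" for x
    using that Suc.prems(3,4) block_diag_proj[OF F(2)[OF that]] block_diag_proj_compl[OF F(2)[OF that]] by (simp_all add: app_field_def)
  note IH = Suc.IH[OF Suc.prems] Suc.IH[OF sm pr] Suc.IH[OF sm(1) Suc.prems(2) pr(1) Suc.prems(4)]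
    Suc.IH[OF Suc.prems(1) sm(2) Suc.prems(3) pr(2)]
  have p: "proj K (?C (\<eta> x) *v \<xi> x) = ?C (\<eta> x) *v \<xi> x" "proj K (?C (\<eta> x) *v app_field F \<xi> x) = ?C (\<eta> x) *v app_field F \<xi> x"
    "proj K (?C (app_field F \<eta> x) *v \<xi> x) = ?C (app_field F \<eta> x) *v \<xi> x"
    by (simp_all only: IH[symmetric] proj_idem)
  have \<xi>: "proj K (\<xi> x) = \<xi> x" using Suc.prems(3) W(2) .
  have F\<xi>: "app_field F \<xi> x = ?A *v \<xi> x" by (simp add: app_field_def block_mult_vec_block_diag[OF bdx \<xi>])
  have "proj K (torsion (Suc (Suc n)) F \<xi> \<eta> x) = F x *v (F x *v (?C (\<eta> x) *v \<xi> x))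
     + ?C (app_field F \<eta> x) *v app_field F \<xi> x - F x *v (?C (\<eta> x) *v app_field F \<xi> x)
     - F x *v (?C (app_field F \<eta> x) *v \<xi> x)"
    by (simp only: torsion.simps(2)[of "Suc n"] proj_add proj_diff block_diag_proj[OF bdx] IH)
  \<comment> \<open>One torsion step multiplies by \<open>(L - R_1) (L - R_2)\<close>. Afterwards
    \<open>off_step_pow_ad\<close> moves the new \<open>ad\<close> inside all the
    \<open>off_step\<close>s.\<close>
  also have "\<dots> = off_step ?A (F x) (\<lambda>v. ad ?A (?C v)) (\<eta> x) *v \<xi> x"
  proof -
    have a: "F x *v (?C (\<eta> x) *v \<xi> x) = ?A *v (?C (\<eta> x) *v \<xi> x)"
      "F x *v (?C (\<eta> x) *v app_field F \<xi> x) = ?A *v (?C (\<eta> x) *v app_field F \<xi> x)"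
      "F x *v (?C (app_field F \<eta> x) *v \<xi> x) = ?A *v (?C (app_field F \<eta> x) *v \<xi> x)"
      using p by (simp_all only: block_mult_vec_block_diag[OF bdx])
    have b: "F x *v (?A *v (?C (\<eta> x) *v \<xi> x)) = ?A *v (?A *v (?C (\<eta> x) *v \<xi> x))"
      by (rule block_mult_vec_block_diag[OF bdx, symmetric]) (simp add: block_mult_vec)
    show ?thesis
      unfolding F\<xi> a[unfolded F\<xi>] b off_step_mult_vec ad_mult_vec matrix_vector_mult_diff_distrib
      by (simp add: app_field_def)
  qed
  also have "off_step ?A (F x) (\<lambda>v. ad ?A (?C v)) = (off_step ?A (F x) ^^ Suc (Suc n)) (?D (Suc n))"
    using off_step_pow_ad[of "Suc n" ?A "F x" "?D n"] by simp
  finally show ?case .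
qed

text \<open>For directions along \<open>- K\<close>, \<open>L - R_2\<close> is a Sylvester operator
  between different blocks and has no kernel; the induction cancels its powers one by one.\<close>

lemma off_step_injective:
  assumes M: "block_diag K M" "separated K M"
    and C: "linear C" "\<And>v. block K (C v) = C v"
    and 0: "\<And>v. proj (- K) v = v \<Longrightarrow> (off_step (block K M) M ^^ n) C v = 0"
    and v: "proj (- K) v = v"
  shows "C v = 0"
  using C 0 v
proof (induction n arbitrary: C v)
  case 0 then show ?case by simp
next
  case (Suc n)
  let ?A = "block K M"
  let ?S = "off_step ?A M C"
  have linS: "linear ?S"
    unfolding off_step_def
    by (intro linear_compose_sub linear_compose[OF Suc.prems(1), unfolded o_def]
        linear_compose[OF _ Suc.prems(1), unfolded o_def])
      (auto simp: linear_iff matrix_add_ldistrib matrix_vector_right_distrib matrix_vector_mult_scaleR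
        matrix_eq matrix_vector_mul_assoc[symmetric] matrix_vector_mult_add_rdistrib scaleR_matrix_vector_assoc[symmetric])
  have C: "proj K (C v *v w) = C v *v w" "C v *v proj K w = C v *v w" for v w
    using block_selfD[OF Suc.prems(2)] by auto
  have blS: "block K (?S v) = ?S v" for v
    by (rule block_selfI) (simp_all add: off_step_mult_vec proj_diff C block_mult_vec)
  have S0: "?S v = 0" if "proj (- K) v = v" for v
    using Suc.IH[OF linS blS _ that] Suc.prems(3) by (simp add: funpow_swap1)
  \<comment> \<open>For fixed \<open>e\<close>, the map \<open>v \<mapsto> C v e\<close> intertwines
    the block on \<open>- K\<close> with the block on \<open>K\<close>.\<close>
  have "C v *v e = 0" for e
  proof (rule sylvester_zero[of "- K" M "\<lambda>v. C v *v e"])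
    show "block_diag (- K) M" "separated (- K) M" using M by (simp_all add: block_diag_compl separated_compl)
    show "linear (\<lambda>v. C v *v e)"
      using linear_compose[OF Suc.prems(1), of "\<lambda>M. M *v e"]
      by (simp add: o_def bounded_linear.linear[OF bounded_bilinear.bounded_linear_left[OF bounded_bilinear_matrix_vector_mult]])
    show "proj (- (- K)) (C h *v e) = C h *v e" for h using C by simp
    show "M *v (C h *v e) = C (M *v h) *v e" if "proj (- K) h = h" for h
      using arg_cong[OF S0[OF that], of "\<lambda>M. M *v e"] block_mult_vec_block_diag[OF M(1) C(1)]
      by (simp add: off_step_mult_vec)
  qed (rule Suc.prems(4))
  then show ?case by (simp add: matrix_eq)
qed

section \<open>Vanishing torsion and the splitting conditions\<close>

lemma ad_pow_linear: "linear ((ad A ^^ n) :: real^'n^'n \<Rightarrow> _)"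
proof (induction n)
  case 0 then show ?case by (simp add: linear_iff)
next
  case (Suc n)
  have "linear (ad A)"
    by (auto simp: linear_iff ad_mult_vec matrix_eq matrix_vector_right_distrib matrix_vector_mult_scaleR
        matrix_vector_mult_add_rdistrib scaleR_matrix_vector_assoc[symmetric] algebra_simps)
  then show ?case using linear_compose[OF Suc] by (simp add: o_def)
qed

lemma ad_pow_block:
  assumes "block K B = B"
  shows "block K ((ad (block K M) ^^ n) B) = (ad (block K M) ^^ n) B"
proof (induction n)
  case 0 then show ?case using assms by simp
next
  case (Suc n)
  let ?B = "(ad (block K M) ^^ n) B"
  note B = block_selfD[OF Suc]
  show ?case
    by (rule block_selfI) (simp_all add: ad_mult_vec proj_diff block_mult_vec B)
qed

lemma block_derivative:
  assumes "smooth_on W F" "x \<in> W"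
  shows "linear (fderiv (\<lambda>z. block K (F z)) x)"
    and "block K (fderiv (\<lambda>z. block K (F z)) x v) = fderiv (\<lambda>z. block K (F z)) x v"
proof -
  have D: "fderiv (\<lambda>z. block K (F z)) x = (\<lambda>v. block K (fderiv F x v))"
    by (rule frechet_derivativeI[OF bounded_linear.has_derivative[OF bounded_linear_block
          smooth_on_has_derivative[OF assms]]])
  show "linear (fderiv (\<lambda>z. block K (F z)) x)"
    unfolding D using linear_compose[OF bounded_linear.linear[OF smooth_on_bounded_linear[OF assms]] linear_block]
    by (simp add: o_def)
  show "block K (fderiv (\<lambda>z. block K (F z)) x v) = fderiv (\<lambda>z. block K (F z)) x v"
    by (simp add: D)
qed

lemma proj_basis_expansion: "proj (- K) v = v \<Longrightarrow> v = (\<Sum>j\<in>- K. v $ j *\<^sub>R axis j 1)"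
  by (simp add: vec_eq_iff axis_def if_distrib[of "(*) _"] sum.delta' cong: if_cong)

text \<open>The expression is linear in the direction of differentiation, so the coordinate
  directions outside \<open>K\<close> can be replaced by all vectors along
  \<open>- K\<close>.\<close>

lemma ad_condition_iff:
  assumes F: "smooth_on W F"
  shows "ad_condition K m W F \<longleftrightarrow> (\<forall>x\<in>W. \<forall>v. proj (- K) v = v \<longrightarrow>
    (ad (block K (F x)) ^^ (m - 1)) (fderiv (\<lambda>z. block K (F z)) x v) = 0)" (is "_ \<longleftrightarrow> ?R")
proof
  assume ad: "ad_condition K m W F"
  show ?R
  proof (intro ballI allI impI)
    fix x v assume x: "x \<in> W" and v: "proj (- K) v = v"
    let ?f = "\<lambda>v. (ad (block K (F x)) ^^ (m - 1)) (fderiv (\<lambda>z. block K (F z)) x v)"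
    have l: "linear ?f"
      using linear_compose[OF block_derivative(1)[OF F x] ad_pow_linear] by (simp add: o_def)
    have "?f (axis j 1) = 0" if "j \<in> - K" for j
      using ad x that by (auto simp: ad_condition_def partial_def)
    then have "(\<Sum>j\<in>- K. v $ j *\<^sub>R ?f (axis j 1)) = 0" by (intro sum.neutral) simp
    moreover have "?f (\<Sum>j\<in>- K. v $ j *\<^sub>R axis j 1) = (\<Sum>j\<in>- K. ?f (v $ j *\<^sub>R axis j 1))"
      by (rule linear_sum[OF l])
    moreover have "\<dots> = (\<Sum>j\<in>- K. v $ j *\<^sub>R ?f (axis j 1))"
      by (intro sum.cong linear_scale[OF l] refl)
    ultimately have "?f (\<Sum>j\<in>- K. v $ j *\<^sub>R axis j 1) = 0" by simp
    then show "?f v = 0" using proj_basis_expansion[OF v] by simp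
  qed
next
  assume R: ?R
  have "proj (- K) (axis j 1) = axis j 1" if "j \<notin> K" for j
    using that by (simp add: vec_eq_iff axis_def)
  then show "ad_condition K m W F" using R by (simp add: ad_condition_def partial_def)
qed

text \<open>By \<open>torsion_mixed\<close> the \<open>K\<close> part of the torsion is algebraic in
  the values of the two fields, so constant fields test all of it. \<open>off_step_injective\<close>
  then cancels the power of \<open>L - R_2\<close> and leaves the iterated commutator.\<close>

lemma torsion_imp_ad_condition:
  assumes m: "m \<ge> 1" and W: "open W" and F: "smooth_on W F" "\<And>x. x \<in> W \<Longrightarrow> block_diag K (F x)"
    and sep: "\<And>x. x \<in> W \<Longrightarrow> separated K (F x)" and T: "torsion_vanishes m W F"
  shows "ad_condition K m W F"
  unfolding ad_condition_iff[OF F(1)]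
proof (intro ballI allI impI)
  fix x v assume x: "x \<in> W" and v: "proj (- K) v = v"
  obtain n where n: "m = Suc n" using m by (metis Suc_le_D One_nat_def)
  let ?A = "block K (F x)"
  let ?f = "\<lambda>v. (ad ?A ^^ n) (fderiv (\<lambda>z. block K (F z)) x v)"
  have lin: "linear ?f"
    using linear_compose[OF block_derivative(1)[OF F(1) x] ad_pow_linear] by (simp add: o_def)
  have bl: "block K (?f v) = ?f v" for v by (rule ad_pow_block[OF block_derivative(2)[OF F(1) x]])
  have blS: "block K ((off_step ?A (F x) ^^ k) ?f v) = (off_step ?A (F x) ^^ k) ?f v" for k v
  proof (induction k arbitrary: v)
    case (Suc k)
    note S = block_selfD[OF Suc]
    show ?case by (rule block_selfI) (simp_all add: off_step_mult_vec proj_diff S block_mult_vec)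
  qed (simp add: bl)
  have "?f v = 0"
  proof (rule off_step_injective[OF F(2)[OF x] sep[OF x] lin bl _ v, of "Suc n"])
    fix v assume v: "proj (- K) v = v"
    let ?B = "(off_step ?A (F x) ^^ Suc n) ?f v"
    have "?B *v e = 0" for e
    proof -
      have "torsion m F (\<lambda>_. proj K e) (\<lambda>_. v) x = 0"
        using T x smooth_on_const[OF W] unfolding torsion_vanishes_def by blast
      moreover have "proj K (torsion (Suc n) F (\<lambda>_. proj K e) (\<lambda>_. v) x) = ?B *v proj K e"
        using torsion_mixed[OF W x F smooth_on_const[OF W] smooth_on_const[OF W], of "proj K e" v n] v by simp
      ultimately show ?thesis using block_selfD(2)[OF blS, of "Suc n" v e] n by simp
    qed
    then show "?B = 0" by (simp add: matrix_eq)
  qed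
  then show "(ad ?A ^^ (m - 1)) (fderiv (\<lambda>z. block K (F z)) x v) = 0" using n by simp
qed

text \<open>A field on a slice is extended to \<open>W\<close> by making it constant in the
  remaining coordinates. Closure of \<open>W\<close> under \<open>glue\<close> guarantees that the
  extension only evaluates the field where it is smooth.\<close>

lemma torsion_imp_torsion_wrt:
  assumes W: "open W" "\<And>x y. x \<in> W \<Longrightarrow> y \<in> W \<Longrightarrow> glue K x y \<in> W"
    and F: "smooth_on W F" "\<And>x. x \<in> W \<Longrightarrow> block_diag K (F x)" and T: "torsion_vanishes m W F"
  shows "torsion_vanishes_wrt K m W (\<lambda>x. block K (F x))"
  unfolding torsion_vanishes_wrt_def Let_def
proof (intro allI impI ballI)
  fix y x and \<xi> \<eta> :: "real^'a \<Rightarrow> real^'a"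
  let ?S = "{x. glue K x y \<in> W}" and ?A = "\<lambda>z. block K (F (glue K z y))"
  assume sm: "smooth_on ?S \<xi>" "smooth_on ?S \<eta>"
    and dir: "\<forall>x\<in>?S. \<forall>i. i \<notin> K \<longrightarrow> \<xi> x $ i = 0 \<and> \<eta> x $ i = 0" and x: "x \<in> ?S"
  note S = open_glue_slice[OF W(1), of K y]
  have dir': "proj K (\<xi> z) = \<xi> z" "proj K (\<eta> z) = \<eta> z" if "z \<in> ?S" for z
    using dir that by (auto simp: proj_eq_self_iff)
  have g: "glue K (glue K z a) b = glue K z b" "glue K z z = z" for a b z by (simp_all add: glue_def vec_eq_iff)
  have A: "smooth_on ?S ?A"
    by (rule smooth_on_linear_compose[OF S bounded_linear_block smooth_on_glue_slice[OF W(1) F(1)]])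
  \<comment> \<open>The fields may still depend on the dummy coordinates of the cylinder. Applying
    \<open>torsion_slice\<close> on the cylinder itself freezes these at their values in
    \<open>x\<close>.\<close>
  have 1: "torsion m ?A \<xi> \<eta> x = torsion m ?A (\<lambda>z. \<xi> (glue K z x)) (\<lambda>z. \<eta> (glue K z x)) x"
    using torsion_slice[OF S A _ sm dir', where z = x and y = x and m = m] x block_diag_block[of K K] by (simp add: g)
  let ?\<xi> = "\<lambda>w. \<xi> (glue K w x)" and ?\<eta> = "\<lambda>w. \<eta> (glue K w x)"
  have inS: "glue K w x \<in> ?S" if "w \<in> W" for w
    using W(2)[OF that, of "glue K x y"] x by (simp add: g) (simp add: glue_def cong: if_cong)
  then have sub: "W \<subseteq> {z. glue K z x \<in> ?S}" by blast
  have sm': "smooth_on W ?\<xi>" "smooth_on W ?\<eta>"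
    using smooth_on_subset[OF smooth_on_glue_slice[OF S] sub] sm by blast+
  have "torsion m F ?\<xi> ?\<eta> (glue K x y) = torsion m ?A (\<lambda>z. ?\<xi> (glue K z y)) (\<lambda>z. ?\<eta> (glue K z y)) x"
    using torsion_slice[OF W(1) F sm', where z = x and y = y and m = m] dir' inS x by simp
  moreover have "torsion m F ?\<xi> ?\<eta> (glue K x y) = 0"
    using T sm' x unfolding torsion_vanishes_def by blast
  ultimately show "torsion m ?A \<xi> \<eta> x = 0" unfolding 1 by (simp add: g)
qed

lemma torsion_imp_splitting_conditions:
  assumes m: "m \<ge> 1" and W: "open W" "\<And>x y J. x \<in> W \<Longrightarrow> y \<in> W \<Longrightarrow> glue J x y \<in> W"
    and F: "smooth_on W F" "block_diagonal_on K W F" and sep: "\<And>x. x \<in> W \<Longrightarrow> separated K (F x)"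
    and T: "torsion_vanishes m W F"
  shows "splitting_conditions K m W F"
proof -
  have bdF: "block_diag K (F x)" "block_diag (- K) (F x)" if "x \<in> W" for x
    using F(2) that by (simp_all add: block_diagonal_on_block_diag block_diag_compl)
  have sep': "separated (- K) (F x)" if "x \<in> W" for x using sep[OF that] by (simp add: separated_compl)
  show ?thesis
    unfolding splitting_conditions_def
    using torsion_imp_torsion_wrt[OF W F(1) bdF(1) T] torsion_imp_torsion_wrt[OF W F(1) bdF(2) T]
      torsion_imp_ad_condition[OF m W(1) F(1) bdF(1) sep T] torsion_imp_ad_condition[OF m W(1) F(1) bdF(2) sep' T]
    by blast
qed

text \<open>The point \<open>x\<close> lies on the slice obtained by freezing the coordinates
  outside \<open>K\<close> at those of \<open>x\<close>; on fields along \<open>K\<close>, the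
  torsion of \<open>F\<close> at \<open>x\<close> is the torsion of its block there.\<close>

lemma torsion_wrt_imp_zero:
  assumes W: "open W" "x \<in> W" and F: "smooth_on W F" "\<And>x. x \<in> W \<Longrightarrow> block_diag K (F x)"
    and T: "torsion_vanishes_wrt K m W (\<lambda>x. block K (F x))"
    and sm: "smooth_on W \<xi>" "smooth_on W \<eta>"
    and dir: "\<And>x. x \<in> W \<Longrightarrow> proj K (\<xi> x) = \<xi> x" "\<And>x. x \<in> W \<Longrightarrow> proj K (\<eta> x) = \<eta> x"
  shows "torsion m F \<xi> \<eta> x = 0"
proof -
  have g: "glue K x x = x" by (simp add: glue_def vec_eq_iff)
  let ?S = "{z. glue K z x \<in> W}"
  have "torsion m (\<lambda>z. block K (F (glue K z x))) (\<lambda>z. \<xi> (glue K z x)) (\<lambda>z. \<eta> (glue K z x)) x = 0"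
    using T[unfolded torsion_vanishes_wrt_def Let_def, rule_format, of x "\<lambda>z. \<xi> (glue K z x)" "\<lambda>z. \<eta> (glue K z x)" x]
      smooth_on_glue_slice[OF W(1) sm(1)] smooth_on_glue_slice[OF W(1) sm(2)] dir W(2)
    by (auto simp: g proj_eq_self_iff)
  then show ?thesis using torsion_slice[OF W(1) F sm dir, where z = x and y = x and m = m] W(2) by (simp add: g)
qed

text \<open>The iterated commutator vanishes for directions along \<open>- K\<close>, and
  \<open>off_step\<close> preserves this because \<open>F x\<close> maps such directions to such
  directions.\<close>

lemma ad_condition_imp_zero:
  assumes m: "m \<ge> 1" and W: "open W" "x \<in> W" and F: "smooth_on W F" "\<And>x. x \<in> W \<Longrightarrow> block_diag K (F x)"
    and ad: "ad_condition K m W F"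
    and sm: "smooth_on W \<xi>" "smooth_on W \<eta>"
    and dir: "\<And>x. x \<in> W \<Longrightarrow> proj K (\<xi> x) = \<xi> x" "\<And>x. x \<in> W \<Longrightarrow> proj (- K) (\<eta> x) = \<eta> x"
  shows "proj K (torsion m F \<xi> \<eta> x) = 0"
proof -
  obtain n where n: "m = Suc n" using m by (metis Suc_le_D One_nat_def)
  let ?f = "\<lambda>v. (ad (block K (F x)) ^^ n) (fderiv (\<lambda>z. block K (F z)) x v)"
  have bdx: "block_diag K (F x)" using F(2) W(2) .
  have f0: "?f v = 0" if "proj (- K) v = v" for v
    using ad that W(2) n by (simp add: ad_condition_iff[OF F(1)])
  have "(off_step (block K (F x)) (F x) ^^ k) ?f v = 0" if "proj (- K) v = v" for k v
    using that
  proof (induction k arbitrary: v)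
    case 0 then show ?case using f0 by simp
  next
    case (Suc k)
    have "proj (- K) (F x *v v) = F x *v v" using Suc.prems block_diag_proj_compl[OF bdx] by simp
    then show ?case using Suc by (simp add: off_step_def)
  qed
  then have "(off_step (block K (F x)) (F x) ^^ Suc n) ?f (\<eta> x) = 0" using dir(2)[OF W(2)] by blast
  then show ?thesis
    unfolding n by (simp only: torsion_mixed[OF W F sm dir] matrix_vector_mult_0)
qed

text \<open>Both fields are split along \<open>K\<close> and \<open>- K\<close>. Pure pairs vanish
  by the slice conditions. For a mixed pair, the \<open>K\<close> part vanishes by the condition on
  the block in \<open>K\<close>, and the other part, after exchanging the arguments, by the
  condition on the block in \<open>- K\<close>.\<close>

lemma splitting_conditions_imp_torsion:
  assumes m: "m \<ge> 1" and W: "open W" and F: "smooth_on W F" "block_diagonal_on K W F"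
    and sc: "splitting_conditions K m W F"
  shows "torsion_vanishes m W F"
  unfolding torsion_vanishes_def
proof (intro allI impI ballI)
  fix \<xi> \<eta> :: "real^'a \<Rightarrow> real^'a" and x assume sm: "smooth_on W \<xi>" "smooth_on W \<eta>" and x: "x \<in> W"
  have bdF: "block_diag K (F x)" "block_diag (- K) (F x)" if "x \<in> W" for x
    using F(2) that by (simp_all add: block_diagonal_on_block_diag block_diag_compl)
  note sc' = sc[unfolded splitting_conditions_def]
  let ?p = "\<lambda>J (f :: real^'a \<Rightarrow> real^'a) x. proj J (f x)"
  have smp: "smooth_on W (?p J f)" if "smooth_on W f" for J and f :: "real^'a \<Rightarrow> real^'a"
    by (rule smooth_on_linear_compose[OF W bounded_linear_proj that])
  have KK: "torsion m F (?p K \<xi>) (?p K \<eta>) x = 0"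
    by (rule torsion_wrt_imp_zero[OF W x F(1) bdF(1)]) (use sc' smp sm in auto)
  have NN: "torsion m F (?p (- K) \<xi>) (?p (- K) \<eta>) x = 0"
    by (rule torsion_wrt_imp_zero[OF W x F(1) bdF(2)]) (use sc' smp sm in auto)
  have mixed: "torsion m F (?p K f) (?p (- K) g) x = 0" if f: "smooth_on W f" and g: "smooth_on W g" for f g
  proof -
    have "proj K (torsion m F (?p K f) (?p (- K) g) x) = 0"
      by (rule ad_condition_imp_zero[OF m W x F(1) bdF(1)]) (use sc' smp f g in auto)
    moreover have "proj (- K) (torsion m F (?p (- K) g) (?p K f) x) = 0"
      by (rule ad_condition_imp_zero[OF m W x F(1) bdF(2)]) (use sc' smp f g in auto)
    then have "proj (- K) (torsion m F (?p K f) (?p (- K) g) x) = 0"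
      using torsion_antisym[of m F "?p K f"] by (simp add: proj_minus)
    ultimately show ?thesis by (metis add_0 proj_add_compl)
  qed
  have "torsion m F \<xi> \<eta> x = torsion m F (\<lambda>x. ?p K \<xi> x + ?p (- K) \<xi> x) (\<lambda>x. ?p K \<eta> x + ?p (- K) \<eta> x) x"
    by (simp add: proj_add_compl)
  also have "\<dots> = 0"
    unfolding torsion_add_left[OF W x F(1) smp[OF sm(1)] smp[OF sm(1)] smooth_on_add[OF W smp[OF sm(2)] smp[OF sm(2)]]]
      torsion_add_right[OF W x F(1) smp[OF sm(1)] smp[OF sm(2)] smp[OF sm(2)]]
    using KK NN mixed[OF sm] mixed[OF sm(2,1)] torsion_antisym[of m F "?p (- K) \<xi>"] by simp
  finally show "torsion m F \<xi> \<eta> x = 0" .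
qed

subsection \<open>Involutivity of the invariant distributions\<close>

text \<open>\<open>(L - R_1) (L - R_2)\<close> on bilinear maps, with \<open>M\<close> acting on the
  value and on both arguments.\<close>

definition torsion_step :: "real^'n^'n \<Rightarrow> (real^'n \<Rightarrow> real^'n \<Rightarrow> real^'n) \<Rightarrow> real^'n \<Rightarrow> real^'n \<Rightarrow> real^'n" where
  "torsion_step M B = (\<lambda>h k. M *v (M *v B h k) + B (M *v h) (M *v k) - M *v B (M *v h) k - M *v B h (M *v k))"

text \<open>Values lie along \<open>- K\<close> and arguments along \<open>K\<close>, so both
  \<open>L - R_1\<close> and \<open>L - R_2\<close> are Sylvester operators between different
  blocks, injective by separation. Each induction step cancels one factor of either kind.\<close>

lemma torsion_step_injective:
  assumes M: "block_diag K M" "separated K M"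
    and B: "\<And>k. linear (\<lambda>h. B h k)" "\<And>h. linear (B h)"
    and Y: "\<And>h k. proj (- K) (B h k) = B h k"
    and 0: "\<And>h k. proj K h = h \<Longrightarrow> proj K k = k \<Longrightarrow> (torsion_step M ^^ n) B h k = 0"
    and hk: "proj K h = h" "proj K k = k"
  shows "B h k = 0"
  using B Y 0 hk
proof (induction n arbitrary: B h k)
  case 0 then show ?case by simp
next
  case (Suc n)
  note lin = Suc.prems(1,2) and Y = Suc.prems(3)
  let ?B = "torsion_step M B"
  have MK: "proj K (M *v h) = M *v h" if "proj K h = h" for h using block_diag_proj[OF M(1), of h] that by simp
  have linM: "linear (\<lambda>h. M *v f h)" if "linear f" for f :: "real^'a \<Rightarrow> real^'a"
    using linear_compose[OF that matrix_vector_mul_linear[of M]] by (simp add: o_def)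
  have "linear (\<lambda>h. B (M *v h) k)" "linear (\<lambda>h. B h (M *v k))" "linear (\<lambda>k. B h (M *v k))" for h k
    using linear_compose[OF matrix_vector_mul_linear[of M] Suc.prems(1)]
      linear_compose[OF matrix_vector_mul_linear[of M] Suc.prems(2)] Suc.prems(1) by (simp_all add: o_def)
  note lin2 = this
  have "linear (\<lambda>h. B (M *v h) (M *v k))" "linear (\<lambda>k. B (M *v h) (M *v k))" for h k
    using lin2(1)[of "M *v k"] lin2(3)[of "M *v h"] by simp_all
  note lin3 = this
  have lB: "linear (\<lambda>h. ?B h k)" "linear (?B h)" for h k
    unfolding torsion_step_def
    using lin lin2 lin3 by (intro linear_compose_add linear_compose_sub linM; simp)+
  have YB: "proj (- K) (?B h k) = ?B h k" for h k
    by (simp add: torsion_step_def proj_add proj_diff block_diag_proj_compl[OF M(1)] Y)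
  have B0: "?B h k = 0" if "proj K h = h" "proj K k = k" for h k
    using Suc.IH[OF lB YB _ that] Suc.prems(4) by (simp add: funpow_swap1)
  \<comment> \<open>\<open>U\<close> is \<open>(L - R_2) B\<close>. It lies in the kernel of
    \<open>L - R_1\<close> and vanishes; then \<open>B\<close> lies in the kernel of
    \<open>L - R_2\<close>.\<close>
  define U where "U h k = M *v B h k - B h (M *v k)" for h k
  have U0: "U h k = 0" if h: "proj K h = h" and k: "proj K k = k" for h k
  proof (rule sylvester_zero[OF M, of "\<lambda>h. U h k"])
    show "linear (\<lambda>h. U h k)"
      unfolding U_def by (intro linear_compose_sub linM lin lin2)
    show "proj (- K) (U h k) = U h k" for h
      by (simp add: U_def proj_diff block_diag_proj_compl[OF M(1)] Y)
    show "M *v U h k = U (M *v h) k" if "proj K h = h" for h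
      using B0[OF that k] by (simp add: U_def torsion_step_def matrix_vector_mult_diff_distrib algebra_simps)
  qed (rule h)
  show ?case
  proof (rule sylvester_zero[OF M, of "B h"])
    show "M *v B h k = B h (M *v k)" if "proj K k = k" for k
      using U0[OF Suc.prems(5) that] by (simp add: U_def)
  qed (use Suc.prems in auto)
qed

text \<open>Modulo the distribution spanned by the columns \<open>G h\<close> with \<open>h\<close> along \<open>K\<close>, the bracket of two
  of its sections is a tensor, on which each torsion step acts invertibly.\<close>
lemma torsion_imp_involutive:
  assumes W: "open W" and sm: "smooth_on W L" "smooth_on W G" "smooth_on W M"
    and LG: "\<And>z. z \<in> W \<Longrightarrow> L z ** G z = G z ** M z"
    and M: "\<And>z. z \<in> W \<Longrightarrow> block_diag K (M z)" "\<And>z. z \<in> W \<Longrightarrow> separated K (M z)"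
    and inv: "\<And>z. z \<in> W \<Longrightarrow> invertible (G z)"
    and frame: "\<And>z h. z \<in> W \<Longrightarrow> proj K h = h \<Longrightarrow> proj K (G z *v h) = h"
    and T: "torsion_vanishes m W L"
    and z: "z \<in> W" and hk: "proj K h = h" "proj K k = k"
  shows "fderiv G z (G z *v h) *v k = fderiv G z (G z *v k) *v h"
proof -
  let ?DG = "\<lambda>z. fderiv G z" and ?i = "matrix_inv (G z)"
  \<comment> \<open>The bracket of the frame fields \<open>G h\<close> and \<open>G k\<close>, read
    in the frame and modulo the distribution. For variable coefficients along \<open>K\<close> the
    extra terms are derivatives of the coefficients; they stay along \<open>K\<close> and are
    projected away.\<close>
  define B where "B h k = proj (- K) (?i *v (?DG z (G z *v h) *v k - ?DG z (G z *v k) *v h))" for h k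
  have iG: "?i *v (G z *v v) = v" for v
    using matrix_inv_mult(2)[OF inv[OF z]] by (simp add: matrix_vector_mul_assoc)
  have iL: "?i *v (L z *v v) = M z *v (?i *v v)" for v
  proof -
    have "v = G z *v (?i *v v)" using matrix_inv_mult(1)[OF inv[OF z]] by (simp add: matrix_vector_mul_assoc)
    then have "L z *v v = (L z ** G z) *v (?i *v v)" by (metis matrix_vector_mul_assoc)
    also have "\<dots> = G z *v (M z *v (?i *v v))" by (simp add: LG[OF z] matrix_vector_mul_assoc matrix_mul_assoc)
    finally show ?thesis by (simp add: iG)
  qed
  \<comment> \<open>In the frame, \<open>L\<close> acts on coefficients as \<open>M\<close>, and
    \<open>M\<close> commutes with the projection. The recursion for the torsion thus becomes
    iteration of \<open>torsion_step\<close> on \<open>B\<close>.\<close>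
  have main: "proj (- K) (?i *v torsion n L (\<lambda>z. G z *v \<xi> z) (\<lambda>z. G z *v \<eta> z) z) = (torsion_step (M z) ^^ n) B (\<xi> z) (\<eta> z)"
    if "smooth_on W \<xi>" "smooth_on W \<eta>" "\<And>x. x \<in> W \<Longrightarrow> proj K (\<xi> x) = \<xi> x" "\<And>x. x \<in> W \<Longrightarrow> proj K (\<eta> x) = \<eta> x"
    for n \<xi> \<eta>
    using that
  proof (induction n arbitrary: \<xi> \<eta>)
    case 0
    have D: "proj (- K) (fderiv f z v) = 0" if "smooth_on W f" "\<And>x. x \<in> W \<Longrightarrow> proj K (f x) = f x" for f v
      using derivative_invariant[OF W z that(1) bounded_linear_proj that(2), of v] by (metis proj_compl(2))
    show ?case
      unfolding torsion.simps lie_bracket_def frechet_derivative_matrix_vector[OF sm(2) 0(1) z]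
        frechet_derivative_matrix_vector[OF sm(2) 0(2) z] funpow_0 B_def
      by (simp add: matrix_vector_mult_diff_distrib matrix_vector_right_distrib proj_diff proj_add iG
          D[OF 0(1,3)] D[OF 0(2,4)])
  next
    case (Suc n)
    let ?M = "app_field M" and ?G = "\<lambda>f z. G z *v f z"
    have app: "app_field L (?G f) x = ?G (?M f) x" if "x \<in> W" for f x
      using LG[OF that] by (simp add: app_field_def matrix_vector_mul_assoc)
    have smM: "smooth_on W (?M \<xi>)" "smooth_on W (?M \<eta>)"
      using smooth_on_app_field[OF W sm(3)] Suc.prems by auto
    have prM: "proj K (?M \<xi> x) = ?M \<xi> x" "proj K (?M \<eta> x) = ?M \<eta> x" if "x \<in> W" for x
      using that Suc.prems(3,4) block_diag_proj[OF M(1)[OF that]] by (simp_all add: app_field_def)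
    have c: "torsion n L (app_field L (?G \<xi>)) (app_field L (?G \<eta>)) z = torsion n L (?G (?M \<xi>)) (?G (?M \<eta>)) z"
       "torsion n L (app_field L (?G \<xi>)) (?G \<eta>) z = torsion n L (?G (?M \<xi>)) (?G \<eta>) z"
       "torsion n L (?G \<xi>) (app_field L (?G \<eta>)) z = torsion n L (?G \<xi>) (?G (?M \<eta>)) z"
      using app by (auto intro!: torsion_cong[OF W z])
    show ?case
      by (simp only: torsion.simps c matrix_vector_mult_diff_distrib matrix_vector_right_distrib proj_diff proj_add
          iL block_diag_proj_compl[OF M(1)[OF z]] Suc.IH[OF Suc.prems] Suc.IH[OF smM prM]
          Suc.IH[OF smM(1) Suc.prems(2) prM(1) Suc.prems(4)] Suc.IH[OF Suc.prems(1) smM(2) Suc.prems(3) prM(2)])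
        (simp add: torsion_step_def app_field_def)
  qed
  have lin: "linear (?DG z)" using smooth_on_bounded_linear[OF sm(2) z] bounded_linear.linear by blast
  note ls = linear_add[OF lin] linear_scale[OF lin] matrix_vector_right_distrib matrix_vector_mult_scaleR
    matrix_vector_mult_add_rdistrib scaleR_matrix_vector_assoc[symmetric] proj_add proj_scaleR
    matrix_vector_mult_diff_distrib
  have "B h k = 0"
  proof (rule torsion_step_injective[OF M(1)[OF z] M(2)[OF z], of B m])
    show "linear (\<lambda>h. B h k)" "linear (B h)" for h k
      by (auto simp: linear_iff B_def ls proj_diff algebra_simps)
    show "proj (- K) (B h k) = B h k" for h k by (simp add: B_def)
    show "(torsion_step (M z) ^^ m) B h k = 0" if "proj K h = h" "proj K k = k" for h k
    proof -
      have "torsion m L (\<lambda>z. G z *v h) (\<lambda>z. G z *v k) z = 0"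
        using T z smooth_on_matrix_vector_mult[OF W sm(2) smooth_on_const[OF W]]
        unfolding torsion_vanishes_def by blast
      then show ?thesis
        using main[OF smooth_on_const[OF W] smooth_on_const[OF W], of h k m] that by simp
    qed
  qed (rule hk)+
  moreover define w where "w = ?DG z (G z *v h) *v k - ?DG z (G z *v k) *v h"
  ultimately have u: "proj K (?i *v w) = ?i *v w" by (metis B_def add.right_neutral proj_add_compl)
  \<comment> \<open>The \<open>K\<close> components of the frame fields are constant, so brackets of
    frame fields have no \<open>K\<close> component. A vector of the distribution is determined by
    that component: the brackets vanish, they do not merely lie in the distribution.\<close>
  have pw: "proj K (?DG z v *v k) = 0" if "proj K k = k" for v k
  proof -
    have sk: "smooth_on W (\<lambda>y. G y *v k)"
      by (rule smooth_on_matrix_vector_mult[OF W sm(2) smooth_on_const[OF W]])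
    have "fderiv (\<lambda>y. proj K (G y *v k)) z v = proj K (?DG z v *v k)"
      using frechet_derivativeI[OF bounded_linear.has_derivative[OF bounded_linear_proj smooth_on_has_derivative[OF sk z]]]
        frechet_derivative_matrix_vector[OF sm(2) smooth_on_const[OF W, of k] z] by simp
    moreover have "fderiv (\<lambda>y. proj K (G y *v k)) z = fderiv (\<lambda>y. k) z"
      by (rule frechet_derivative_cong_open[OF W z]) (simp add: frame that)
    ultimately show ?thesis by simp
  qed
  have "w = G z *v (?i *v w)" using matrix_inv_mult(1)[OF inv[OF z]] by (simp add: matrix_vector_mul_assoc)
  then have "?i *v w = proj K w" using frame[OF z u] by simp
  also have "\<dots> = 0" using pw hk by (simp add: w_def proj_diff)
  finally have "w = 0" using \<open>w = G z *v (?i *v w)\<close> by simp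
  then show ?thesis by (simp add: w_def)
qed

subsection \<open>Matrices over commutative rings\<close>

lemma matrix_sub_ldistrib: "A ** (B - C) = A ** B - A ** C" for A :: "'a::comm_ring_1^'n^'m"
  by (simp add: matrix_matrix_mult_def vec_eq_iff algebra_simps sum_subtractf)

lemma matrix_sub_rdistrib: "(A - B) ** C = A ** C - B ** C" for A :: "'a::comm_ring_1^'n^'m"
  by (simp add: matrix_matrix_mult_def vec_eq_iff algebra_simps sum_subtractf)

lemma matrix_add_rdistrib': "(A + B) ** C = A ** C + B ** C" for A :: "'a::comm_ring_1^'n^'m"
  by (simp add: matrix_matrix_mult_def vec_eq_iff algebra_simps sum.distrib)

lemma matrix_mult_zero: "A ** 0 = 0" "0 ** A = 0" for A :: "'a::comm_ring_1^'n^'n"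
  by (simp_all add: matrix_matrix_mult_def vec_eq_iff)

lemma minus_matrix_vector_mult: "(- A) *v v = - (A *v v)" for A :: "'a::comm_ring_1^'n^'m"
  by (simp add: matrix_vector_mult_def vec_eq_iff sum_negf)

lemma card_add_card_Compl: "card K + card (- K) = CARD('n)" for K :: "'n::finite set"
  by (subst card_Un_disjoint[symmetric]) auto

lemma mat_mult_commute: "mat c ** A = A ** mat c" for A :: "'a::comm_ring_1^'n^'n"
proof -
  have "(mat c ** A) $ i $ j = (A ** mat c) $ i $ j" for i j
  proof -
    have "(mat c ** A) $ i $ j = (\<Sum>k\<in>UNIV. if i = k then c * A $ k $ j else 0)"
      unfolding matrix_matrix_mult_def mat_def vec_lambda_beta by (rule sum.cong) auto
    also have "\<dots> = (\<Sum>k\<in>UNIV. if k = j then A $ i $ k * c else 0)"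
      by (simp add: mult.commute)
    also have "\<dots> = (A ** mat c) $ i $ j"
      unfolding matrix_matrix_mult_def mat_def vec_lambda_beta by (rule sum.cong) auto
    finally show ?thesis .
  qed
  then show ?thesis by (simp add: vec_eq_iff)
qed

lemma mat_mult_mat: "mat c ** mat d = (mat (c * d) :: 'a::comm_ring_1^'n^'n)"
proof -
  have "(mat c ** mat d :: 'a^'n^'n) $ i $ j = mat (c * d) $ i $ j" for i j
  proof -
    have "(mat c ** mat d :: 'a^'n^'n) $ i $ j = (\<Sum>k\<in>UNIV. if i = k then c * (if k = j then d else 0) else 0)"
      unfolding matrix_matrix_mult_def mat_def vec_lambda_beta by (rule sum.cong) auto
    then show ?thesis by (simp add: mat_def)
  qed
  then show ?thesis by (simp add: vec_eq_iff)
qed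

lemma mat_mult_vec: "mat c *v v = c *s v" for v :: "'a::comm_ring_1^'n"
proof -
  have "(mat c *v v) $ i = (\<Sum>k\<in>UNIV. if i = k then c * v $ k else 0)" for i
    unfolding matrix_vector_mult_def mat_def vec_lambda_beta by (rule sum.cong) auto
  then show ?thesis by (simp add: vec_eq_iff)
qed

lemma matrix_vector_mult_axis: "A *v axis k 1 = column k A" for A :: "'a::comm_ring_1^'n^'m"
proof -
  have "(A *v axis k 1) $ i = (\<Sum>j\<in>UNIV. if j = k then A $ i $ j else 0)" for i
    unfolding matrix_vector_mult_def axis_def vec_lambda_beta by (rule sum.cong) auto
  then show ?thesis by (simp add: vec_eq_iff column_def)
qed

lemma mat_add: "mat (a + b) = mat a + (mat b :: 'a::comm_ring_1^'n^'n)"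
  by (simp add: mat_def vec_eq_iff)

lemma det_mat: "det (mat c :: 'a::comm_ring_1^'n^'n) = c ^ CARD('n)"
  by (subst det_diagonal) (simp_all add: mat_def)

subsection \<open>Polynomials of a matrix\<close>

definition poly_mat :: "real poly \<Rightarrow> real^'n^'n \<Rightarrow> real^'n^'n" where
  "poly_mat p M = fold_coeffs (\<lambda>a X. a *\<^sub>R mat 1 + M ** X) p 0"

lemma poly_mat_0 [simp]: "poly_mat 0 M = 0"
  by (simp add: poly_mat_def)

lemma poly_mat_pCons [simp]: "poly_mat (pCons a p) M = a *\<^sub>R mat 1 + M ** poly_mat p M"
  by (cases "p = 0 \<and> a = 0") (auto simp: poly_mat_def)

lemma poly_mat_add: "poly_mat (p + q) M = poly_mat p M + poly_mat q M"
  by (induction p q rule: poly_induct2) (simp_all add: matrix_add_ldistrib scaleR_add_left algebra_simps)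

lemma poly_mat_smult: "poly_mat (smult a p) M = a *\<^sub>R poly_mat p M"
  by (induction p) (simp_all add: matrix_scalar_ac scalar_matrix_assoc scaleR_add_right)

lemma poly_mat_mult: "poly_mat (p * q) M = poly_mat p M ** poly_mat q M"
proof (induction p)
  case (pCons a p)
  have "poly_mat (pCons a p * q) M = a *\<^sub>R poly_mat q M + M ** (poly_mat p M ** poly_mat q M)"
    using pCons by (simp add: poly_mat_add poly_mat_smult)
  then show ?case by (simp add: matrix_add_rdistrib' scalar_matrix_assoc[symmetric] matrix_mul_assoc)
qed simp

lemma poly_mat_1 [simp]: "poly_mat 1 M = mat 1"
  by (simp add: one_pCons)

lemma poly_mat_commute: "C ** M = M ** C \<Longrightarrow> C ** poly_mat p M = poly_mat p M ** C"
proof (induction p)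
  case (pCons a p)
  have "C ** (M ** poly_mat p M) = M ** (C ** poly_mat p M)"
    using pCons.prems by (simp add: matrix_mul_assoc)
  then show ?case
    using pCons by (simp add: matrix_add_ldistrib matrix_add_rdistrib' matrix_scalar_ac scalar_matrix_assoc[symmetric] matrix_mul_assoc)
qed simp

lemma poly_mat_conj:
  assumes "T ** S = mat 1" "S ** T = mat 1"
  shows "poly_mat p (T ** M ** S) = T ** poly_mat p M ** S"
proof (induction p)
  case (pCons a p)
  have "T ** M ** S ** (T ** poly_mat p M ** S) = T ** M ** (S ** T) ** poly_mat p M ** S"
    by (simp only: matrix_mul_assoc)
  then have "T ** M ** S ** (T ** poly_mat p M ** S) = T ** (M ** poly_mat p M) ** S"
    using assms(2) by (simp add: matrix_mul_assoc)
  then show ?case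
    using pCons assms(1) by (simp add: matrix_add_ldistrib matrix_add_rdistrib' matrix_scalar_ac scalar_matrix_assoc[symmetric])
qed simp

subsection \<open>Cayley-Hamilton\<close>

text \<open>The adjugate. Replacing row \<open>k\<close> by a unit vector yields the cofactors by
  determinants alone, so it makes sense over the polynomial ring.\<close>

definition adj :: "'a::comm_ring_1^'n^'n \<Rightarrow> 'a^'n^'n" where
  "adj M = (\<chi> j k. det (\<chi> r. if r = k then axis j 1 else M $ r))"

text \<open>Linearity of the determinant in row \<open>k\<close> reassembles row \<open>i\<close> of
  \<open>M\<close> in that place: the result is \<open>det M\<close> for \<open>i = k\<close> and
  has two equal rows otherwise.\<close>

lemma mult_adj: "M ** adj M = mat (det M)"
proof -
  have "(M ** adj M) $ i $ k = mat (det M) $ i $ k" for i k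
  proof -
    have "(M ** adj M) $ i $ k = (\<Sum>j\<in>UNIV. det (\<chi> r. if r = k then M $ i $ j *s axis j 1 else M $ r))"
      by (simp add: matrix_matrix_mult_def adj_def det_row_mul)
    also have "\<dots> = det (\<chi> r. if r = k then (\<Sum>j\<in>UNIV. M $ i $ j *s axis j 1) else M $ r)"
      by (rule det_linear_row_sum[symmetric]) simp
    also have "\<dots> = det (\<chi> r. if r = k then M $ i else M $ r)"
      unfolding basis_expansion ..
    also have "\<dots> = mat (det M) $ i $ k"
    proof (cases "i = k")
      case True
      have "(\<chi> r. if r = k then M $ k else M $ r) = M" by (simp add: vec_eq_iff)
      then show ?thesis unfolding True by (simp add: mat_def)
    next
      case False
      then show ?thesis
        by (subst det_identical_rows[of i k]) (auto simp: row_def vec_eq_iff mat_def)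
    qed
    finally show ?thesis .
  qed
  then show ?thesis by (simp add: vec_eq_iff)
qed

text \<open>Letting the variable act as \<open>M\<close> turns the vector space into a module over
  the polynomials; this is the module map that sends each polynomial unit vector to the real
  one.\<close>

definition eval_vec :: "real^'n^'n \<Rightarrow> (real poly)^'n \<Rightarrow> real^'n" where
  "eval_vec M v = (\<Sum>i\<in>UNIV. poly_mat (v $ i) M *v axis i 1)"

lemma eval_vec_add: "eval_vec M (v + w) = eval_vec M v + eval_vec M w"
  by (simp add: eval_vec_def poly_mat_add matrix_vector_mult_add_rdistrib sum.distrib)

lemma eval_vec_smult: "eval_vec M (q *s v) = poly_mat q M *v eval_vec M v"
  by (simp add: eval_vec_def poly_mat_mult matrix_vector_mul_assoc[symmetric] vec.sum)

lemma eval_vec_sum: "finite I \<Longrightarrow> eval_vec M (\<Sum>i\<in>I. v i) = (\<Sum>i\<in>I. eval_vec M (v i))"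
  by (induction I rule: finite_induct) (simp_all add: eval_vec_add, simp add: eval_vec_def)

lemma eval_vec_axis: "eval_vec M (axis k 1) = axis k 1"
proof -
  have "eval_vec M (axis k 1) = (\<Sum>i\<in>UNIV. if i = k then axis k 1 else 0)"
    unfolding eval_vec_def by (rule sum.cong) (auto simp: axis_def)
  then show ?thesis by simp
qed

definition const_mat :: "real^'n^'m \<Rightarrow> (real poly)^'n^'m" where
  "const_mat A = (\<chi> i j. [:A $ i $ j:])"

abbreviation char_mat :: "real^'n^'n \<Rightarrow> (real poly)^'n^'n" where
  "char_mat A \<equiv> mat [:0, 1:] - const_mat A"

lemma charpoly_eq: "charpoly A = det (char_mat A)"
  unfolding charpoly_def by (rule arg_cong[where f = det]) (simp add: vec_eq_iff mat_def const_mat_def)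

text \<open>Column \<open>j\<close> of \<open>X - A\<close> evaluates to \<open>A\<close> applied to
  the \<open>j\<close>-th unit vector minus column \<open>j\<close> of \<open>A\<close>, that is, to
  0. The adjugate writes the characteristic polynomial times a unit vector as a polynomial
  combination of these columns.\<close>

lemma cayley_hamilton: "poly_mat (charpoly A) A = 0"
proof -
  let ?M = "char_mat A"
  have col: "eval_vec A (column j ?M) = 0" for j
  proof -
    have "eval_vec A (column j ?M) = (\<Sum>i\<in>UNIV. (if i = j then A *v axis i 1 else 0) - (A $ i $ j) *\<^sub>R axis i 1)"
      unfolding eval_vec_def
    proof (rule sum.cong)
      fix i
      have "column j ?M $ i = (if i = j then [:- (A $ i $ j), 1:] else [:- (A $ i $ j):])"
        by (simp add: column_def mat_def const_mat_def)
      then show "poly_mat (column j ?M $ i) A *v axis i 1 = (if i = j then A *v axis i 1 else 0) - (A $ i $ j) *\<^sub>R axis i 1"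
        by (simp add: matrix_vector_mult_diff_rdistrib minus_matrix_vector_mult scaleR_matrix_vector_assoc[symmetric])
    qed simp
    also have "\<dots> = A *v axis j 1 - (\<Sum>i\<in>UNIV. (A $ i $ j) *\<^sub>R axis i 1)"
      by (simp add: sum_subtractf)
    also have "(\<Sum>i\<in>UNIV. (A $ i $ j) *\<^sub>R axis i 1) = column j A"
      using basis_expansion[of "column j A"] by (simp add: column_def scalar_mult_eq_scaleR)
    finally show ?thesis by (simp add: matrix_vector_mult_basis)
  qed
  have "poly_mat (charpoly A) A *v axis k 1 = 0" for k
  proof -
    have "charpoly A *s axis k 1 = (mat (det ?M)) *v axis k 1"
      by (simp add: charpoly_eq mat_mult_vec)
    also have "\<dots> = ?M *v (adj ?M *v axis k 1)"
      unfolding mult_adj[symmetric] by (rule matrix_vector_mul_assoc[symmetric])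
    also have "adj ?M *v axis k 1 = column k (adj ?M)"
      by (rule matrix_vector_mult_axis)
    also have "?M *v column k (adj ?M) = (\<Sum>j\<in>UNIV. column k (adj ?M) $ j *s column j ?M)"
      by (rule matrix_mult_sum)
    finally have "eval_vec A (charpoly A *s axis k 1) = (\<Sum>j\<in>UNIV. eval_vec A (column k (adj ?M) $ j *s column j ?M))"
      by (simp add: eval_vec_sum)
    then show ?thesis by (simp add: eval_vec_smult eval_vec_axis col)
  qed
  then show ?thesis
    by (simp add: vec_eq_iff matrix_vector_mult_basis column_def)
qed

subsection \<open>Spectral splitting of a matrix\<close>

lemma sum_const_poly: "(\<Sum>k\<in>I. [:f k:]) = [:\<Sum>k\<in>I. f k:]"
  by (induction I rule: infinite_finite_induct) simp_all

lemma const_mat_mult: "const_mat (A ** B) = const_mat A ** const_mat B"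
  by (simp add: const_mat_def matrix_matrix_mult_def vec_eq_iff sum_const_poly mult.commute)

lemma const_mat_1: "const_mat (mat 1) = mat 1"
  by (auto simp: const_mat_def mat_def vec_eq_iff one_pCons)

lemma const_mat_add: "const_mat (A + B) = const_mat A + const_mat B"
  by (simp add: const_mat_def vec_eq_iff)

lemma const_mat_scaleR: "const_mat (a *\<^sub>R mat 1) = mat [:a:]"
  by (auto simp: const_mat_def mat_def vec_eq_iff)

lemma charpoly_conj:
  fixes T S A :: "real^'n^'n"
  assumes "T ** S = mat 1" "S ** T = mat 1"
  shows "charpoly (T ** A ** S) = charpoly A"
proof -
  have TS: "const_mat T ** const_mat S = mat 1"
    using assms by (simp add: const_mat_mult[symmetric] const_mat_1)
  have "const_mat T ** mat [:0, 1:] ** const_mat S = mat [:0, 1:] ** (const_mat T ** const_mat S)"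
    using mat_mult_commute[of "[:0, 1:]" "const_mat T"] by (simp add: matrix_mul_assoc)
  then have "char_mat (T ** A ** S) = const_mat T ** char_mat A ** const_mat S"
    by (simp add: TS matrix_sub_ldistrib matrix_sub_rdistrib const_mat_mult)
  then have "charpoly (T ** A ** S) = det (const_mat T ** const_mat S) * charpoly A"
    by (simp add: charpoly_eq det_mul)
  then show ?thesis by (simp add: TS)
qed

text \<open>The factor theorem: \<open>X - A\<close> divides \<open>p(X) - p(A)\<close>, with the
  quotient built along Horner's scheme. Its commuting with everything that commutes with
  \<open>A\<close> is carried along in order to be applied to the block projection.\<close>

lemma charpoly_quotient:
  "\<exists>R. mat p - const_mat (poly_mat p A) = char_mat A ** R \<and>
     (\<forall>C. C ** A = A ** C \<longrightarrow> R ** const_mat C = const_mat C ** R)"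
proof (induction p)
  case 0
  show ?case by (rule exI[of _ 0]) (simp add: const_mat_def vec_eq_iff mat_def matrix_matrix_mult_def)
next
  case (pCons a p)
  then obtain R where R: "mat p - const_mat (poly_mat p A) = char_mat A ** R"
    "\<And>C. C ** A = A ** C \<Longrightarrow> R ** const_mat C = const_mat C ** R" by blast
  let ?x = "mat [:0, 1:] :: real poly^'a^'a" and ?P = "const_mat (poly_mat p A)"
  have "mat (pCons a p) = mat [:a:] + ?x ** mat p"
    by (simp add: mat_mult_mat mat_add[symmetric])
  then have "mat (pCons a p) - const_mat (poly_mat (pCons a p) A) = ?x ** mat p - const_mat A ** ?P"
    by (simp add: const_mat_add const_mat_mult const_mat_scaleR)
  also have "\<dots> = ?x ** (mat p - ?P) + char_mat A ** ?P"
    by (simp add: matrix_sub_ldistrib matrix_sub_rdistrib)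
  also have "?x ** (mat p - ?P) = char_mat A ** (?x ** R)"
    unfolding R(1) by (simp only: matrix_mul_assoc mat_mult_commute[of _ "char_mat A"])
  also have "\<dots> + char_mat A ** ?P = char_mat A ** (?x ** R + ?P)"
    by (rule matrix_add_ldistrib[symmetric])
  finally have 1: "mat (pCons a p) - const_mat (poly_mat (pCons a p) A) = char_mat A ** (?x ** R + ?P)" .
  have 2: "(?x ** R + ?P) ** const_mat C = const_mat C ** (?x ** R + ?P)" if C: "C ** A = A ** C" for C
  proof -
    have "?P ** const_mat C = const_mat C ** ?P"
      using poly_mat_commute[OF C] by (simp add: const_mat_mult[symmetric])
    moreover have "?x ** R ** const_mat C = const_mat C ** (?x ** R)"
      using R(2)[OF C] by (metis matrix_mul_assoc mat_mult_commute)
    ultimately show ?thesis by (simp add: matrix_add_ldistrib matrix_add_rdistrib')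
  qed
  show ?case using 1 2 by blast
qed

section \<open>Idempotents and the characteristic polynomial of a block\<close>

definition proj_mat :: "'n set \<Rightarrow> real^'n^'n" where
  "proj_mat K = (\<chi> i j. if i = j \<and> i \<in> K then 1 else 0)"

lemma proj_mat_mult_vec [simp]: "proj_mat K *v v = proj K v"
proof -
  have "(proj_mat K *v v) $ i = (\<Sum>j\<in>UNIV. if i = j then (if i \<in> K then v $ j else 0) else 0)" for i
    unfolding matrix_vector_mult_def proj_mat_def vec_lambda_beta by (rule sum.cong) auto
  then show ?thesis by (simp add: vec_eq_iff)
qed

lemma proj_mat_idem: "proj_mat K ** proj_mat K = proj_mat K" "proj_mat K ** proj_mat (- K) = 0"
  "proj_mat (- K) ** proj_mat K = 0" "proj_mat K + proj_mat (- K) = mat 1"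
  by (simp_all add: matrix_eq matrix_vector_mul_assoc[symmetric] matrix_vector_mult_add_rdistrib proj_add_compl)

lemma block_diag_iff_commute: "block_diag K M \<longleftrightarrow> proj_mat K ** M = M ** proj_mat K"
  by (simp add: block_diag_iff matrix_eq matrix_vector_mul_assoc[symmetric])

text \<open>Bases of the range and of the kernel, which is the range of \<open>1 - e\<close>, are
  indexed by \<open>K\<close> and \<open>- K\<close> and form the columns of
  \<open>S\<close>.\<close>

lemma idempotent_conj_proj_mat:
  fixes e :: "real^'n^'n" and K :: "'n set"
  assumes e: "e ** e = e" and K: "card K = dim (range ((*v) e))"
  obtains T S where "T ** S = mat 1" "S ** T = mat 1" "T ** e ** S = proj_mat K"
proof -
  let ?R = "range ((*v) e)" and ?N = "range ((*v) (mat 1 - e))"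
  have ee: "e *v (e *v v) = e *v v" for v using e by (simp add: matrix_vector_mul_assoc)
  have sub: "subspace ?R" "subspace ?N"
    by (auto intro!: linear_subspace_image matrix_vector_mul_linear)
  have R: "e *v v = v" if "v \<in> ?R" for v using that ee by auto
  have N: "e *v v = 0" if "v \<in> ?N" for v
    using that ee by (auto simp: matrix_vector_mult_diff_rdistrib matrix_vector_mult_diff_distrib)
  have split: "v = e *v v + (mat 1 - e) *v v" for v by (simp add: matrix_vector_mult_diff_rdistrib)
  have "{x + y |x y. x \<in> ?R \<and> y \<in> ?N} = UNIV" using split by blast
  moreover have "?R \<inter> ?N = {0}"
  proof -
    have "v = 0" if "v \<in> ?R" "v \<in> ?N" for v using R[OF that(1)] N[OF that(2)] by simp
    then show ?thesis using subspace_0[OF sub(1)] subspace_0[OF sub(2)] by blast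
  qed
  ultimately have "CARD('n) = dim ?R + dim ?N"
    using dim_sums_Int[OF sub] by (simp add: dim_UNIV)
  then have K': "card (- K) = dim ?N"
    using K card_add_card_Compl[of K] by simp
  obtain B1 where B1: "B1 \<subseteq> ?R" "independent B1" "?R \<subseteq> span B1" "card B1 = dim ?R" by (rule basis_exists)
  obtain B2 where B2: "B2 \<subseteq> ?N" "independent B2" "?N \<subseteq> span B2" "card B2 = dim ?N" by (rule basis_exists)
  have fin: "finite B1" "finite B2" using B1(2) B2(2) independent_imp_finite by auto
  obtain b1 where b1: "bij_betw b1 K B1"
    using finite_same_card_bij[of K B1] K B1(4) fin by auto
  obtain b2 where b2: "bij_betw b2 (- K) B2"
    using finite_same_card_bij[of "- K" B2] K' B2(4) fin by auto
  define b where "b i = (if i \<in> K then b1 i else b2 i)" for i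
  define S where "S = (\<chi> i j. b j $ i)"
  have S: "S *v axis j 1 = b j" for j
    by (simp add: S_def matrix_vector_mult_basis column_def)
  have "B1 \<subseteq> range ((*v) S)"
  proof
    fix w assume "w \<in> B1"
    then obtain i where "i \<in> K" "w = b1 i" using b1 by (auto simp: bij_betw_def)
    then have "w = S *v axis i 1" by (simp add: S b_def)
    then show "w \<in> range ((*v) S)" by blast
  qed
  moreover have "B2 \<subseteq> range ((*v) S)"
  proof
    fix w assume "w \<in> B2"
    then obtain i where "i \<notin> K" "w = b2 i" using b2 by (auto simp: bij_betw_def)
    then have "w = S *v axis i 1" by (simp add: S b_def)
    then show "w \<in> range ((*v) S)" by blast
  qed
  moreover have sS: "subspace (range ((*v) S))"
    by (auto intro!: linear_subspace_image matrix_vector_mul_linear)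
  ultimately have "span B1 \<subseteq> range ((*v) S)" "span B2 \<subseteq> range ((*v) S)"
    using span_minimal[OF _ sS] by blast+
  then have "?R \<subseteq> range ((*v) S)" "?N \<subseteq> range ((*v) S)"
    using B1(3) B2(3) by (blast dest: subset_trans)+
  then have "e *v v \<in> range ((*v) S)" "(mat 1 - e) *v v \<in> range ((*v) S)" for v by blast+
  note sum_in = subspace_add[OF sS this]
  have "v \<in> range ((*v) S)" for v
    using sum_in[of v v] unfolding split[of v, symmetric] .
  then have "surj ((*v) S)" by blast
  then obtain T where T: "S ** T = mat 1" using matrix_right_invertible_surjective by blast
  then have T': "T ** S = mat 1" by (simp add: matrix_left_right_inverse)
  have "e ** S = S ** proj_mat K"
  proof -
    have "e *v (S *v axis j 1) = S *v proj K (axis j 1)" for j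
    proof (cases "j \<in> K")
      case True
      then have bj: "b j \<in> ?R" using b1 B1(1) bij_betwE[OF b1] by (simp only: b_def if_True subsetD)
      have pj: "proj K (axis j 1) = axis j 1" using True by (simp add: vec_eq_iff axis_def)
      show ?thesis unfolding pj S by (rule R[OF bj])
    next
      case False
      then have "b2 j \<in> B2" using b2 by (simp add: bij_betwE)
      then have bj: "b j \<in> ?N" using False B2(1) by (simp only: b_def if_False subsetD)
      have pj: "proj K (axis j 1) = 0" using False by (simp add: vec_eq_iff axis_def)
      show ?thesis unfolding pj S by (simp only: N[OF bj] matrix_vector_mult_0_right)
    qed
    then have "(e ** S) *v axis j 1 = (S ** proj_mat K) *v axis j 1" for j
      by (simp add: matrix_vector_mul_assoc[symmetric])
    then show ?thesis by (simp add: matrix_vector_mult_basis column_def vec_eq_iff)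
  qed
  then have "T ** e ** S = proj_mat K" using T' by (metis matrix_mul_assoc matrix_mul_lid)
  then show ?thesis using that T T' by blast
qed

lemma degree_det_le:
  fixes M :: "'a::comm_ring_1 poly^'n^'n"
  assumes "\<And>i j. degree (M $ i $ j) \<le> (if i \<in> K then 1 else 0)"
  shows "degree (det M) \<le> card K"
  unfolding det_def
proof (rule degree_sum_le)
  fix p assume "p \<in> {p. p permutes (UNIV :: 'n set)}"
  have "degree (\<Prod>i\<in>UNIV. M $ i $ p i) \<le> sum (degree \<circ> (\<lambda>i. M $ i $ p i)) UNIV"
    by (rule degree_prod_sum_le) simp
  also have "\<dots> \<le> (\<Sum>i\<in>UNIV. if i \<in> K then 1 else 0)"
    by (intro sum_mono) (use assms in simp)
  also have "\<dots> = card K" by (simp add: sum.If_cases)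
  finally have "degree (\<Prod>i\<in>UNIV. M $ i $ p i) \<le> card K" .
  moreover have "degree (of_int (sign p) * q) \<le> degree q" for q :: "'a poly"
    by (rule order_trans[OF degree_mult_le]) simp
  ultimately show "degree (of_int (sign p) * (\<Prod>i\<in>UNIV. M $ i $ p i)) \<le> card K"
    using order_trans by blast
qed simp

text \<open>The matrix is \<open>X - A\<close> on the block and the identity elsewhere, so its
  determinant is the characteristic polynomial of the block. Cutting the identity of
  \<open>charpoly_quotient\<close> down by the projection shows that it divides \<open>p\<close>
  times the identity there.\<close>

lemma block_char_mat_dvd:
  fixes A :: "real^'n^'n"
  assumes A: "block_diag K A" and p: "poly_mat p A ** proj_mat K = 0"
  shows "det (char_mat A ** const_mat (proj_mat K) + const_mat (proj_mat (- K))) dvd p ^ CARD('n)"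
    and "degree (det (char_mat A ** const_mat (proj_mat K) + const_mat (proj_mat (- K)))) \<le> card K"
proof -
  let ?e = "const_mat (proj_mat K)" and ?f = "const_mat (proj_mat (- K))"
  let ?N = "char_mat A ** ?e + ?f"
  have ef: "?e ** ?e = ?e" "?f ** ?f = ?f" "?e ** ?f = 0" "?f ** ?e = 0" "?e + ?f = mat 1"
    using proj_mat_idem[of K] proj_mat_idem(1)[of "- K"]
    by (simp_all add: const_mat_mult[symmetric] const_mat_add[symmetric] const_mat_1)
      (simp_all add: const_mat_def vec_eq_iff)
  obtain R where R: "mat p - const_mat (poly_mat p A) = char_mat A ** R" "R ** ?e = ?e ** R"
    using charpoly_quotient[of p A] A block_diag_iff_commute by blast
  have "?N ** (R ** ?e + ?f) = char_mat A ** R ** ?e + ?f"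
  proof -
    have "char_mat A ** ?e ** (R ** ?e) = char_mat A ** (?e ** R) ** ?e" by (simp add: matrix_mul_assoc)
    also have "\<dots> = char_mat A ** R ** (?e ** ?e)" unfolding R(2)[symmetric] by (simp add: matrix_mul_assoc)
    finally have 1: "char_mat A ** ?e ** (R ** ?e) = char_mat A ** R ** ?e" by (simp add: ef)
    have 2: "char_mat A ** ?e ** ?f = 0" "?f ** (R ** ?e) = 0"
      unfolding R(2) matrix_mul_assoc ef matrix_mul_assoc[symmetric, of "char_mat A" ?e ?f]
      by (simp_all add: matrix_mult_zero ef)
    show ?thesis unfolding matrix_add_ldistrib matrix_add_rdistrib' 1 2 ef by simp
  qed
  also have "\<dots> = mat p ** ?e + ?f"
    using p unfolding R(1)[symmetric]
    by (simp add: matrix_sub_rdistrib const_mat_mult[symmetric]) (simp add: const_mat_def vec_eq_iff)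
  \<comment> \<open>The extra factor completes \<open>mat p ** ?e + ?f\<close> to the scalar matrix
    \<open>mat p\<close>, whose determinant is \<open>p ^ CARD('n)\<close>.\<close>
  finally have "?N ** (R ** ?e + ?f) ** (?e + mat p ** ?f) = (mat p ** ?e + ?f) ** (?e + mat p ** ?f)" by simp
  also have "\<dots> = mat p ** (?e + ?f)"
  proof -
    have "mat p ** ?e ** ?e = mat p ** ?e" "mat p ** ?e ** (mat p ** ?f) = 0" "?f ** (mat p ** ?f) = mat p ** ?f"
    proof -
      show "mat p ** ?e ** ?e = mat p ** ?e" unfolding matrix_mul_assoc[symmetric] ef ..
      have "mat p ** ?e ** (mat p ** ?f) = (mat p ** ?e ** mat p) ** ?f"
        by (rule matrix_mul_assoc)
      also have "mat p ** ?e ** mat p = mat p ** (mat p ** ?e)"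
        by (rule mat_mult_commute[symmetric])
      also have "mat p ** (mat p ** ?e) ** ?f = mat p ** mat p ** (?e ** ?f)" by (simp only: matrix_mul_assoc)
      finally show "mat p ** ?e ** (mat p ** ?f) = 0" by (simp add: ef matrix_mult_zero)
      have "?f ** (mat p ** ?f) = mat p ** (?f ** ?f)"
        by (simp only: matrix_mul_assoc mat_mult_commute[of p ?f, symmetric])
      then show "?f ** (mat p ** ?f) = mat p ** ?f" by (simp add: ef)
    qed
    then show ?thesis unfolding matrix_add_ldistrib matrix_add_rdistrib' by (simp add: ef)
  qed
  finally have "det ?N * det ((R ** ?e + ?f) ** (?e + mat p ** ?f)) = p ^ CARD('n)"
    using det_mul[of ?N "(R ** ?e + ?f) ** (?e + mat p ** ?f)"]
    by (simp add: ef matrix_mul_assoc det_mat)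
  then show "det ?N dvd p ^ CARD('n)" by (metis dvd_triv_left)
  show "degree (det ?N) \<le> card K"
  proof (rule degree_det_le)
    fix i j
    have "(char_mat A ** ?e) $ i $ j = (\<Sum>k\<in>UNIV. if k = j then (if j \<in> K then char_mat A $ i $ j else 0) else 0)"
      unfolding matrix_matrix_mult_def const_mat_def proj_mat_def vec_lambda_beta
      by (rule sum.cong) (auto simp: one_pCons)
    then have 1: "?N $ i $ j = (if j \<in> K then char_mat A $ i $ j else 0) + ?f $ i $ j" by simp
    show "degree (?N $ i $ j) \<le> (if i \<in> K then 1 else 0)"
      unfolding 1 using A by (auto simp: const_mat_def proj_mat_def mat_def block_diag_def one_pCons)
  qed
qed

text \<open>A set \<open>K\<close> is first chosen with as many elements as the rank of
  \<open>e\<close>. The characteristic polynomials of the two blocks multiply to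
  \<open>p1 * p2\<close> and divide powers of \<open>p1\<close> and \<open>p2\<close>; by
  coprimality they divide \<open>p1\<close> and \<open>p2\<close> themselves, and counting degrees
  leaves no slack.\<close>

lemma spectral_idempotent_dim:
  fixes A :: "real^'n^'n"
  assumes chi: "charpoly A = p1 * p2" and cop: "coprime p1 p2"
    and nz: "p1 \<noteq> 0" "p2 \<noteq> 0" and deg: "degree p1 + degree p2 = CARD('n)"
    and e: "e ** e = e" "e ** A = A ** e" "poly_mat p1 A ** e = 0" "poly_mat p2 A ** (mat 1 - e) = 0"
  shows "dim (range ((*v) e)) = degree p1"
proof -
  have "dim (range ((*v) e)) \<le> CARD('n)" using dim_subset_UNIV[of "range ((*v) e)"] by simp
  then obtain K :: "'n set" where K: "card K = dim (range ((*v) e))"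
    using obtain_subset_with_card_n[of "dim (range ((*v) e))" UNIV] by blast
  obtain T S where TS: "T ** S = mat 1" "S ** T = mat 1" and eK: "T ** e ** S = proj_mat K"
    using idempotent_conj_proj_mat[OF e(1) K] .
  have conj: "(T ** X ** S) ** (T ** Y ** S) = T ** (X ** Y) ** S" for X Y
  proof -
    have "(T ** X ** S) ** (T ** Y ** S) = T ** X ** (S ** T) ** Y ** S" by (simp only: matrix_mul_assoc)
    then show ?thesis using TS by (simp add: matrix_mul_assoc)
  qed
  define C where "C = T ** A ** S"
  have bdC: "block_diag K C"
    unfolding block_diag_iff_commute C_def eK[symmetric] conj using e(2) by simp
  have fK: "T ** (mat 1 - e) ** S = proj_mat (- K)"
    using TS eK proj_mat_idem(4)[of K]
    by (simp add: matrix_sub_ldistrib matrix_sub_rdistrib algebra_simps)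
  have p1: "poly_mat p1 C ** proj_mat K = 0" and p2: "poly_mat p2 C ** proj_mat (- K) = 0"
    unfolding C_def poly_mat_conj[OF TS] eK[symmetric] fK[symmetric] conj using e by simp_all
  have chiC: "charpoly C = p1 * p2" unfolding C_def charpoly_conj[OF TS] chi ..
  let ?e = "const_mat (proj_mat K)" and ?f = "const_mat (proj_mat (- K))"
  let ?N1 = "char_mat C ** ?e + ?f" and ?N2 = "char_mat C ** ?f + ?e"
  have ef: "?e ** ?e = ?e" "?f ** ?f = ?f" "?e ** ?f = 0" "?f ** ?e = 0" "?e + ?f = mat 1"
    using proj_mat_idem[of K] proj_mat_idem(1)[of "- K"]
    by (simp_all add: const_mat_mult[symmetric] const_mat_add[symmetric] const_mat_1)
      (simp_all add: const_mat_def vec_eq_iff)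
  have com: "?e ** char_mat C = char_mat C ** ?e"
    using bdC by (simp add: matrix_sub_ldistrib matrix_sub_rdistrib mat_mult_commute block_diag_iff_commute const_mat_mult[symmetric])
  have "?N1 ** ?N2 = char_mat C ** (?e + ?f)"
  proof -
    have 1: "char_mat C ** ?e ** (char_mat C ** ?f) = 0"
    proof -
      have "char_mat C ** ?e ** (char_mat C ** ?f) = char_mat C ** (?e ** char_mat C) ** ?f"
        by (simp only: matrix_mul_assoc)
      also have "\<dots> = char_mat C ** char_mat C ** (?e ** ?f)"
        unfolding com by (simp only: matrix_mul_assoc)
      finally show ?thesis by (simp add: ef matrix_mult_zero)
    qed
    have 2: "?f ** (char_mat C ** ?f) = char_mat C ** ?f"
    proof -
      have "?f = mat 1 - ?e" using ef(5) by (metis add_diff_cancel_left')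
      then have "?f ** char_mat C = char_mat C ** ?f"
        using com by (simp add: matrix_sub_ldistrib[of _ "mat 1"] matrix_sub_rdistrib[of "mat 1"])
      then have "?f ** (char_mat C ** ?f) = char_mat C ** (?f ** ?f)"
        by (simp only: matrix_mul_assoc)
      then show ?thesis by (simp add: ef)
    qed
    have 3: "char_mat C ** ?e ** ?e = char_mat C ** ?e" unfolding matrix_mul_assoc[symmetric] ef ..
    show ?thesis unfolding matrix_add_ldistrib matrix_add_rdistrib' 1 2 3 by (simp add: ef(4) add.commute)
  qed
  then have prod: "det ?N1 * det ?N2 = p1 * p2"
    using det_mul[of ?N1 ?N2] chiC by (simp add: ef charpoly_eq)
  have N1: "det ?N1 dvd p1 ^ CARD('n)" "degree (det ?N1) \<le> card K"
    using block_char_mat_dvd[OF bdC p1] .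
  have N2: "det ?N2 dvd p2 ^ CARD('n)" "degree (det ?N2) \<le> card (- K)"
    using block_char_mat_dvd[of "- K" C p2] bdC p2 by (simp_all add: block_diag_compl)
  have "coprime (det ?N1) p2"
    using N1(1) cop by (meson coprime_divisors coprime_power_left_iff dvd_refl coprime_commute)
  then have d1: "det ?N1 dvd p1"
    using prod by (metis coprime_dvd_mult_left_iff dvd_triv_left)
  have "coprime (det ?N2) p1"
    using N2(1) cop by (meson coprime_divisors coprime_power_left_iff dvd_refl coprime_commute)
  then have d2: "det ?N2 dvd p2"
    using prod by (metis coprime_dvd_mult_right_iff dvd_triv_right)
  have nzN: "det ?N1 \<noteq> 0" "det ?N2 \<noteq> 0" using prod nz by auto
  have "degree (det ?N1) + degree (det ?N2) = degree p1 + degree p2"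
    using arg_cong[OF prod, of degree] nz nzN by (simp add: degree_mult_eq)
  moreover have "card K + card (- K) = CARD('n)"
    by (rule card_add_card_Compl)
  ultimately show ?thesis
    using dvd_imp_degree_le[OF d1 nz(1)] dvd_imp_degree_le[OF d2 nz(2)] N1(2) N2(2) deg K by linarith
qed

text \<open>By Bezout, \<open>b p2\<close> evaluated at \<open>A\<close> is the idempotent whose
  range is the kernel of \<open>p1\<close> at \<open>A\<close>. Being a polynomial in
  \<open>A\<close>, it commutes with everything that commutes with \<open>A\<close>; once it is
  conjugated to the coordinate projection, this gives \<open>separated\<close>.\<close>

lemma matrix_splitting:
  fixes A :: "real^'n^'n" and K :: "'n set"
  assumes chi: "charpoly A = p1 * p2" and cop: "coprime p1 p2"
    and nz: "p1 \<noteq> 0" "p2 \<noteq> 0" and K: "card K = degree p1" "card (- K) = degree p2"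
  obtains T S where "T ** S = mat 1" "S ** T = mat 1" "block_diag K (T ** A ** S)" "separated K (T ** A ** S)"
proof -
  obtain a b where ab: "a * p1 + b * p2 = 1"
    using bezout_coefficients_fst_snd[of p1 p2] cop by (metis coprime_imp_gcd_eq_1)
  define e where "e = poly_mat (b * p2) A"
  have f: "mat 1 - e = poly_mat (a * p1) A"
    using arg_cong[OF ab, of "\<lambda>p. poly_mat p A"] by (simp add: e_def poly_mat_add algebra_simps)
  have p12: "poly_mat (p1 * p2 * q) A = 0" for q
    using cayley_hamilton[of A] chi by (simp add: poly_mat_mult)
  have "e ** (mat 1 - e) = poly_mat (p1 * p2 * (a * b)) A"
    unfolding f unfolding e_def poly_mat_mult[symmetric] by (simp add: mult_ac)
  then have ee: "e ** e = e" by (simp add: p12 matrix_sub_ldistrib)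
  have comm: "X ** poly_mat q A = poly_mat q A ** X" if "X ** A = A ** X" for X q
    using poly_mat_commute[OF that] .
  have eA: "e ** A = A ** e" using comm[of A] by (simp add: e_def)
  have "poly_mat p1 A ** e = poly_mat (p1 * p2 * b) A" "poly_mat p2 A ** (mat 1 - e) = poly_mat (p1 * p2 * a) A"
    unfolding f unfolding e_def poly_mat_mult[symmetric] by (simp_all add: mult_ac)
  then have pe: "poly_mat p1 A ** e = 0" "poly_mat p2 A ** (mat 1 - e) = 0" using p12 by simp_all
  have "card K + card (- K) = CARD('n)" by (rule card_add_card_Compl)
  then have "dim (range ((*v) e)) = degree p1"
    using spectral_idempotent_dim[OF chi cop nz _ ee eA pe] K by simp
  then obtain T S where TS: "T ** S = mat 1" "S ** T = mat 1" and eK: "T ** e ** S = proj_mat K"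
    using idempotent_conj_proj_mat[OF ee, of K] K by metis
  have eK': "proj_mat K = poly_mat (b * p2) (T ** A ** S)"
    unfolding poly_mat_conj[OF TS] eK[symmetric] e_def ..
  have block_diag: "block_diag K C" if "(T ** A ** S) ** C = C ** (T ** A ** S)" for C
    unfolding block_diag_iff_commute eK' using poly_mat_commute[OF that[symmetric]] by simp
  show ?thesis
    using that[OF TS] block_diag unfolding separated_def by blast
qed

subsection \<open>Smooth invariant splittings\<close>

definition dia :: "'n set \<Rightarrow> real^'n^'n \<Rightarrow> real^'n^'n" where
  "dia K M = (\<chi> i j. if (i \<in> K) = (j \<in> K) then M $ i $ j else 0)"

definition off :: "'n set \<Rightarrow> real^'n^'n \<Rightarrow> real^'n^'n" where
  "off K M = (\<chi> i j. if (i \<in> K) = (j \<in> K) then 0 else M $ i $ j)"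

lemma linear_dia: "linear (dia K)" and linear_off: "linear (off K)"
  by (auto simp: linear_iff dia_def off_def vec_eq_iff)

lemma bounded_linear_dia: "bounded_linear (dia K)" and bounded_linear_off: "bounded_linear (off K)"
  using linear_dia linear_off linear_conv_bounded_linear by blast+

lemma dia_add_off: "dia K M + off K M = M"
  by (simp add: dia_def off_def vec_eq_iff)

lemma dia_off [simp]: "dia K (off K M) = 0" and off_dia [simp]: "off K (dia K M) = 0"
  and off_off [simp]: "off K (off K M) = off K M" and dia_dia [simp]: "dia K (dia K M) = dia K M"
  by (auto simp: dia_def off_def vec_eq_iff)

lemma block_diag_iff_off: "block_diag K M \<longleftrightarrow> off K M = 0"
  by (auto simp: block_diag_def off_def vec_eq_iff)

lemma block_diag_dia: "block_diag K (dia K M)"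
  by (simp add: block_diag_iff_off)

lemma block_diag_add: "block_diag K A \<Longrightarrow> block_diag K B \<Longrightarrow> block_diag K (A + B)"
  by (simp add: block_diag_def)

lemma block_diag_mult_off: "block_diag K A \<Longrightarrow> dia K B = 0 \<Longrightarrow> dia K (A ** B) = 0"
  and off_mult_block_diag: "block_diag K A \<Longrightarrow> dia K B = 0 \<Longrightarrow> dia K (B ** A) = 0"
  and off_mult_off: "dia K B = 0 \<Longrightarrow> dia K C = 0 \<Longrightarrow> block_diag K (B ** C)"
  unfolding block_diag_def dia_def vec_eq_iff matrix_matrix_mult_def
  by (auto intro!: sum.neutral split: if_splits) metis+

lemma off_proj:
  assumes "dia K N = 0" "proj K h = h"
  shows "proj K (N *v h) = 0"
proof -
  have N: "N $ i $ j = 0" if "(i \<in> K) = (j \<in> K)" for i j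
    using arg_cong[OF assms(1), of "\<lambda>M. M $ i $ j"] that by (simp add: dia_def)
  have h: "h $ j = 0" if "j \<notin> K" for j using assms(2) that by (simp add: proj_eq_self_iff)
  have "N $ i $ j * h $ j = 0" if "i \<in> K" for i j using N h that by (cases "j \<in> K") auto
  then have "(N *v h) $ i = 0" if "i \<in> K" for i
    using that unfolding matrix_vector_mult_def vec_lambda_beta by (intro sum.neutral) blast
  then show ?thesis by (simp add: vec_eq_iff)
qed

lemma dia_compl: "dia (- K) M = dia K M"
  by (simp add: dia_def)

text \<open>The commutator on off-diagonal matrices, completed by the identity on diagonal ones. As
  an endomorphism of the whole matrix space it is invertible once it is injective.\<close>

definition sylv :: "'n set \<Rightarrow> real^'n^'n \<Rightarrow> real^'n^'n \<Rightarrow> real^'n^'n" where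
  "sylv K M N = dia K N + off K (M ** N - N ** M)"

lemma linear_mult_left: "linear (\<lambda>N. M ** N)" and linear_mult_right: "linear (\<lambda>N. N ** M)"
  for M :: "real^'n^'n"
  using bounded_bilinear_matrix_matrix_mult bounded_bilinear.bounded_linear_left bounded_bilinear.bounded_linear_right
    bounded_linear.linear by blast+

lemma linear_sylv: "linear (sylv K M)"
  unfolding sylv_def[abs_def]
  by (intro linear_compose_add linear_dia linear_compose[OF _ linear_off, unfolded o_def]
      linear_compose_sub linear_mult_left linear_mult_right)

text \<open>Commutation with a block diagonal \<open>M\<close> splits into the diagonal and the
  off-diagonal part, so the kernel of \<open>sylv K M\<close> consists of the off-diagonal matrices
  commuting with \<open>M\<close>.\<close>

lemma sylv_inj_iff:
  assumes M: "block_diag K M"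
  shows "inj (sylv K M) \<longleftrightarrow> separated K M"
proof
  assume inj: "inj (sylv K M)"
  show "separated K M"
    unfolding separated_def
  proof (intro allI impI)
    fix C assume C: "M ** C = C ** M"
    have d: "block_diag K (dia K C ** M - M ** dia K C)"
      using M block_diag_dia[of K C] by (auto simp: block_diag_iff matrix_vector_mult_diff_rdistrib matrix_vector_mul_assoc[symmetric] proj_diff)
    have "M ** off K C - off K C ** M = dia K C ** M - M ** dia K C"
    proof -
      have "M ** (dia K C + off K C) = (dia K C + off K C) ** M" using C by (simp add: dia_add_off)
      then show ?thesis
        by (simp add: linear_add[OF linear_mult_left] linear_add[OF linear_mult_right] algebra_simps)
    qed
    then have "sylv K M (off K C) = 0"
      using d by (simp add: sylv_def block_diag_iff_off)
    then have "off K C = 0" using inj linear_injective_0[OF linear_sylv] by blast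
    then show "block_diag K C" by (simp add: block_diag_iff_off)
  qed
next
  assume sep: "separated K M"
  show "inj (sylv K M)"
    unfolding linear_injective_0[OF linear_sylv]
  proof (intro allI impI)
    fix N assume N: "sylv K M N = 0"
    have "dia K (sylv K M N) = dia K N" by (simp add: sylv_def linear_add[OF linear_dia])
    then have 1: "dia K N = 0" using N by (simp add: linear_0[OF linear_dia])
    then have "off K (M ** N - N ** M) = 0" using N by (simp add: sylv_def)
    moreover have "dia K (M ** N - N ** M) = 0"
      using block_diag_mult_off[OF M 1] off_mult_block_diag[OF M 1] by (simp add: linear_diff[OF linear_dia])
    ultimately have "M ** N - N ** M = 0" using dia_add_off[of K "M ** N - N ** M"] by simp
    then have "off K N = 0" using sep by (simp add: separated_def block_diag_iff_off)
    then show "N = 0" using 1 dia_add_off[of K N] by simp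
  qed
qed

text \<open>An injective linear map is bounded below by some \<open>c\<close>, and this survives
  perturbations of norm below \<open>c / C\<close>, where \<open>C\<close> bounds the commutator as
  a bilinear map.\<close>

lemma separated_nearby:
  assumes M0: "block_diag K M0" "separated K M0"
  obtains e where "e > 0" "\<And>M. block_diag K M \<Longrightarrow> norm (M - M0) < e \<Longrightarrow> separated K M"
proof -
  have "inj (sylv K M0)" using M0 sylv_inj_iff by blast
  then obtain c where c: "c > 0" "\<And>N. c * norm N \<le> norm (sylv K M0 N)"
    using linear_inj_bounded_below_pos[OF linear_sylv] by blast
  have "bounded_bilinear (\<lambda>X N. off K (X ** N - N ** X))"
    unfolding bilinear_conv_bounded_bilinear[symmetric] bilinear_def
    by (intro conjI allI linear_compose[OF _ linear_off, unfolded o_def]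
      linear_compose_sub linear_mult_left linear_mult_right)
  then obtain C where C: "C > 0" "\<And>X N. norm (off K (X ** N - N ** X)) \<le> norm X * norm N * C"
    using bounded_bilinear.pos_bounded by blast
  show ?thesis
  proof (rule that[of "c / C"])
    show "c / C > 0" using c C by simp
    fix M assume M: "block_diag K M" "norm (M - M0) < c / C"
    have "inj (sylv K M)"
      unfolding linear_injective_0[OF linear_sylv]
    proof (intro allI impI, rule ccontr)
      fix N assume N: "sylv K M N = 0" "N \<noteq> 0"
      have "sylv K M N - sylv K M0 N = off K ((M - M0) ** N - N ** (M - M0))"
        by (simp add: sylv_def linear_diff[OF linear_off] linear_diff[OF linear_mult_left] linear_diff[OF linear_mult_right])
      then have "norm (sylv K M0 N) = norm (off K ((M - M0) ** N - N ** (M - M0)))"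
        using N(1) by (metis diff_0 norm_minus_cancel)
      also have "\<dots> \<le> norm (M - M0) * norm N * C" by (rule C(2))
      also have "\<dots> < c * norm N"
        using M(2) N(2) C(1) by (simp add: pos_less_divide_eq mult.commute mult.left_commute)
      finally show False using c(2)[of N] by simp
    qed
    then show "separated K M" using M(1) sylv_inj_iff by blast
  qed
qed

text \<open>The invariant complementary subspaces are graphs over the coordinate subspaces: with the
  off-diagonal unknown \<open>N\<close> and \<open>G = 1 + N\<close>, the equation \<open>L G = G M\<close> with \<open>M\<close> block diagonal is
  the Riccati equation \<open>L\<^sub>o + L\<^sub>d N - N L\<^sub>d - N L\<^sub>o N = 0\<close>.\<close>
lemma smooth_splitting:
  fixes L :: "real^'n \<Rightarrow> real^'n^'n"
  assumes W: "open W" "0 \<in> W" and L: "smooth_on W L" and L0: "block_diag K (L 0)" "separated K (L 0)"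
  obtains Q G M where "open Q" "0 \<in> Q" "Q \<subseteq> W" "smooth_on Q G" "smooth_on Q M" "G 0 = mat 1"
    "\<And>z. z \<in> Q \<Longrightarrow> L z ** G z = G z ** M z" "\<And>z. z \<in> Q \<Longrightarrow> block_diag K (M z)"
    "\<And>z. z \<in> Q \<Longrightarrow> separated K (M z)" "\<And>z. z \<in> Q \<Longrightarrow> invertible (G z)"
    "\<And>z h. z \<in> Q \<Longrightarrow> proj K h = h \<Longrightarrow> proj K (G z *v h) = h"
    "\<And>z h. z \<in> Q \<Longrightarrow> proj (- K) h = h \<Longrightarrow> proj (- K) (G z *v h) = h"
proof -
  \<comment> \<open>With \<open>P = 0\<close> every \<open>\<sigma> s\<close> is the identity and
    the equation reads \<open>f x = H (x, f x)\<close>: an implicit function theorem.\<close>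
  interpret shrinking "\<lambda>_ :: real^'n. 0"
    by (rule shrinking.intro) simp_all
  have \<sigma>: "\<sigma> s x = x" for s x by (simp add: \<sigma>_def)
  obtain T where T: "linear T" "\<And>N. T (sylv K (L 0) N) = N" "\<And>N. sylv K (L 0) (T N) = N"
  proof -
    have "inj (sylv K (L 0))" using L0 sylv_inj_iff by blast
    from linear_injective_isomorphism[OF linear_sylv this] show ?thesis using that by blast
  qed
  have blT: "bounded_linear T" using T(1) linear_conv_bounded_linear by blast
  \<comment> \<open>The off-diagonal part of the Riccati expression plus \<open>dia K N\<close>, so
    that zeros are automatically off-diagonal. At the origin this is exactly the linear map
    \<open>sylv K (L 0)\<close>, with inverse \<open>T\<close>; hence \<open>H\<close> vanishes
    identically in \<open>N\<close> there, as \<open>fixpoint_local\<close> requires.\<close>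
  define R where "R p = dia K (snd p) + off K (off K (L (fst p)) + dia K (L (fst p)) ** snd p
    - snd p ** dia K (L (fst p)) - snd p ** off K (L (fst p)) ** snd p)" for p
  define H where "H p = snd p - T (R p)" for p
  let ?Q = "W \<times> (UNIV :: (real^'n^'n) set)"
  have oQ: "open ?Q" using W(1) by (simp add: open_Times)
  have smH: "smooth_on ?Q H"
  proof -
    have "smooth_on ?Q (\<lambda>p. L (fst p))"
      by (rule smooth_on_compose[OF oQ W(1) _ L]) (auto intro!: smooth_on_linear oQ bounded_linear_fst)
    then have l: "smooth_on ?Q (\<lambda>p. dia K (L (fst p)))" "smooth_on ?Q (\<lambda>p. off K (L (fst p)))"
      using smooth_on_linear_compose[OF oQ] bounded_linear_dia bounded_linear_off by blast+
    have s: "smooth_on ?Q snd" by (rule smooth_on_linear[OF oQ bounded_linear_snd])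
    note m = smooth_on_matrix_mult[OF oQ]
    have "smooth_on ?Q (\<lambda>p. off K (L (fst p)) + dia K (L (fst p)) ** snd p
        - snd p ** dia K (L (fst p)) - snd p ** off K (L (fst p)) ** snd p)"
      by (intro smooth_on_diff smooth_on_add m l s oQ)
    from smooth_on_linear_compose[OF oQ bounded_linear_off this]
    have "smooth_on ?Q R"
      unfolding R_def[abs_def] by (intro smooth_on_add smooth_on_linear_compose[OF oQ bounded_linear_dia] s oQ)
    then show ?thesis
      unfolding H_def[abs_def] by (intro smooth_on_diff smooth_on_linear_compose[OF oQ blT] s oQ)
  qed
  have H0: "H (0, N) = 0" for N
  proof -
    have "dia K (L 0) = L 0" using L0(1) dia_add_off[of K "L 0"] by (simp add: block_diag_iff_off)
    then have "R (0, N) = sylv K (L 0) N" using L0(1) by (simp add: R_def sylv_def block_diag_iff_off matrix_matrix_mult_def zero_vec_def[symmetric])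
    then show ?thesis by (simp add: H_def T)
  qed
  have DH0: "fderiv H (0, 0) (0, k) = 0" for k
  proof -
    have "((\<lambda>N. H (0, N)) has_derivative (\<lambda>k. fderiv H (0, 0) (0, k))) (at 0)"
      using smooth_on_has_derivative[OF smH, of "(0, 0)"] W(2)
      by (auto intro!: derivative_eq_intros has_derivative_compose[of "\<lambda>N. (0, N)" _ 0 UNIV H])
    moreover have "((\<lambda>N. H (0, N)) has_derivative (\<lambda>k. 0)) (at 0)" by (simp add: H0)
    ultimately have "(\<lambda>k. fderiv H (0, 0) (0, k)) = (\<lambda>k. 0)"
      by (rule has_derivative_unique)
    then show ?thesis by meson
  qed
  obtain d f where d: "d > 0" and f: "smooth_on (ball 0 d) f" and f0: "f 0 = 0"
    and inQ: "\<And>s x. s \<in> {0..1} \<Longrightarrow> x \<in> ball 0 d \<Longrightarrow> (x, f (\<sigma> s x)) \<in> ?Q"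
    and eq: "\<And>x. x \<in> ball 0 d \<Longrightarrow> ((\<lambda>s. H (x, f (\<sigma> s x))) has_integral f x) {0..1}"
    by (rule fixpoint_local[of ?Q H]) (use oQ W smH H0 DH0 in auto)
  have dW: "x \<in> W" if "x \<in> ball 0 d" for x using inQ[of 1 x] that by simp
  have Rf: "R (x, f x) = 0" if x: "x \<in> ball 0 d" for x
  proof -
    have "f x = H (x, f x)" using integral_unique[OF eq[OF x]] by (simp add: \<sigma>)
    then have "T (R (x, f x)) = 0" by (simp add: H_def)
    then show ?thesis using T(3)[of "R (x, f x)"] by (simp add: linear_0[OF linear_sylv])
  qed
  let ?d = "\<lambda>x. dia K (L x)" and ?o = "\<lambda>x. off K (L x)"
  have dia_f: "dia K (f x) = 0" if x: "x \<in> ball 0 d" for x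
  proof -
    have "dia K (R (x, f x)) = dia K (f x)" by (simp add: R_def linear_add[OF linear_dia])
    then show ?thesis using Rf[OF x] by (simp add: linear_0[OF linear_dia])
  qed
  have riccati: "?o x + ?d x ** f x - f x ** ?d x - f x ** ?o x ** f x = 0" (is "?X x = 0") if x: "x \<in> ball 0 d" for x
  proof -
    \<comment> \<open>For off-diagonal \<open>f x\<close> the whole Riccati expression is
      off-diagonal, so its off-diagonal part carries the full equation.\<close>
    note n = dia_f[OF x]
    have "dia K (f x ** ?o x ** f x) = 0" by (rule block_diag_mult_off[OF off_mult_off n]) (simp_all add: n)
    then have "dia K (?X x) = 0"
      using block_diag_mult_off[OF block_diag_dia n, of "L x"] off_mult_block_diag[OF block_diag_dia n, of "L x"]
      by (simp add: linear_diff[OF linear_dia] linear_add[OF linear_dia])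
    moreover have "off K (?X x) = 0" using Rf[OF x] n by (simp add: R_def)
    ultimately show ?thesis using dia_add_off[of K "?X x"] by simp
  qed
  define G where "G x = mat 1 + f x" for x
  define M where "M x = ?d x + ?o x ** f x" for x
  have smL: "smooth_on (ball 0 d) L" by (rule smooth_on_subset[OF L]) (use dW in blast)
  have smG: "smooth_on (ball 0 d) G"
    unfolding G_def[abs_def] by (intro smooth_on_add smooth_on_const f open_ball)
  have smM: "smooth_on (ball 0 d) M"
    unfolding M_def[abs_def]
    by (intro smooth_on_add smooth_on_matrix_mult smooth_on_linear_compose[OF open_ball bounded_linear_dia]
        smooth_on_linear_compose[OF open_ball bounded_linear_off] smL f open_ball)
  have LG: "L x ** G x = G x ** M x" if x: "x \<in> ball 0 d" for x
  proof -
    have "L x ** G x = (?d x + ?o x) + (?d x ** f x + ?o x ** f x)"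
      using linear_add[OF linear_mult_right[of "f x"], of "?d x" "?o x"]
      by (simp add: G_def matrix_add_ldistrib dia_add_off)
    moreover have "G x ** M x = ?d x + ?o x ** f x + (f x ** ?d x + f x ** (?o x ** f x))"
      using linear_add[OF linear_mult_right[of "M x"], of "mat 1" "f x"]
      by (simp add: G_def) (simp add: M_def matrix_add_ldistrib)
    ultimately show ?thesis using riccati[OF x] by (simp add: matrix_mul_assoc algebra_simps)
  qed
  have bdM: "block_diag K (M x)" if "x \<in> ball 0 d" for x
    unfolding M_def by (intro block_diag_add block_diag_dia off_mult_off) (simp_all add: dia_f[OF that])
  have M0: "M 0 = L 0" using L0(1) dia_add_off[of K "L 0"] by (simp add: M_def f0 block_diag_iff_off matrix_matrix_mult_def zero_vec_def[symmetric])
  obtain e where e: "e > 0" "\<And>X. block_diag K X \<Longrightarrow> norm (X - L 0) < e \<Longrightarrow> separated K X"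
    using separated_nearby[OF L0] by blast
  \<comment> \<open>Two open conditions that hold at 0 are preserved by shrinking:
    \<open>M z\<close> stays separated because \<open>M 0 = L 0\<close>, and \<open>G z\<close>
    stays invertible because \<open>G 0\<close> is the identity.\<close>
  define Q where "Q = (ball 0 d \<inter> M -` ball (L 0) e) \<inter> (ball 0 d \<inter> (\<lambda>x. det (G x)) -` (- {0}))"
  have contdet: "continuous_on (ball 0 d) (\<lambda>x. det (G x))"
  proof -
    have "C_diff_on 0 (ball 0 d) G" using smG smooth_on_def by blast
    then have "C_diff_on 0 (ball 0 d) (\<lambda>x. det (G x))"
      by (intro C_diff_on_det C_diff_on_vec_nth open_ball)
    then show ?thesis by simp
  qed
  have "open Q"
    unfolding Q_def
    by (intro open_Int continuous_open_preimage smooth_on_continuous[OF smM] contdet open_ball) auto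
  moreover have "0 \<in> Q" using d e(1) by (simp add: Q_def M0 G_def f0)
  moreover have sub: "Q \<subseteq> ball 0 d" by (auto simp: Q_def)
  moreover have "Q \<subseteq> W" using sub dW by blast
  moreover have "separated K (M z)" if "z \<in> Q" for z
    using that bdM[of z] e(2)[of "M z"] by (auto simp: Q_def dist_norm norm_minus_commute)
  moreover have "invertible (G z)" if "z \<in> Q" for z using that by (simp add: Q_def invertible_det_nz)
  moreover have "proj J (G z *v h) = h" if "z \<in> Q" "proj J h = h" "J = K \<or> J = - K" for J z h
  proof -
    have "dia J (f z) = 0" using dia_f[of z] that sub by (auto simp: dia_compl)
    from off_proj[OF this that(2)] show ?thesis
      using that(2) by (simp add: G_def matrix_vector_mult_add_rdistrib proj_add)
  qed
  ultimately show ?thesis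
    using that[of Q G M] LG bdM smooth_on_subset[OF smG] smooth_on_subset[OF smM]
    by (simp add: G_def f0 subset_iff)
qed

subsection \<open>Coordinate changes and the splitting theorem\<close>

lemma is_chart_inj_on:
  assumes "is_chart X c"
  shows "inj_on (snd c) (fst c)"
  using assms homeomorphic_imp_injective_map[of "subtopology X (fst c)"] openin_subset[of X "fst c"]
  unfolding is_chart_def by (metis topspace_subtopology_subset)

lemma is_chart_openin_image:
  assumes c: "is_chart X c" and U: "U \<subseteq> fst c"
  shows "openin X U \<longleftrightarrow> open (snd c ` U)"
proof -
  have c': "openin X (fst c)" "open (snd c ` fst c)"
    "homeomorphic_map (subtopology X (fst c)) (top_of_set (snd c ` fst c)) (snd c)"
    using c by (simp_all add: is_chart_def)
  have "topspace (subtopology X (fst c)) = fst c"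
    using openin_subset[OF c'(1)] by (simp add: Int_absorb1)
  then have "openin (top_of_set (snd c ` fst c)) (snd c ` U) \<longleftrightarrow> openin (subtopology X (fst c)) U"
    using homeomorphic_map_openness[OF c'(3), of U] U by simp
  then show ?thesis
    using U by (simp add: openin_open_subtopology[OF c'(1)] openin_open_eq[OF c'(2)] image_mono)
qed

definition restrict_chart :: "('a, 'n) chart \<Rightarrow> (real^'n) set \<Rightarrow> (real^'n \<Rightarrow> real^'n) \<Rightarrow> ('a, 'n) chart" where
  "restrict_chart c N \<phi> = ({q \<in> fst c. snd c q \<in> N}, \<phi> \<circ> snd c)"

lemma image_restrict_chart:
  assumes "N \<subseteq> snd c ` fst c"
  shows "snd c ` fst (restrict_chart c N \<phi>) = N" "snd (restrict_chart c N \<phi>) ` fst (restrict_chart c N \<phi>) = \<phi> ` N"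
proof -
  show "snd c ` fst (restrict_chart c N \<phi>) = N" using assms by (auto simp: restrict_chart_def)
  then show "snd (restrict_chart c N \<phi>) ` fst (restrict_chart c N \<phi>) = \<phi> ` N"
    using image_comp[of \<phi> "snd c" "fst (restrict_chart c N \<phi>)"] by (simp add: restrict_chart_def)
qed

lemma is_chart_restrict_chart:
  assumes c: "is_chart X c" and N: "open N" "N \<subseteq> snd c ` fst c" and V: "open V" "homeomorphism N V \<phi> \<psi>"
  shows "is_chart X (restrict_chart c N \<phi>)"
proof -
  let ?c = "restrict_chart c N \<phi>"
  have sub: "fst ?c \<subseteq> fst c" by (auto simp: restrict_chart_def)
  have im: "snd c ` fst ?c = N" "snd ?c ` fst ?c = V"
    using image_restrict_chart[OF N(2)] V(2) by (auto simp: homeomorphism_def)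
  have op: "openin X (fst ?c)" using is_chart_openin_image[OF c sub] N(1) im by simp
  have ts: "topspace (subtopology X (fst c)) = fst c" "topspace (subtopology X (fst ?c)) = fst ?c"
    using c op openin_subset by (auto simp: is_chart_def)
  have "homeomorphic_map (subtopology X (fst c)) (top_of_set (snd c ` fst c)) (snd c)"
    using c by (simp add: is_chart_def)
  from homeomorphic_map_subtopologies[OF this, of "fst ?c" N]
  have "homeomorphic_map (subtopology (subtopology X (fst c)) (fst ?c)) (subtopology (top_of_set (snd c ` fst c)) N) (snd c)"
    using ts(1) sub im(1) N(2) by (simp add: Int_absorb1)
  then have 1: "homeomorphic_map (subtopology X (fst ?c)) (top_of_set N) (snd c)"
    using sub N(2) by (simp add: subtopology_subtopology Int_absorb1)
  have "homeomorphic_maps (top_of_set N) (top_of_set V) \<phi> \<psi>"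
    using V(2) by (auto simp: homeomorphic_maps_def homeomorphism_def)
  then have 2: "homeomorphic_map (top_of_set N) (top_of_set V) \<phi>" using homeomorphic_map_maps by blast
  have "homeomorphic_map (subtopology X (fst ?c)) (top_of_set V) (snd ?c)"
    using homeomorphic_map_compose[OF 1 2] by (simp add: restrict_chart_def)
  then show ?thesis using op V(1) im(2) by (simp add: is_chart_def)
qed

lemma transition_eq:
  assumes "is_chart X c" "q \<in> fst c"
  shows "transition c d (snd c q) = snd d q"
  using inv_into_f_f[OF is_chart_inj_on[OF assms(1)] assms(2)] by (simp add: transition_def)

text \<open>Membership in the maximal atlas asks for smooth transitions to the charts of
  \<open>\<A>\<close>; those of the new chart are the old ones composed with \<open>\<psi>\<close>
  on one side or with \<open>\<phi>\<close> on the other.\<close>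

lemma restrict_chart_coordinate_system:
  fixes c :: "('a, 'n::finite) chart"
  assumes man: "smooth_manifold X \<A>" and c: "c \<in> coordinate_systems X \<A>"
    and N: "open N" "N \<subseteq> snd c ` fst c" and V: "open V" "homeomorphism N V \<phi> \<psi>"
    and sm: "smooth_on N \<phi>" "smooth_on V \<psi>"
  shows "restrict_chart c N \<phi> \<in> coordinate_systems X \<A>"
proof -
  let ?c = "restrict_chart c N \<phi>"
  have chart: "is_chart X c" "is_chart X ?c"
    using c is_chart_restrict_chart[OF _ N V] by (auto simp: coordinate_systems_def)
  have sub: "fst ?c \<subseteq> fst c" by (auto simp: restrict_chart_def)
  have hom: "\<phi> x \<in> V" "\<psi> (\<phi> x) = x" if "x \<in> N" for x
    using V(2) that by (auto simp: homeomorphism_def)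
  have cq: "snd c q \<in> N" "snd ?c q = \<phi> (snd c q)" if "q \<in> fst ?c" for q
    using that by (auto simp: restrict_chart_def)
  have "compatible ?c d" if d: "d \<in> \<A>" for d
  proof -
    have dchart: "is_chart X d" using man d by (simp add: smooth_manifold_def)
    have comp: "smooth_on (snd c ` (fst c \<inter> fst d)) (transition c d)"
        "smooth_on (snd d ` (fst c \<inter> fst d)) (transition d c)"
      using c d by (auto simp: coordinate_systems_def compatible_def)
    have opens: "openin X (fst c \<inter> fst d)" "openin X (fst ?c \<inter> fst d)"
      using chart dchart by (auto simp: is_chart_def)
    have o: "open (snd c ` (fst c \<inter> fst d))" "open (snd ?c ` (fst ?c \<inter> fst d))" "open (snd d ` (fst ?c \<inter> fst d))"
      using is_chart_openin_image[OF chart(1), of "fst c \<inter> fst d"] is_chart_openin_image[OF chart(2), of "fst ?c \<inter> fst d"]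
        is_chart_openin_image[OF dchart, of "fst ?c \<inter> fst d"] opens by auto
    have s1: "smooth_on (snd ?c ` (fst ?c \<inter> fst d)) (\<lambda>y. transition c d (\<psi> y))"
    proof (rule smooth_on_compose[OF o(2) o(1) _ comp(1)])
      show "smooth_on (snd ?c ` (fst ?c \<inter> fst d)) \<psi>"
        by (rule smooth_on_subset[OF sm(2)]) (use cq hom in auto)
      show "\<psi> ` snd ?c ` (fst ?c \<inter> fst d) \<subseteq> snd c ` (fst c \<inter> fst d)"
        using cq hom sub by auto
    qed
    have e1: "transition c d (\<psi> y) = transition ?c d y" if y: "y \<in> snd ?c ` (fst ?c \<inter> fst d)" for y
    proof -
      obtain q where q: "q \<in> fst ?c" "y = snd ?c q" using y by blast
      have "transition c d (\<psi> y) = transition c d (snd c q)" using q cq[OF q(1)] hom by simp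
      then show ?thesis
        using transition_eq[OF chart(1), of q d] transition_eq[OF chart(2) q(1), of d] q sub by auto
    qed
    note 1 = smooth_on_cong[OF o(2) e1 s1]
    have td: "transition d e (snd d q) = snd e q" if "q \<in> fst d" for e :: "('a, 'n) chart" and q
      using transition_eq[OF dchart that] .
    have s2: "smooth_on (snd d ` (fst ?c \<inter> fst d)) (\<lambda>y. \<phi> (transition d c y))"
    proof (rule smooth_on_compose[OF o(3) N(1) _ sm(1)])
      show "smooth_on (snd d ` (fst ?c \<inter> fst d)) (transition d c)"
        by (rule smooth_on_subset[OF comp(2)]) (use sub in auto)
      show "transition d c ` snd d ` (fst ?c \<inter> fst d) \<subseteq> N"
        using td[of _ c] cq(1) by auto
    qed
    have e2: "\<phi> (transition d c y) = transition d ?c y" if y: "y \<in> snd d ` (fst ?c \<inter> fst d)" for y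
    proof -
      obtain q where q: "q \<in> fst ?c" "q \<in> fst d" "y = snd d q" using y by blast
      then show ?thesis using td[of q c] td[of q ?c] cq(2) by simp
    qed
    note 2 = smooth_on_cong[OF o(3) e2 s2]
    show ?thesis using 1 2 by (simp add: compatible_def)
  qed
  then show ?thesis using chart by (simp add: coordinate_systems_def)
qed

lemma operator_field_restrict_chart:
  fixes c :: "('a, 'n::finite) chart"
  assumes L: "operator_field X \<A> L" and c: "c \<in> coordinate_systems X \<A>"
    and c': "restrict_chart c N \<phi> \<in> coordinate_systems X \<A>"
    and N: "open N" "N \<subseteq> snd c ` fst c" and z: "z \<in> N"
  shows "L (restrict_chart c N \<phi>) (\<phi> z) ** matrix (fderiv \<phi> z)
    = matrix (fderiv \<phi> z) ** L c z"
proof -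
  let ?c = "restrict_chart c N \<phi>"
  have chart: "is_chart X c" using c by (simp add: coordinate_systems_def)
  have tr: "transition c ?c y = \<phi> y" if y: "y \<in> N" for y
  proof -
    obtain q where q: "q \<in> fst c" "y = snd c q" using y N(2) by blast
    then show ?thesis using transition_eq[OF chart q(1), of ?c] by (simp add: restrict_chart_def)
  qed
  have "fst c \<inter> fst ?c = fst ?c" by (auto simp: restrict_chart_def)
  then have "z \<in> snd c ` (fst c \<inter> fst ?c)" using image_restrict_chart(1)[OF N(2)] z by simp
  then have "L ?c (transition c ?c z) ** matrix (fderiv (transition c ?c) z)
      = matrix (fderiv (transition c ?c) z) ** L c z"
    using L c c' unfolding operator_field_def Let_def by blast
  moreover have "fderiv (transition c ?c) z = fderiv \<phi> z"
    by (rule frechet_derivative_cong_open[OF N(1) z tr])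
  ultimately show ?thesis by (simp add: tr[OF z])
qed

text \<open>Conjugation transports the commutant along with the operator, and conjugation by the
  block diagonal \<open>H\<close> preserves block diagonality.\<close>

lemma block_diag_separated_conj:
  fixes H :: "real^'n^'n"
  assumes H: "block_diag K H" "invertible H" and LH: "L ** H = H ** M" and M: "block_diag K M" "separated K M"
  shows "block_diag K L" "separated K L"
proof -
  note i = matrix_inv_mult[OF H(2)]
  have iv: "H *v (matrix_inv H *v v) = v" "matrix_inv H *v (H *v v) = v" for v
    using i by (simp_all add: matrix_vector_mul_assoc)
  have Li: "L *v v = H *v (M *v (matrix_inv H *v v))" for v
    using LH iv by (metis matrix_vector_mul_assoc)
  have bdi: "proj K (matrix_inv H *v v) = matrix_inv H *v proj K v" for v
    using block_diag_proj[OF H(1)] iv by metis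
  show "block_diag K L"
    unfolding block_diag_iff Li using block_diag_proj[OF H(1)] block_diag_proj[OF M(1)] bdi by simp
  show "separated K L"
    unfolding separated_def
  proof (intro allI impI)
    fix C assume "L ** C = C ** L"
    then have LC: "L *v (C *v v) = C *v (L *v v)" for v by (metis matrix_vector_mul_assoc)
    let ?C = "matrix_inv H ** C ** H"
    have LHv: "L *v (H *v v) = H *v (M *v v)" for v using LH by (metis matrix_vector_mul_assoc)
    have "M *v (?C *v v) = ?C *v (M *v v)" for v
    proof -
      have "H *v (M *v (?C *v v)) = L *v (C *v (H *v v))"
        by (simp add: LHv[symmetric] matrix_vector_mul_assoc[symmetric] iv)
      also have "\<dots> = H *v (?C *v (M *v v))"
        by (simp add: LC LHv matrix_vector_mul_assoc[symmetric] iv)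
      finally show ?thesis using iv(2) by metis
    qed
    then have "M ** ?C = ?C ** M" by (simp add: matrix_eq matrix_vector_mul_assoc[symmetric])
    then have "block_diag K ?C" using M(2) by (simp add: separated_def)
    then have bdC: "proj K (?C *v v) = ?C *v proj K v" for v by (simp add: block_diag_iff)
    have "proj K (C *v v) = C *v proj K v" for v
    proof -
      have C: "C *v w = H *v (?C *v (matrix_inv H *v w))" for w
        by (simp add: matrix_vector_mul_assoc[symmetric] iv)
      show ?thesis unfolding C block_diag_proj[OF H(1)] bdC bdi ..
    qed
    then show "block_diag K C" by (simp add: block_diag_iff)
  qed
qed

text \<open>Membership in a cube is tested coordinate by coordinate, so \<open>glue\<close> cannot
  leave it. The half-edge \<open>r / CARD('n)\<close> comes from bounding the norm by the sum of the
  absolute values of the coordinates.\<close>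

lemma ex_cube:
  fixes V :: "(real^'n) set"
  assumes V: "open V" "0 \<in> V"
  obtains C where "open C" "0 \<in> C" "C \<subseteq> V" "\<And>x y J. x \<in> C \<Longrightarrow> y \<in> C \<Longrightarrow> glue J x y \<in> C"
proof -
  obtain r where r: "r > 0" "ball 0 r \<subseteq> V" using V openE by blast
  define e where "e = r / CARD('n)"
  have e: "e > 0" using r by (simp add: e_def)
  define C where "C = (\<Inter>i\<in>UNIV. {x :: real^'n. \<bar>x $ i\<bar> < e})"
  show ?thesis
  proof (rule that[of C])
    show "open C" unfolding C_def
      by (intro open_INT ballI open_Collect_less continuous_intros) auto
    show "0 \<in> C" using e by (simp add: C_def)
    show "C \<subseteq> V"
    proof
      fix x assume x: "x \<in> C"
      have "norm x \<le> (\<Sum>i\<in>UNIV. \<bar>x $ i\<bar>)" by (rule norm_le_l1_cart)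
      also have "\<dots> < (\<Sum>i\<in>(UNIV::'n set). e)"
        by (rule sum_strict_mono) (use x in \<open>auto simp: C_def\<close>)
      also have "\<dots> = r" by (simp add: e_def)
      finally show "x \<in> V" using r by auto
    qed
    show "glue J x y \<in> C" if "x \<in> C" "y \<in> C" for x y J
      using that by (auto simp: C_def glue_def)
  qed
qed

text \<open>The roles are crossed: \<open>g1\<close> straightens the distribution belonging to
  \<open>K\<close>, so its components outside \<open>K\<close> are constant along it and serve as
  the coordinates \<open>v\<close>; likewise \<open>g2\<close> provides \<open>u\<close>. The
  derivative of \<open>\<phi>\<close> then sends each distribution into its own group of coordinate
  directions.\<close>

lemma ex_splitting_diffeomorphism:
  fixes G :: "real^'n \<Rightarrow> real^'n^'n"
  assumes Q: "open Q" "0 \<in> Q" and G: "smooth_on Q G" "G 0 = mat 1"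
    and comm: "\<And>z h k J. z \<in> Q \<Longrightarrow> J = K \<or> J = - K \<Longrightarrow> proj J h = h \<Longrightarrow> proj J k = k \<Longrightarrow>
      fderiv G z (G z *v h) *v k = fderiv G z (G z *v k) *v h"
  obtains N C \<phi> \<psi> where "open N" "0 \<in> N" "N \<subseteq> Q" "open C" "homeomorphism N C \<phi> \<psi>"
    "smooth_on N \<phi>" "smooth_on C \<psi>" "\<And>x y J. x \<in> C \<Longrightarrow> y \<in> C \<Longrightarrow> glue J x y \<in> C"
    "\<And>z. z \<in> N \<Longrightarrow> bij (fderiv \<phi> z)"
    "\<And>z h. z \<in> N \<Longrightarrow> proj K (fderiv \<phi> z (G z *v h)) = fderiv \<phi> z (G z *v proj K h)"
proof -
  obtain N1 g1 where g1: "open N1" "0 \<in> N1" "N1 \<subseteq> Q" "smooth_on N1 g1" "g1 0 = 0"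
    "\<And>k. fderiv g1 0 k = k"
    "\<And>z h. z \<in> N1 \<Longrightarrow> proj K h = h \<Longrightarrow> fderiv g1 z (G z *v h) = h"
    using frobenius[OF Q G, of K] comm by blast
  obtain N2 g2 where g2: "open N2" "0 \<in> N2" "N2 \<subseteq> Q" "smooth_on N2 g2" "g2 0 = 0"
    "\<And>k. fderiv g2 0 k = k"
    "\<And>z h. z \<in> N2 \<Longrightarrow> proj (- K) h = h \<Longrightarrow> fderiv g2 z (G z *v h) = h"
    using frobenius[OF Q G, of "- K"] comm by blast
  define \<phi> where "\<phi> z = proj (- K) (g1 z) + proj K (g2 z)" for z
  let ?N = "N1 \<inter> N2"
  have N: "open ?N" "0 \<in> ?N" using g1 g2 by auto
  have s: "smooth_on ?N g1" "smooth_on ?N g2" using smooth_on_subset g1(4) g2(4) by blast+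
  have smp: "smooth_on ?N \<phi>"
    unfolding \<phi>_def[abs_def]
    by (intro smooth_on_add smooth_on_linear_compose[OF N(1) bounded_linear_proj] s N)
  let ?D = "\<lambda>z. fderiv \<phi> z"
  have D: "?D z v = proj (- K) (fderiv g1 z v) + proj K (fderiv g2 z v)"
    if "z \<in> ?N" for z v
    using frechet_derivativeI[OF has_derivative_add[OF
        bounded_linear.has_derivative[OF bounded_linear_proj smooth_on_has_derivative[OF s(1) that]]
        bounded_linear.has_derivative[OF bounded_linear_proj smooth_on_has_derivative[OF s(2) that]]]]
    by (simp add: \<phi>_def[abs_def])
  have "?D 0 = id"
    using D[OF N(2)] g1(6) g2(6) proj_add_compl[of K] by (auto simp: add.commute)
  then have "inj (?D 0)" by simp
  then obtain U V \<psi> where U: "open U" "U \<subseteq> ?N" "0 \<in> U" "open V" "homeomorphism U V \<phi> \<psi>" "smooth_on V \<psi>"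
    "\<And>x. x \<in> U \<Longrightarrow> bij (?D x)"
    using smooth_inverse_function[OF N(1) smp N(2)] by metis
  have \<phi>0: "\<phi> 0 = 0" by (simp add: \<phi>_def g1(5) g2(5))
  have "0 \<in> V" using U(3,5) \<phi>0 by (metis homeomorphism_def imageI)
  then obtain C where C: "open C" "0 \<in> C" "C \<subseteq> V" "\<And>x y J. x \<in> C \<Longrightarrow> y \<in> C \<Longrightarrow> glue J x y \<in> C"
    using ex_cube[OF U(4)] by blast
  define N' where "N' = U \<inter> \<phi> -` C"
  have sub: "N' \<subseteq> U" by (simp add: N'_def)
  have smU: "smooth_on U \<phi>" using smooth_on_subset[OF smp U(2)] .
  show ?thesis
  proof (rule that[of N' C \<phi> \<psi>])
    show "open N'" unfolding N'_def
      by (rule continuous_open_preimage[OF smooth_on_continuous[OF smU] U(1) C(1)])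
    show "0 \<in> N'" using U(3) C(2) \<phi>0 by (simp add: N'_def)
    show "N' \<subseteq> Q" using sub U(2) g1(3) by blast
    have "\<phi> ` N' = C"
    proof
      show "C \<subseteq> \<phi> ` N'"
      proof
        fix y assume y: "y \<in> C"
        then have "\<psi> y \<in> U" "\<phi> (\<psi> y) = y" using U(5) C(3) by (auto simp: homeomorphism_def)
        then have "\<psi> y \<in> N'" using y by (simp add: N'_def)
        then show "y \<in> \<phi> ` N'" using \<open>\<phi> (\<psi> y) = y\<close> by (metis imageI)
      qed
    qed (auto simp: N'_def)
    then show "homeomorphism N' C \<phi> \<psi>"
      using homeomorphism_of_subsets[OF U(5) sub C(3)] by simp
    show "proj K (?D z (G z *v h)) = ?D z (G z *v proj K h)" if "z \<in> N'" for z h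
    proof -
      have z: "z \<in> ?N" using that sub U(2) by blast
      have lin: "linear (?D z)"
        using smooth_on_bounded_linear[OF smp z] bounded_linear.linear by blast
      have "?D z (G z *v proj K h) = proj K (fderiv g2 z (G z *v proj K h))"
        using D[OF z] g1(7)[of z "proj K h"] z by simp
      then have 1: "proj K (?D z (G z *v proj K h)) = ?D z (G z *v proj K h)" by simp
      have "?D z (G z *v proj (- K) h) = proj (- K) (fderiv g1 z (G z *v proj (- K) h))"
        using D[OF z] g2(7)[of z "proj (- K) h"] z by simp
      then have 2: "proj K (?D z (G z *v proj (- K) h)) = 0" by simp
      have "?D z (G z *v h) = ?D z (G z *v proj K h) + ?D z (G z *v proj (- K) h)"
        using linear_add[OF lin] by (metis matrix_vector_right_distrib proj_add_compl)
      then show ?thesis using 1 2 by (simp add: proj_add)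
    qed
  qed (use C U smooth_on_subset[OF smU sub] smooth_on_subset[OF U(6) C(3)] sub in blast)+
qed

lemma splitting_theorem:
  fixes X :: "'a topology" and \<A> :: "('a, 'n::finite) chart set" and K :: "'n set"
  assumes m: "m \<ge> 1" and man: "smooth_manifold X \<A>" and op: "operator_field X \<A> L"
    and T: "operator_torsion_vanishes m X \<A> L"
    and chi: "has_charpoly_at X \<A> L p (p1 * p2)" and cop: "coprime p1 p2"
    and monic: "lead_coeff p1 = 1" "lead_coeff p2 = 1"
    and K: "card K = degree p1" "card (- K) = degree p2"
  shows "\<exists>c\<in>coordinate_systems X \<A>. p \<in> fst c \<and>
    block_diagonal_on K (snd c ` fst c) (L c) \<and> splitting_conditions K m (snd c ` fst c) (L c)"
proof -
  obtain c where c: "c \<in> coordinate_systems X \<A>" "p \<in> fst c" "charpoly (L c (snd c p)) = p1 * p2"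
    using chi unfolding has_charpoly_at_def by blast
  have open_im: "open (snd c ` fst c)" if "c \<in> coordinate_systems X \<A>" for c :: "('a, 'n) chart"
    using that by (simp add: coordinate_systems_def is_chart_def)
  have smL: "smooth_on (snd c ` fst c) (L c)" if "c \<in> coordinate_systems X \<A>" for c :: "('a, 'n) chart"
    using op that by (simp add: operator_field_def)
  have "p1 \<noteq> 0" "p2 \<noteq> 0" using monic by auto
  then obtain A B where AB: "A ** B = mat 1" "B ** A = mat 1"
    and M0: "block_diag K (A ** L c (snd c p) ** B)" "separated K (A ** L c (snd c p) ** B)"
    using matrix_splitting[OF c(3) cop _ _ K] by metis
  have ABv: "A *v (B *v v) = v" "B *v (A *v v) = v" for v
    using AB by (simp_all add: matrix_vector_mul_assoc)
  \<comment> \<open>An affine change of coordinates moves \<open>p\<close> to the origin and makes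
    \<open>L\<close> block diagonal and separated there, as \<open>smooth_splitting\<close>
    demands.\<close>
  define \<alpha> where "\<alpha> z = A *v (z - snd c p)" for z
  define \<beta> where "\<beta> y = B *v y + snd c p" for y
  let ?W = "snd c ` fst c"
  have \<alpha>\<beta>: "\<alpha> (\<beta> y) = y" "\<beta> (\<alpha> z) = z" for y z by (simp_all add: \<alpha>_def \<beta>_def ABv)
  have sm\<alpha>\<beta>: "smooth_on S \<alpha>" "smooth_on S \<beta>" if "open S" for S
    unfolding \<alpha>_def[abs_def] \<beta>_def[abs_def]
    by (intro smooth_on_matrix_vector_mult smooth_on_diff smooth_on_add smooth_on_const smooth_on_linear that
        bounded_linear_ident matrix_vector_mul_bounded_linear)+
  have im: "\<alpha> ` ?W = \<beta> -` ?W" using \<alpha>\<beta> by (auto simp: image_iff) (metis imageI)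
  have oV: "open (\<alpha> ` ?W)"
    unfolding im by (rule open_vimage[OF open_im[OF c(1)] smooth_on_continuous[OF sm\<alpha>\<beta>(2)]]) simp
  have hom: "homeomorphism ?W (\<alpha> ` ?W) \<alpha> \<beta>"
    using \<alpha>\<beta> smooth_on_continuous[OF sm\<alpha>\<beta>(1)[OF open_im[OF c(1)]]] smooth_on_continuous[OF sm\<alpha>\<beta>(2)[OF oV]]
    by (simp add: homeomorphism_def image_image)
  define c1 where "c1 = restrict_chart c ?W \<alpha>"
  have c1: "c1 \<in> coordinate_systems X \<A>"
    unfolding c1_def
    by (rule restrict_chart_coordinate_system[OF man c(1) open_im[OF c(1)] order_refl oV hom sm\<alpha>\<beta>(1)[OF open_im[OF c(1)]] sm\<alpha>\<beta>(2)[OF oV]])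
  have p1: "p \<in> fst c1" "snd c1 p = 0" using c(2) by (simp_all add: c1_def restrict_chart_def \<alpha>_def)
  have "(\<alpha> has_derivative (\<lambda>v. A *v v)) (at z)" for z
    unfolding \<alpha>_def[abs_def]
    by (rule has_derivative_eq_rhs[OF bounded_linear.has_derivative[OF matrix_vector_mul_bounded_linear
          has_derivative_diff[OF has_derivative_ident has_derivative_const]]]) simp
  from frechet_derivativeI[OF this] have D\<alpha>: "matrix (fderiv \<alpha> z) = A" for z by simp
  have "snd c p \<in> ?W" using c(2) by blast
  from operator_field_restrict_chart[OF op c(1) c1[unfolded c1_def] open_im[OF c(1)] order_refl this]
  have "L c1 0 ** A = A ** L c (snd c p)" by (simp add: D\<alpha> c1_def[symmetric]) (simp add: \<alpha>_def)
  then have "L c1 0 = A ** L c (snd c p) ** B" using AB(1) by (metis matrix_mul_assoc matrix_mul_rid)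
  then have L0: "block_diag K (L c1 0)" "separated K (L c1 0)" using M0 by simp_all
  have z1: "0 \<in> snd c1 ` fst c1" using p1 by force
  obtain Q G M where Q: "open Q" "0 \<in> Q" "Q \<subseteq> snd c1 ` fst c1" and GM: "smooth_on Q G" "smooth_on Q M" "G 0 = mat 1"
    "\<And>z. z \<in> Q \<Longrightarrow> L c1 z ** G z = G z ** M z" "\<And>z. z \<in> Q \<Longrightarrow> block_diag K (M z)"
    "\<And>z. z \<in> Q \<Longrightarrow> separated K (M z)" "\<And>z. z \<in> Q \<Longrightarrow> invertible (G z)"
    "\<And>z h. z \<in> Q \<Longrightarrow> proj K h = h \<Longrightarrow> proj K (G z *v h) = h"
    "\<And>z h. z \<in> Q \<Longrightarrow> proj (- K) h = h \<Longrightarrow> proj (- K) (G z *v h) = h"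
    using smooth_splitting[OF open_im[OF c1] z1 smL[OF c1] L0] by blast
  \<comment> \<open>Vanishing torsion is tested on fields that are smooth on a whole chart image.
    The frame lives on \<open>Q\<close> only, so \<open>Q\<close> is made a chart image of its
    own.\<close>
  define c2 where "c2 = restrict_chart c1 Q (\<lambda>z. z)"
  have c2: "c2 \<in> coordinate_systems X \<A>"
    unfolding c2_def
    by (rule restrict_chart_coordinate_system[OF man c1 Q(1,3) Q(1), where \<psi> = "\<lambda>z. z"])
      (auto intro: smooth_on_linear Q(1) bounded_linear_ident simp: homeomorphism_def)
  have im2: "snd c2 ` fst c2 = Q" using image_restrict_chart(2)[OF Q(3), of "\<lambda>z. z"] by (simp add: c2_def)
  have p2: "p \<in> fst c2" "snd c2 p = 0" using p1 Q(2) by (simp_all add: c2_def restrict_chart_def)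
  have L2: "L c2 z = L c1 z" if "z \<in> Q" for z
  proof -
    have "matrix (fderiv (\<lambda>z::real^'n. z) z) = mat 1"
      using matrix_id_mat_1 by (simp add: frechet_derivativeI[OF has_derivative_ident] id_def)
    then show ?thesis
      using operator_field_restrict_chart[OF op c1 c2[unfolded c2_def] Q(1,3) that] by (simp add: c2_def)
  qed
  have LG: "L c2 z ** G z = G z ** M z" if "z \<in> Q" for z using GM(4)[OF that] L2[OF that] by simp
  have sm2: "smooth_on Q (L c2)" and T2: "torsion_vanishes m Q (L c2)"
    using smL[OF c2] T c2 im2 by (auto simp: operator_torsion_vanishes_def)
  have block_diag': "block_diag (- K) (M z)" "separated (- K) (M z)" if "z \<in> Q" for z
    using GM(5,6)[OF that] by (simp_all add: block_diag_compl separated_compl)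
  have comm: "fderiv G z (G z *v h) *v k = fderiv G z (G z *v k) *v h"
    if "z \<in> Q" "J = K \<or> J = - K" "proj J h = h" "proj J k = k" for z h k J
    using that(2)
  proof
    assume J: "J = K"
    show ?thesis
      by (rule torsion_imp_involutive[OF Q(1) sm2 GM(1,2) LG GM(5,6,7,8) T2 that(1)]) (use that J in auto)
  next
    assume J: "J = - K"
    show ?thesis
      by (rule torsion_imp_involutive[OF Q(1) sm2 GM(1,2) LG block_diag' GM(7,9) T2 that(1)]) (use that J in auto)
  qed
  obtain N C \<phi> \<psi> where N: "open N" "0 \<in> N" "N \<subseteq> Q" "open C" "homeomorphism N C \<phi> \<psi>"
    "smooth_on N \<phi>" "smooth_on C \<psi>" "\<And>x y J. x \<in> C \<Longrightarrow> y \<in> C \<Longrightarrow> glue J x y \<in> C"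
    "\<And>z. z \<in> N \<Longrightarrow> bij (fderiv \<phi> z)"
    "\<And>z h. z \<in> N \<Longrightarrow> proj K (fderiv \<phi> z (G z *v h)) = fderiv \<phi> z (G z *v proj K h)"
  proof (rule ex_splitting_diffeomorphism[OF Q(1,2) GM(1,3), of K])
    show "fderiv G z (G z *v h) *v k = fderiv G z (G z *v k) *v h"
      if "z \<in> Q" "J = K \<or> J = - K" "proj J h = h" "proj J k = k" for z h k J
      using that by (rule comm)
  qed (rule that, assumption+)
  have N2: "N \<subseteq> snd c2 ` fst c2" using N(3) im2 by simp
  define c3 where "c3 = restrict_chart c2 N \<phi>"
  have c3: "c3 \<in> coordinate_systems X \<A>"
    unfolding c3_def by (rule restrict_chart_coordinate_system[OF man c2 N(1) N2 N(4,5,6,7)])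
  have im3: "snd c3 ` fst c3 = C"
    using image_restrict_chart(2)[OF N2, of \<phi>] N(5) by (simp add: c3_def homeomorphism_def)
  have p3: "p \<in> fst c3" using p2 N(2) by (simp add: c3_def restrict_chart_def)
  have L3: "block_diag K (L c3 x) \<and> separated K (L c3 x)" if x: "x \<in> C" for x
  proof -
    obtain z where z: "z \<in> N" "x = \<phi> z" using x N(5) by (auto simp: homeomorphism_def)
    have zQ: "z \<in> Q" using z N(3) by blast
    let ?D = "fderiv \<phi> z" and ?J = "matrix (fderiv \<phi> z)"
    have lin: "linear ?D" using smooth_on_bounded_linear[OF N(6) z(1)] bounded_linear.linear by blast
    have J: "?J *v v = ?D v" for v using fun_cong[OF matrix_vector_mul(2)[OF lin]] by simp
    have "inj (\<lambda>v. ?J *v v)" using N(9)[OF z(1)] J by (simp add: bij_def)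
    then have invJ: "invertible ?J" using invertible_left_inverse matrix_left_invertible_injective by blast
    have LJ: "L c3 x ** ?J = ?J ** L c2 z"
      using operator_field_restrict_chart[OF op c2 c3[unfolded c3_def] N(1) N2 z(1)] z(2) by (simp add: c3_def)
    \<comment> \<open>In the frame \<open>G\<close> the operator is \<open>M z\<close>. Since
      \<open>\<phi>\<close> straightens both distributions, the product of its Jacobian with
      \<open>G z\<close> is block diagonal, so \<open>L\<close> in the new chart is conjugate to
      \<open>M z\<close> by a block diagonal matrix.\<close>
    have bdH: "block_diag K (?J ** G z)"
      using N(10)[OF z(1)] by (simp add: block_diag_iff matrix_vector_mul_assoc[symmetric] J)
    have "L c3 x ** (?J ** G z) = ?J ** (L c2 z ** G z)" using LJ by (simp add: matrix_mul_assoc)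
    then have LH: "L c3 x ** (?J ** G z) = (?J ** G z) ** M z" using LG[OF zQ] by (simp add: matrix_mul_assoc)
    show ?thesis
      using block_diag_separated_conj[OF bdH invertible_mult[OF invJ GM(7)[OF zQ]] LH GM(5,6)[OF zQ]] by blast
  qed
  have "block_diagonal_on K C (L c3)" using L3 by (simp add: block_diagonal_on_block_diag)
  moreover have "splitting_conditions K m C (L c3)"
  proof (rule torsion_imp_splitting_conditions[OF m N(4) N(8)])
    show "smooth_on C (L c3)" using smL[OF c3] im3 by simp
    show "torsion_vanishes m C (L c3)" using T c3 im3 by (auto simp: operator_torsion_vanishes_def)
  qed (use calculation L3 in blast)+
  ultimately show ?thesis using c3 p3 im3 by blast
qed

theorem mainTheorem6:
  fixes m :: nat
  assumes "m \<ge> 1"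
  shows
    "(\<forall>(X :: 'a topology) (\<A> :: ('a, 'n::finite) chart set) L p p1 p2 (K :: 'n set).
        smooth_manifold X \<A> \<and> operator_field X \<A> L \<and> operator_torsion_vanishes m X \<A> L \<and>
        p \<in> topspace X \<and> has_charpoly_at X \<A> L p (p1 * p2) \<and>
        coprime p1 p2 \<and> lead_coeff p1 = 1 \<and> lead_coeff p2 = 1 \<and>
        card K = degree p1 \<and> card (- K) = degree p2 \<longrightarrow>
        (\<exists>c\<in>coordinate_systems X \<A>. p \<in> fst c \<and>
           block_diagonal_on K (snd c ` fst c) (L c) \<and>
           splitting_conditions K m (snd c ` fst c) (L c)))
     \<and>
     (\<forall>(K :: 'n set) W (F :: real ^ 'n \<Rightarrow> real ^ 'n ^ 'n).
        open W \<and> smooth_on W F \<and> block_diagonal_on K W F \<and> splitting_conditions K m W F \<longrightarrow>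
        torsion_vanishes m W F)"
proof (intro conjI allI impI; elim conjE)
  fix X :: "'a topology" and \<A> :: "('a, 'n) chart set" and L p p1 p2 and K :: "'n set"
  assume "smooth_manifold X \<A>" "operator_field X \<A> L" "operator_torsion_vanishes m X \<A> L"
    "has_charpoly_at X \<A> L p (p1 * p2)" "coprime p1 p2" "lead_coeff p1 = 1" "lead_coeff p2 = 1"
    "card K = degree p1" "card (- K) = degree p2"
  then show "\<exists>c\<in>coordinate_systems X \<A>. p \<in> fst c \<and>
      block_diagonal_on K (snd c ` fst c) (L c) \<and> splitting_conditions K m (snd c ` fst c) (L c)"
    by (rule splitting_theorem[OF assms])
next
  fix K :: "'n set" and W and F :: "real ^ 'n \<Rightarrow> real ^ 'n ^ 'n"
  assume "open W" "smooth_on W F" "block_diagonal_on K W F" "splitting_conditions K m W F"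
  then show "torsion_vanishes m W F" by (rule splitting_conditions_imp_torsion[OF assms])
qed

end
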